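(* Define the formal power series (convergent for $|q|<1$) \[ Q_{10}(q):=\frac{(q;q^{10})_\infty\,(q^9;q^{10})_\infty}{(q^3;q^{10})_\infty\,(q^7;q^{10})_\infty},\qquad (a;q)_\infty:=\prod_{j\ge 0}(1-aq^j), \] and for $\delta\in\{1,-1\}$ write $Q_{10}(q)^{\delta}=\sum_{n\ge 0}c_\delta(n)q^n$. Then: \begin{enumerate} \item $c_1(n)=0$ for $n\in\{2,5,7,9,15,17,22,27,37,47\}$, and for every other integer $n\ge 0$ we have $\operatorname{sgn}(c_1(n))=1$ if $n\equiv 0,2,3,6,9\pmod{10}$ and $\operatorname{sgn}(c_1(n))=-1$ otherwise; \item $c_{-1}(n)=0$ for $n\in\{3,4,5,6,9,13,19,23,29,39\}$, and for every other integer $n\ge 0$ we have $\operatorname{sgn}(c_{-1}(n))=1$ if $n\equiv 0,1,2,3,9\pmod{10}$ and $\operatorname{sgn}(c_{-1}(n))=-1$ otherwise. \end{enumerate}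
   Context: $\operatorname{sgn}(x)\in\{1,0,-1\}$ denotes the sign of a real number $x$. *)

theory Defs
  imports "HOL-Analysis.Analysis"
begin

text \<open>
  The infinite product \<open>(a; q)\<^sub>\<infinity>\<close> of formal power series. The operator \<^const>\<open>prodinf\<close> is taken
  with respect to the library topology on formal power series, in which a sequence converges
  iff each coefficient is eventually constant; \<open>convergent_prod_qpoch_inf\<close> below shows that
  the product exists whenever \<open>a\<close> and \<open>q\<close> have zero constant term.
\<close>

definition qpoch_inf :: "real fps \<Rightarrow> real fps \<Rightarrow> real fps" where
  "qpoch_inf a q = (\<Prod>j. 1 - a * q ^ j)"

definition Q10 :: "real fps" where
  "Q10 = (qpoch_inf fps_X (fps_X ^ 10) * qpoch_inf (fps_X ^ 9) (fps_X ^ 10)) /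
         (qpoch_inf (fps_X ^ 3) (fps_X ^ 10) * qpoch_inf (fps_X ^ 7) (fps_X ^ 10))"

definition c :: "int \<Rightarrow> nat \<Rightarrow> real" where
  "c \<delta> n = fps_nth (Q10 powi \<delta>) n"

lemma convergent_prod_qpoch_inf:
  fixes a q :: "real fps"
  assumes "fps_nth a 0 = 0" and "fps_nth q 0 = 0"
  shows "convergent_prod (\<lambda>j. 1 - a * q ^ j)"
proof -
  define f where "f = (\<lambda>j. 1 - a * q ^ j)"
  define P where "P = (\<lambda>N. \<Prod>i\<le>N. f i)"
  have X_dvd: "fps_X dvd h" if "fps_nth h 0 = 0" for h :: "real fps"
  proof
    show "h = fps_X * fps_shift 1 h"
      using that by (auto simp: fps_eq_iff)
  qed
  have low: "fps_nth (g * (a * q ^ j)) k = 0" if "k \<le> j" for g :: "real fps" and j k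
  proof -
    obtain a' where a': "a = fps_X * a'"
      using X_dvd[OF assms(1)] unfolding dvd_def by blast
    obtain q' where q': "q = fps_X * q'"
      using X_dvd[OF assms(2)] unfolding dvd_def by blast
    have "g * (a * q ^ j) = fps_X ^ Suc j * (g * a' * q' ^ j)"
      by (simp add: a' q' power_mult_distrib mult_ac)
    thus ?thesis
      using that by (simp only: fps_X_power_mult_nth) simp
  qed
  have step: "fps_nth (P (Suc N)) k = fps_nth (P N) k" if "k \<le> N" for N k
  proof -
    have "P (Suc N) = P N - P N * (a * q ^ Suc N)"
      by (simp add: P_def f_def algebra_simps)
    thus ?thesis using low[of k "Suc N" "P N"] that by simp
  qed
  have stable: "fps_nth (P N) k = fps_nth (P k) k" if "k \<le> N" for N k
    using that by (induction N rule: dec_induct) (auto simp: step)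
  define L where "L = Abs_fps (\<lambda>k. fps_nth (P k) k)"
  have "P \<longlonglongrightarrow> L"
  proof (rule tendsto_fpsI)
    fix k
    show "\<forall>\<^sub>F N in sequentially. fps_nth (P N) k = fps_nth L k"
      using eventually_ge_at_top[of k] by eventually_elim (simp add: L_def, rule stable)
  qed
  moreover have "fps_nth L 0 = 1"
    using assms by (simp add: L_def P_def f_def)
  hence "L \<noteq> 0" by auto
  ultimately have "raw_has_prod f 0 L"
    by (simp add: raw_has_prod_def P_def)
  thus ?thesis unfolding convergent_prod_def f_def by blast
qed

end

theory Submission
  imports Defs
begin

text \<open>
  With \<open>\<theta>\<^sub>a(q) = \<Sum>\<^sub>n (-1)\<^sup>n q\<^bsup>5n(n-1) + an\<^esup>\<close>, Jacobi's triple product gives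
  \<open>Q10 = \<theta>\<^sub>1 / \<theta>\<^sub>3\<close>. Multiplying by \<open>\<theta>\<^sub>3(-q)\<close> makes the denominator even, and separating the double
  series \<open>\<theta>\<^sub>1(q) \<theta>\<^sub>3(-q)\<close> by parity shows that the coefficients at odd indices are those of
  \<open>- \<theta>\<^sub>1 J\<^sub>1\<^sub>0 / J\<^sub>5\<^sup>2\<close> and those at even indices are those of \<open>\<psi> \<theta>\<^sub>1 / (J\<^sub>5 J\<^sub>1\<^sub>0)\<close>, where \<open>J\<^sub>m\<close> is the product of all
  \<open>1 - q\<close> to the powers \<open>m, 2m, 3m, ...\<close> and \<open>\<psi>\<close> is the generating function of the triangular
  numbers. As these denominators are series in \<open>q\<^sup>5\<close>, splitting the numerators modulo 5 expresses
  each residue class modulo 10 through the generating functions \<open>P\<^sub>b\<close> of the partitions into parts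
  not congruent to \<open>0, b, -b\<close> modulo 50. An odd class is a single product and visibly
  has one sign. An even class is a signed combination of three terms
  \<open>A P\<^sub>b\<close>, \<open>B P\<^sub>d\<close>, \<open>C P\<^sub>e\<close>, where \<open>A\<close>, \<open>B\<close>, \<open>C\<close> are the components of \<open>\<psi>\<close>. Its sign is settled by two
  comparisons: the \<open>P\<^sub>b\<close> lie on the bottom shelf of a Gordon-type recursion with nonnegative
  coefficients, so that differences \<open>P\<^sub>b - P\<^sub>d\<close> are nonnegative and controlled from both sides, and the
  exponents of \<open>A\<close>, \<open>B\<close>, \<open>C\<close> interlace. The finitely many coefficients to which these estimates do not
  apply follow from the recurrence given by \<open>Q10 \<theta>\<^sub>3 = \<theta>\<^sub>1\<close>. Exchanging \<open>\<theta>\<^sub>1\<close> and \<open>\<theta>\<^sub>3\<close> treats \<open>1 / Q10\<close>.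
\<close>

text \<open>The strength of the comparisons depends on small parts. \<open>P b\<close> with
  \<open>b > 1\<close> counts partitions that may use the part 1, so \<open>P b * K\<close> has
  nondecreasing coefficients; for \<open>P 1\<close> and the upper shelves only the part 2 in
  \<open>K\<close> is at hand, which gives monotonicity along each parity class. In most even
  classes all three \<open>P b\<close> can be moved to a common one, and a matching of exponents
  decides. The classes 4 and 8 modulo 10 of \<open>1 / Q10\<close> are harder: there one term has to
  outweigh both others, and the growth of \<open>P b\<close> with \<open>b\<close> has to be used
  quantitatively. The common unit for it is \<open>g 12\<close>: each step from \<open>P b\<close>
  to \<open>P (b + 2)\<close> with odd \<open>b \<le> 11\<close> adds at least
  \<open>q^b (1 + q) g 12\<close>, while \<open>g 24\<close>, the largest entry of that shelf, is at
  most \<open>(1 + q^24) g 12\<close>. The number 110 of computed coefficients is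
  \<open>10 * 11\<close>: the estimate for class 2 modulo 10 of \<open>Q10\<close> rests on a term
  that is seen to be positive only from quotient 11 on, and all other estimates start
  earlier.\<close>

unbundle no vec_syntax
notation fps_nth (infixl "$" 75)

section \<open>Formal power series as weighted counting series\<close>

definition gf :: "'i set \<Rightarrow> ('i \<Rightarrow> real) \<Rightarrow> ('i \<Rightarrow> nat) \<Rightarrow> real fps" where
  "gf I s e = Abs_fps (\<lambda>k. \<Sum>i | i \<in> I \<and> e i = k. s i)"

text \<open>A sum over an infinite set is 0 by convention, so \<open>gf\<close> is the intended
  series only if each exponent is attained finitely often. The form with \<open>\<le>\<close> is the
  one that the product formula needs.\<close>

definition adm :: "'i set \<Rightarrow> ('i \<Rightarrow> nat) \<Rightarrow> bool" where
  "adm I e \<longleftrightarrow> (\<forall>k. finite {i \<in> I. e i \<le> k})"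

lemma gf_nth: "gf I s e $ k = (\<Sum>i | i \<in> I \<and> e i = k. s i)"
  by (simp add: gf_def)

lemma adm_eq_finite:
  assumes "adm I e" shows "finite {i \<in> I. e i = k}"
  by (rule finite_subset[of _ "{i \<in> I. e i \<le> k}"]) (use assms in \<open>auto simp: adm_def\<close>)

lemma adm_subset:
  assumes "adm I e" "J \<subseteq> I" shows "adm J e"
  unfolding adm_def
proof
  fix k
  show "finite {i \<in> J. e i \<le> k}"
    by (rule finite_subset[of _ "{i \<in> I. e i \<le> k}"]) (use assms in \<open>auto simp: adm_def\<close>)
qed

lemma adm_nat:
  assumes "\<And>n::nat. n \<le> e n" shows "adm UNIV e"
  unfolding adm_def
proof
  fix k
  show "finite {i \<in> UNIV. e i \<le> k}"
    by (rule finite_subset[of _ "{..k}"]) (use assms order_trans in auto)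
qed

lemma adm_int: "(\<And>n::int. \<bar>n\<bar> \<le> int (e n)) \<Longrightarrow> adm UNIV e"
  unfolding adm_def
proof (intro allI)
  fix k assume *: "\<And>n::int. \<bar>n\<bar> \<le> int (e n)"
  have "{i \<in> UNIV. e i \<le> k} \<subseteq> {- int k..int k}"
  proof
    fix n assume "n \<in> {i \<in> UNIV. e i \<le> k}"
    thus "n \<in> {- int k..int k}" using *[of n] by auto
  qed
  thus "finite {i \<in> UNIV. e i \<le> k}" by (rule finite_subset) simp
qed

lemma gf_mult_nth:
  assumes "adm I e"
  shows "(gf I s e * f) $ k = (\<Sum>i | i \<in> I \<and> e i \<le> k. s i * f $ (k - e i))"
proof -
  let ?S = "{i \<in> I. e i \<le> k}"
  have fin: "finite ?S" using assms by (auto simp: adm_def)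
  have "(gf I s e * f) $ k = (\<Sum>j=0..k. \<Sum>i\<in>{i \<in> ?S. e i = j}. s i * f $ (k - e i))"
    unfolding fps_mult_nth gf_nth sum_distrib_right
    by (intro sum.cong) auto
  also have "\<dots> = (\<Sum>i\<in>?S. s i * f $ (k - e i))"
    by (rule sum.group) (use fin in auto)
  finally show ?thesis by simp
qed

lemma gf_mult:
  assumes "adm I e" "adm J d"
  shows "gf I s e * gf J t d = gf (I \<times> J) (\<lambda>(i, j). s i * t j) (\<lambda>(i, j). e i + d j)"
proof (rule fps_ext)
  fix k
  have "(gf I s e * gf J t d) $ k =
      (\<Sum>i | i \<in> I \<and> e i \<le> k. \<Sum>j | j \<in> J \<and> d j = k - e i. s i * t j)"
    by (simp add: gf_mult_nth[OF assms(1)] gf_nth sum_distrib_left)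
  also have "\<dots> = (\<Sum>(i, j)\<in>Sigma {i \<in> I. e i \<le> k} (\<lambda>i. {j \<in> J. d j = k - e i}). s i * t j)"
    by (rule sum.Sigma) (use assms in \<open>auto simp: adm_eq_finite, auto simp: adm_def\<close>)
  also have "Sigma {i \<in> I. e i \<le> k} (\<lambda>i. {j \<in> J. d j = k - e i}) =
      {p \<in> I \<times> J. (case p of (i, j) \<Rightarrow> e i + d j) = k}"
    by auto
  finally show "(gf I s e * gf J t d) $ k = gf (I \<times> J) (\<lambda>(i, j). s i * t j) (\<lambda>(i, j). e i + d j) $ k"
    by (simp add: gf_nth)
qed

lemma gf_reindex:
  assumes "bij_betw h J I" "\<And>j. j \<in> J \<Longrightarrow> s (h j) = t j" "\<And>j. j \<in> J \<Longrightarrow> e (h j) = d j"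
  shows "gf I s e = gf J t d"
proof (rule fps_ext)
  fix k
  have "bij_betw h {j \<in> J. d j = k} {i \<in> I. e i = k}"
    using assms(1,3) unfolding bij_betw_def inj_on_def by (auto simp: image_iff)
  from sum.reindex_bij_betw[OF this, of s]
  have "(\<Sum>i | i \<in> I \<and> e i = k. s i) = (\<Sum>j | j \<in> J \<and> d j = k. s (h j))" by simp
  also have "\<dots> = (\<Sum>j | j \<in> J \<and> d j = k. t j)"
    by (intro sum.cong) (use assms in auto)
  finally show "gf I s e $ k = gf J t d $ k" by (simp add: gf_nth)
qed

lemma gf_cong:
  "I = J \<Longrightarrow> (\<And>i. i \<in> J \<Longrightarrow> s i = t i) \<Longrightarrow> (\<And>i. i \<in> J \<Longrightarrow> e i = d i) \<Longrightarrow> gf I s e = gf J t d"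
  by (rule gf_reindex[of id]) auto

lemma gf_Un:
  assumes "adm (I \<union> J) e" "I \<inter> J = {}"
  shows "gf (I \<union> J) s e = gf I s e + gf J s e"
proof (rule fps_ext)
  fix k
  have "{i \<in> I \<union> J. e i = k} = {i \<in> I. e i = k} \<union> {i \<in> J. e i = k}" by auto
  moreover have "finite {i \<in> I \<union> J. e i = k}" using adm_eq_finite[OF assms(1)] .
  ultimately show "gf (I \<union> J) s e $ k = (gf I s e + gf J s e) $ k"
    unfolding gf_nth fps_add_nth using assms(2)
    by (simp only:) (subst sum.union_disjoint, auto)
qed

lemma gf_const_mult: "gf I (\<lambda>i. a * s i) e = fps_const a * gf I s e"
  by (rule fps_ext) (simp add: gf_nth sum_distrib_left)

lemma gf_minus: "gf I (\<lambda>i. - s i) e = - gf I s e"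
  by (rule fps_ext) (simp add: gf_nth sum_negf)

lemma gf_shift: "fps_X ^ a * gf I s e = gf I s (\<lambda>i. a + e i)"
proof (rule fps_ext)
  fix k
  have "{i \<in> I. e i = k - a} = {i \<in> I. a + e i = k}" if "a \<le> k" using that by auto
  moreover have "{i \<in> I. a + e i = k} = {}" if "\<not> a \<le> k" using that by auto
  ultimately show "(fps_X ^ a * gf I s e) $ k = gf I s (\<lambda>i. a + e i) $ k"
    unfolding fps_X_power_mult_nth gf_nth by (cases "a \<le> k") (simp_all add: not_le)
qed

lemma nth_compose_X_power:
  fixes f :: "real fps"
  assumes "d > 0"
  shows "(f oo fps_X ^ d) $ n = (if d dvd n then f $ (n div d) else 0)"
proof -
  have "(f oo fps_X ^ d) $ n = (\<Sum>i=0..n. if d * i = n then f $ i else 0)"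
    unfolding fps_compose_nth by (intro sum.cong) (auto simp flip: power_mult)
  also have "\<dots> = (if d dvd n then f $ (n div d) else 0)"
  proof (cases "d dvd n")
    case True
    then obtain m where m: "n = d * m" by auto
    have "(\<Sum>i=0..n. if d * i = n then f $ i else 0) = (\<Sum>i=0..n. if i = m then f $ i else 0)"
      using m assms by (intro sum.cong) auto
    thus ?thesis using m assms by simp
  next
    case False
    hence "(\<Sum>i=0..n. if d * i = n then f $ i else 0) = 0" by (intro sum.neutral) auto
    thus ?thesis using False by simp
  qed
  finally show ?thesis .
qed

lemma gf_compose_X_power:
  assumes "d > 0"
  shows "gf I s e oo fps_X ^ d = gf I s (\<lambda>i. d * e i)"
proof (rule fps_ext)
  fix k
  show "(gf I s e oo fps_X ^ d) $ k = gf I s (\<lambda>i. d * e i) $ k"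
  proof (cases "d dvd k")
    case True
    hence "{i \<in> I. e i = k div d} = {i \<in> I. d * e i = k}" using assms by auto
    thus ?thesis using assms True by (simp add: nth_compose_X_power gf_nth)
  next
    case False
    hence "{i \<in> I. d * e i = k} = {}" by auto
    thus ?thesis using assms False by (simp add: nth_compose_X_power gf_nth del: Collect_empty_eq)
  qed
qed

section \<open>Extraction of residue classes, and the substitution of \<open>-q\<close> for
  \<open>q\<close>\<close>

definition sec :: "nat \<Rightarrow> nat \<Rightarrow> real fps \<Rightarrow> real fps" where
  "sec d r f = Abs_fps (\<lambda>k. f $ (d * k + r))"

lemma sec_nth [simp]: "sec d r f $ k = f $ (d * k + r)"
  by (simp add: sec_def)

lemma sec_add: "sec d r (f + g) = sec d r f + sec d r g"
  and sec_diff: "sec d r (f - g) = sec d r f - sec d r g"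
  by (auto simp: fps_eq_iff)

lemma sec_monom:
  assumes "d > 0" "r < d"
  shows "sec d r (fps_X ^ a * (f oo fps_X ^ d)) =
           (if a mod d = r then fps_X ^ (a div d) * f else 0)"
proof (rule fps_ext)
  fix k
  have a: "a = d * (a div d) + a mod d" by simp
  have 1: "d * k + r - a = d * (k - a div d)" if "a mod d = r" "a div d \<le> k"
  proof -
    have "d * k + r - a = d * k + r - (d * (a div d) + r)" using a that(1) by metis
    thus ?thesis by (simp add: right_diff_distrib')
  qed
  have 2: "d * k + r < a \<longleftrightarrow> k < a div d" if "a mod d = r"
  proof -
    have "d * k + r < a \<longleftrightarrow> d * k + r < d * (a div d) + r" using a that(1) by metis
    thus ?thesis using assms by simp
  qed
  have 3: "\<not> d dvd d * k + r - a" if "a mod d \<noteq> r" "\<not> d * k + r < a"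
  proof
    assume "d dvd d * k + r - a"
    then obtain c where "d * k + r - a = d * c" by auto
    hence "d * k + r = d * c + a" using that by simp
    hence "(d * k + r) mod d = (d * c + a) mod d" by simp
    thus False using that(1) assms by simp
  qed
  show "sec d r (fps_X ^ a * (f oo fps_X ^ d)) $ k =
          (if a mod d = r then fps_X ^ (a div d) * f else 0) $ k"
  proof (cases "a mod d = r")
    case True
    show ?thesis
    proof (cases "k < a div d")
      case True
      thus ?thesis using 2[OF \<open>a mod d = r\<close>] \<open>a mod d = r\<close> by (simp add: fps_X_power_mult_nth)
    next
      case False
      hence "\<not> d * k + r < a" "d * k + r - a = d * (k - a div d)"
        using 1 2 \<open>a mod d = r\<close> by auto
      thus ?thesis using False \<open>a mod d = r\<close> assms
        by (simp add: fps_X_power_mult_nth nth_compose_X_power)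
    qed
  next
    case False
    thus ?thesis using 3 assms by (auto simp: fps_X_power_mult_nth nth_compose_X_power)
  qed
qed

text \<open>A factor in \<open>q^d\<close> has only exponents divisible by \<open>d\<close> and so
  preserves residue classes; after extraction it becomes a factor in \<open>q\<close>. This is how
  denominators are taken out of a dissection.\<close>

lemma sec_mult_compose:
  assumes "d > 0" "r < d"
  shows "sec d r (f * (g oo fps_X ^ d)) = sec d r f * g"
proof (rule fps_ext)
  fix k
  let ?G = "g oo fps_X ^ d"
  have "(?G * f) $ (d * k + r) = (\<Sum>j\<in>{0..d*k+r}. ?G $ j * f $ (d * k + r - j))"
    by (simp add: fps_mult_nth)
  also have "\<dots> = (\<Sum>j\<in>(*) d ` {0..k}. ?G $ j * f $ (d * k + r - j))"
  proof (rule sum.mono_neutral_right)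
    show "(*) d ` {0..k} \<subseteq> {0..d*k+r}" by (auto simp: trans_le_add1)
    show "\<forall>i\<in>{0..d*k+r} - (*) d ` {0..k}. ?G $ i * f $ (d * k + r - i) = 0"
    proof
      fix i assume i: "i \<in> {0..d*k+r} - (*) d ` {0..k}"
      have "\<not> d dvd i"
      proof
        assume "d dvd i"
        then obtain c where c: "i = d * c" by auto
        with i have "c \<notin> {0..k}" by auto
        hence "d * (k + 1) \<le> d * c" by (intro mult_le_mono) auto
        with i c assms show False by auto
      qed
      thus "?G $ i * f $ (d * k + r - i) = 0" using assms by (simp add: nth_compose_X_power)
    qed
  qed simp
  also have "\<dots> = (\<Sum>j\<in>{0..k}. g $ j * f $ (d * (k - j) + r))"
    by (subst sum.reindex)
       (use assms in \<open>auto simp: inj_on_def nth_compose_X_power right_diff_distrib' intro!: sum.cong\<close>)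
  also have "\<dots> = (g * sec d r f) $ k" by (simp add: fps_mult_nth)
  finally show "sec d r (f * (g oo fps_X ^ d)) $ k = (sec d r f * g) $ k"
    by (simp add: mult.commute)
qed

text \<open>The series \<open>f(-q)\<close>.\<close>

definition alt :: "real fps \<Rightarrow> real fps" where
  "alt f = Abs_fps (\<lambda>k. (-1) ^ k * f $ k)"

lemma alt_nth [simp]: "alt f $ k = (-1) ^ k * f $ k"
  by (simp add: alt_def)

lemma alt_mult: "alt (f * g) = alt f * alt g"
proof (rule fps_ext)
  fix k
  show "alt (f * g) $ k = (alt f * alt g) $ k"
    unfolding fps_mult_nth alt_nth sum_distrib_left
  proof (rule sum.cong[OF refl])
    fix i assume "i \<in> {0..k}"
    hence "(-1::real) ^ k = (-1) ^ i * (-1) ^ (k - i)" by (simp flip: power_add)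
    thus "(- 1) ^ k * (f $ i * g $ (k - i)) = (- 1) ^ i * f $ i * ((- 1) ^ (k - i) * g $ (k - i))"
      by (simp add: algebra_simps)
  qed
qed

lemma alt_one [simp]: "alt 1 = 1"
  and alt_alt [simp]: "alt (alt f) = f"
  by (auto simp: fps_eq_iff simp flip: power_add mult.assoc)

lemma alt_minus: "alt (f - g) = alt f - alt g"
  by (auto simp: fps_eq_iff algebra_simps)

lemma alt_prod: "alt (\<Prod>i\<in>S. f i) = (\<Prod>i\<in>S. alt (f i))"
  by (induction S rule: infinite_finite_induct) (auto simp: alt_mult)

lemma alt_gf: "alt (gf I s e) = gf I (\<lambda>i. (-1) ^ e i * s i) e"
  by (rule fps_ext) (simp add: gf_nth sum_distrib_left)

lemma alt_X_power: "alt (fps_X ^ n) = fps_const ((-1) ^ n) * fps_X ^ n"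
  by (rule fps_ext) simp

lemma alt_compose_even: "alt (f oo fps_X ^ 2) = f oo fps_X ^ 2"
  by (rule fps_ext) (auto simp: nth_compose_X_power[of 2, simplified])

section \<open>Products over sets of exponents\<close>

definition eqm :: "nat \<Rightarrow> real fps \<Rightarrow> real fps \<Rightarrow> bool" where
  "eqm N f g \<longleftrightarrow> (\<forall>k<N. f $ k = g $ k)"

lemma eqm_refl [simp]: "eqm N f f"
  and eqm_sym: "eqm N f g \<Longrightarrow> eqm N g f"
  and eqm_trans [trans]: "eqm N f g \<Longrightarrow> eqm N g h \<Longrightarrow> eqm N f h"
  by (auto simp: eqm_def)

lemma eqm_imp_eq: "(\<And>N. eqm N f g) \<Longrightarrow> f = g"
  by (rule fps_ext) (auto simp: eqm_def)

lemma eqm_mult: "eqm N f g \<Longrightarrow> eqm N f' g' \<Longrightarrow> eqm N (f * f') (g * g')"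
  unfolding eqm_def fps_mult_nth by (auto intro!: sum.cong)

lemma eqm_add: "eqm N f g \<Longrightarrow> eqm N f' g' \<Longrightarrow> eqm N (f + f') (g + g')"
  unfolding eqm_def by auto

lemma eqm_sum: "(\<And>i. i \<in> S \<Longrightarrow> eqm N (f i) (g i)) \<Longrightarrow> eqm N (sum f S) (sum g S)"
  unfolding eqm_def fps_sum_nth by (auto intro!: sum.cong)

lemma eqm_prod: "(\<And>i. i \<in> S \<Longrightarrow> eqm N (f i) (g i)) \<Longrightarrow> eqm N (prod f S) (prod g S)"
  by (induction S rule: infinite_finite_induct) (auto intro: eqm_mult)

lemma eqm_alt: "eqm N f g \<Longrightarrow> eqm N (alt f) (alt g)"
  by (auto simp: eqm_def)

lemma eqm_inverse:
  assumes "eqm N f g" "f $ 0 = 1" "g $ 0 = 1"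
  shows "eqm N (inverse f) (inverse g)"
proof -
  have 1: "inverse f * f = 1" "g * inverse g = 1"
    using assms by (auto intro: inverse_mult_eq_1 inverse_mult_eq_1')
  have "eqm N (inverse f * g * inverse g) (inverse f * f * inverse g)"
    by (intro eqm_mult eqm_refl eqm_sym[OF assms(1)])
  thus ?thesis using 1 by (simp add: mult.assoc)
qed

lemma eqm_zero_X_power: "N \<le> a \<Longrightarrow> eqm N (fps_X ^ a * f) 0"
  by (auto simp: eqm_def fps_X_power_mult_nth)

lemma eqm_one_minus_X_power: "N \<le> a \<Longrightarrow> eqm N (1 - fps_X ^ a) 1"
  by (auto simp: eqm_def)

lemma eqm_compose: "d > 0 \<Longrightarrow> eqm N f g \<Longrightarrow> eqm N (f oo fps_X ^ d) (g oo fps_X ^ d)"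
  by (auto simp: eqm_def nth_compose_X_power) (meson div_le_dividend le_less_trans)

text \<open>The product of \<open>1 - q^n\<close> over the positive \<open>n\<close> in
  \<open>S\<close>. Factors with \<open>n > k\<close> do not affect the coefficient at
  \<open>k\<close>, so each coefficient is read from a finite product. The number 0 may belong to
  \<open>S\<close> without effect, which admits the residue class of 0.\<close>

definition PR :: "nat set \<Rightarrow> real fps" where
  "PR S = Abs_fps (\<lambda>k. (\<Prod>n\<in>S \<inter> {1..k}. 1 - fps_X ^ n) $ k)"

lemma prod_eqm_trunc:
  assumes "finite T" "T \<inter> {..<N} = T' \<inter> {..<N}" "finite T'"
  shows "eqm N (\<Prod>n\<in>T. 1 - fps_X ^ n) (\<Prod>n\<in>T'. 1 - fps_X ^ n)"
proof -
  have *: "eqm N (\<Prod>n\<in>T. 1 - fps_X ^ n) (\<Prod>n\<in>T \<inter> {..<N}. 1 - fps_X ^ n)" if "finite T" for T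
  proof -
    have "(\<Prod>n\<in>T. 1 - fps_X ^ n :: real fps) =
            (\<Prod>n\<in>T \<inter> {..<N}. 1 - fps_X ^ n) * (\<Prod>n\<in>T - {..<N}. 1 - fps_X ^ n)"
      using that by (subst prod.union_disjoint[symmetric]) (auto intro!: prod.cong)
    also have "eqm N \<dots> ((\<Prod>n\<in>T \<inter> {..<N}. 1 - fps_X ^ n) * (\<Prod>n\<in>T - {..<N}. 1))"
      by (intro eqm_mult eqm_refl eqm_prod eqm_one_minus_X_power) auto
    finally show ?thesis by simp
  qed
  show ?thesis
    by (rule eqm_trans[OF *[OF assms(1)]], subst assms(2), rule eqm_sym[OF *[OF assms(3)]])
qed

lemma PR_eqm:
  assumes "finite T" "\<And>n. 0 < n \<Longrightarrow> n < N \<Longrightarrow> n \<in> S \<longleftrightarrow> n \<in> T" "0 \<notin> T"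
  shows "eqm N (PR S) (\<Prod>n\<in>T. 1 - fps_X ^ n)"
  unfolding eqm_def
proof (intro allI impI)
  fix k assume "k < N"
  have "eqm (Suc k) (\<Prod>n\<in>S \<inter> {1..k}. 1 - fps_X ^ n) (\<Prod>n\<in>T. 1 - fps_X ^ n)"
  proof (rule prod_eqm_trunc)
    have "n \<in> S \<inter> {1..k} \<inter> {..<Suc k} \<longleftrightarrow> n \<in> T \<inter> {..<Suc k}" for n
      using assms(2)[of n] assms(3) \<open>k < N\<close> by (cases "n = 0") auto
    thus "S \<inter> {1..k} \<inter> {..<Suc k} = T \<inter> {..<Suc k}" by blast
  qed (use assms in auto)
  thus "PR S $ k = (\<Prod>n\<in>T. 1 - fps_X ^ n) $ k"
    by (simp add: PR_def eqm_def)
qed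

lemma PR_eqm': "eqm N (PR S) (\<Prod>n\<in>S \<inter> {1..<N}. 1 - fps_X ^ n)"
  by (rule PR_eqm) auto

lemma PR_nth_0 [simp]: "PR S $ 0 = 1"
  by (simp add: PR_def)

lemma PR_nonzero [simp]: "PR S \<noteq> 0"
  using PR_nth_0[of S] by (metis fps_zero_nth zero_neq_one)

lemma PR_cong: "(\<And>n. n > 0 \<Longrightarrow> n \<in> S \<longleftrightarrow> n \<in> T) \<Longrightarrow> PR S = PR T"
  by (rule eqm_imp_eq, rule eqm_trans[OF PR_eqm' eqm_sym[OF PR_eqm]]) auto

lemma PR_Un:
  assumes "\<And>n. n > 0 \<Longrightarrow> n \<notin> S \<or> n \<notin> T"
  shows "PR (S \<union> T) = PR S * PR T"
proof (rule eqm_imp_eq)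
  fix N
  have "eqm N (PR (S \<union> T)) (\<Prod>n\<in>(S \<union> T) \<inter> {1..<N}. 1 - fps_X ^ n)" by (rule PR_eqm')
  also have "(S \<union> T) \<inter> {1..<N} = (S \<inter> {1..<N}) \<union> (T \<inter> {1..<N})" by auto
  also have "(\<Prod>n\<in>\<dots>. 1 - fps_X ^ n :: real fps) =
      (\<Prod>n\<in>S \<inter> {1..<N}. 1 - fps_X ^ n) * (\<Prod>n\<in>T \<inter> {1..<N}. 1 - fps_X ^ n)"
    by (rule prod.union_disjoint) (use assms in \<open>auto simp: Suc_le_eq\<close>)
  also have "eqm N \<dots> (PR S * PR T)"
    by (intro eqm_mult eqm_sym[OF PR_eqm'])
  finally show "eqm N (PR (S \<union> T)) (PR S * PR T)" .
qed

lemma PR_insert: "a > 0 \<Longrightarrow> a \<in> S \<Longrightarrow> PR S = (1 - fps_X ^ a) * PR (S - {a})"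
proof -
  assume a: "a > 0" "a \<in> S"
  have "PR {a} = 1 - fps_X ^ a"
  proof (rule eqm_imp_eq)
    fix N show "eqm N (PR {a}) (1 - fps_X ^ a)"
      using PR_eqm[of "{a}" N "{a}"] a by simp
  qed
  moreover have "PR S = PR ({a} \<union> (S - {a}))" using a by (intro PR_cong) auto
  ultimately show ?thesis by (subst (asm) PR_Un) auto
qed

lemma PR_compose:
  assumes "d > 0"
  shows "PR S oo fps_X ^ d = PR ((*) d ` S)"
proof (rule eqm_imp_eq)
  fix N
  have le: "n \<le> d * n" for n using assms by simp
  have "eqm N (PR S oo fps_X ^ d) ((\<Prod>n\<in>S \<inter> {1..<N}. 1 - fps_X ^ n) oo fps_X ^ d)"
    by (intro eqm_compose PR_eqm' assms)
  also have "(\<Prod>n\<in>S \<inter> {1..<N}. 1 - fps_X ^ n) oo fps_X ^ d =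
      (\<Prod>n\<in>S \<inter> {1..<N}. 1 - fps_X ^ (d * n) :: real fps)"
    using assms by (subst fps_compose_prod_distrib)
      (auto intro!: prod.cong simp: fps_compose_sub_distrib fps_X_power_compose power_mult)
  also have "\<dots> = (\<Prod>n\<in>(*) d ` (S \<inter> {1..<N}). 1 - fps_X ^ n)"
    using assms by (subst prod.reindex) (auto simp: inj_on_def)
  also have "eqm N \<dots> (PR ((*) d ` S))"
    by (rule eqm_sym, rule PR_eqm)
       (use assms in \<open>auto simp: image_iff intro: le_less_trans[OF le]\<close>)
  finally show "eqm N (PR S oo fps_X ^ d) (PR ((*) d ` S))" .
qed

text \<open>For odd \<open>n\<close> the substitution of \<open>-q\<close> turns
  \<open>1 - q^n\<close> into \<open>1 + q^n\<close>, and the two factors multiply to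
  \<open>1 - q^(2 n)\<close>.\<close>

lemma PR_alt_odd:
  assumes "\<And>n. n \<in> S \<Longrightarrow> odd n"
  shows "PR S * alt (PR S) = PR ((*) 2 ` S)"
proof (rule eqm_imp_eq)
  fix N
  let ?P = "\<Prod>n\<in>S \<inter> {1..<N}. 1 - fps_X ^ n :: real fps"
  have "eqm N (PR S * alt (PR S)) (?P * alt ?P)"
    by (intro eqm_mult eqm_alt PR_eqm')
  also have "?P * alt ?P = (\<Prod>n\<in>S \<inter> {1..<N}. (1 - fps_X ^ n) * (1 + fps_X ^ n))"
    unfolding alt_prod prod.distrib[symmetric]
    by (intro prod.cong) (use assms in \<open>auto simp: alt_minus alt_X_power simp flip: fps_const_neg\<close>)
  also have "\<dots> = (\<Prod>n\<in>S \<inter> {1..<N}. 1 - fps_X ^ (2 * n))"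
    by (intro prod.cong refl) (simp only: mult_2 power_add, simp add: algebra_simps)
  also have "\<dots> = (\<Prod>n\<in>(*) 2 ` (S \<inter> {1..<N}). 1 - fps_X ^ n)"
    by (subst prod.reindex) (auto simp: inj_on_def)
  also have "eqm N \<dots> (PR ((*) 2 ` S))"
    by (rule eqm_sym, rule PR_eqm) (auto simp: image_iff)
  finally show "eqm N (PR S * alt (PR S)) (PR ((*) 2 ` S))" .
qed

lemma alt_PR_even:
  assumes "\<And>n. n \<in> S \<Longrightarrow> even n"
  shows "alt (PR S) = PR S"
proof (rule eqm_imp_eq)
  fix N
  let ?P = "\<Prod>n\<in>S \<inter> {1..<N}. 1 - fps_X ^ n :: real fps"
  have "eqm N (alt (PR S)) (alt ?P)" by (intro eqm_alt PR_eqm')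
  also have "alt ?P = ?P"
    unfolding alt_prod
    by (intro prod.cong) (use assms in \<open>auto simp: alt_minus alt_X_power\<close>)
  also have "eqm N \<dots> (PR S)" by (rule eqm_sym, rule PR_eqm')
  finally show "eqm N (alt (PR S)) (PR S)" .
qed

section \<open>Nonnegative coefficients and partition generating functions\<close>

definition nn :: "real fps \<Rightarrow> bool" where
  "nn f \<longleftrightarrow> (\<forall>k. 0 \<le> f $ k)"

lemma nnD: "nn f \<Longrightarrow> 0 \<le> f $ k"
  by (simp add: nn_def)

lemma nn_0 [simp]: "nn 0" and nn_1 [simp]: "nn 1" and nn_X_power [simp]: "nn (fps_X ^ a)"
  by (auto simp: nn_def)

lemma nn_X [simp]: "nn fps_X"
  using nn_X_power[of 1] by simp

lemma nn_add: "nn f \<Longrightarrow> nn g \<Longrightarrow> nn (f + g)"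
  by (auto simp: nn_def)

lemma nn_mult: "nn f \<Longrightarrow> nn g \<Longrightarrow> nn (f * g)"
  by (auto simp: nn_def fps_mult_nth intro!: sum_nonneg)

lemma nn_prod: "(\<And>i. i \<in> S \<Longrightarrow> nn (f i)) \<Longrightarrow> nn (prod f S)"
  by (induction S rule: infinite_finite_induct) (auto intro: nn_mult)

text \<open>The inverse \<open>h\<close> satisfies \<open>h = 1 + g * h\<close>. As \<open>g\<close>
  has no constant term, the coefficient of \<open>h\<close> at \<open>k\<close> is a nonnegative
  combination of earlier ones.\<close>

lemma nn_inverse_one_minus:
  assumes "nn g" "g $ 0 = 0"
  shows "nn (inverse (1 - g))"
proof -
  define h where "h = inverse (1 - g)"
  have "(1 - g) * h = 1" unfolding h_def using assms by (intro inverse_mult_eq_1') auto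
  hence h: "h = 1 + g * h" by (simp add: algebra_simps)
  have "0 \<le> h $ k" for k
  proof (induction k rule: less_induct)
    case (less k)
    have "h $ k = (1 + g * h) $ k" using h by simp
    also have "\<dots> = (if k = 0 then 1 else 0) + (\<Sum>i=0..k. g $ i * h $ (k - i))"
      by (simp add: fps_mult_nth)
    also have "\<dots> \<ge> 0"
    proof (intro add_nonneg_nonneg sum_nonneg)
      fix i assume "i \<in> {0..k}"
      show "0 \<le> g $ i * h $ (k - i)"
        using assms less[of "k - i"] \<open>i \<in> {0..k}\<close> by (cases "i = 0") (auto simp: nn_def)
    qed auto
    finally show ?case .
  qed
  thus ?thesis by (simp add: nn_def h_def)
qed

text \<open>The coefficients count partitions into parts from \<open>S\<close>. Truncation to
  finitely many parts reduces this to a product of geometric series.\<close>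

lemma nn_inverse_PR: "nn (inverse (PR S))"
  unfolding nn_def
proof
  fix k
  let ?P = "\<Prod>n\<in>S \<inter> {1..<Suc k}. 1 - fps_X ^ n :: real fps"
  have P0: "?P $ 0 = 1"
    using PR_eqm'[of 1 S] PR_eqm'[of "Suc k" S] by (simp add: eqm_def) (metis PR_nth_0 zero_less_Suc)
  have "eqm (Suc k) (inverse (PR S)) (inverse ?P)"
    by (intro eqm_inverse PR_eqm' P0 PR_nth_0)
  hence "inverse (PR S) $ k = inverse ?P $ k" by (simp add: eqm_def)
  also have "nn (inverse ?P)"
    unfolding inverse_prod_fps by (intro nn_prod nn_inverse_one_minus) auto
  hence "inverse ?P $ k \<ge> 0" by (rule nnD)
  finally show "0 \<le> inverse (PR S) $ k" .
qed

text \<open>Multiplying by \<open>1 - q^a\<close> forbids the part \<open>a\<close>. Monotonicity of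
  coefficients thereby becomes nonnegativity of another series of the same kind.\<close>

lemma inverse_PR_remove:
  assumes "a > 0" "a \<in> S"
  shows "(1 - fps_X ^ a) * inverse (PR S) = inverse (PR (S - {a}))"
proof -
  have "inverse (PR S) = inverse (1 - fps_X ^ a) * inverse (PR (S - {a}))"
    by (subst PR_insert[OF assms]) (rule fps_inverse_mult)
  moreover have "(1 - fps_X ^ a :: real fps) * inverse (1 - fps_X ^ a) = 1"
    using assms by (intro inverse_mult_eq_1') auto
  ultimately show ?thesis by (simp flip: mult.assoc)
qed

lemma mult_inverse_PR [simp]: "PR S * inverse (PR S) = 1" "inverse (PR S) * PR S = 1"
  by (auto intro: inverse_mult_eq_1' inverse_mult_eq_1)

lemma qpoch_inf_eq_PR:
  assumes "a > 0" "m > 0"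
  shows "qpoch_inf (fps_X ^ a) (fps_X ^ m) = PR (range (\<lambda>j. a + m * j))"
proof -
  let ?f = "\<lambda>j. 1 - fps_X ^ a * (fps_X ^ m) ^ j :: real fps"
  have f: "?f = (\<lambda>j. 1 - fps_X ^ (a + m * j))"
    by (auto simp: power_add power_mult)
  have "(\<lambda>N. \<Prod>j\<le>N. ?f j) \<longlonglongrightarrow> PR (range (\<lambda>j. a + m * j))"
  proof (rule tendsto_fpsI)
    fix k
    have "eqm (Suc k) (PR (range (\<lambda>j. a + m * j))) (\<Prod>j\<le>N. ?f j)" if "k \<le> N" for N
    proof -
      have "eqm (Suc k) (PR (range (\<lambda>j. a + m * j))) (\<Prod>n\<in>(\<lambda>j. a + m * j) ` {..N}. 1 - fps_X ^ n)"
      proof (rule PR_eqm)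
        fix n assume n: "n < Suc k"
        show "n \<in> range (\<lambda>j. a + m * j) \<longleftrightarrow> n \<in> (\<lambda>j. a + m * j) ` {..N}"
        proof
          assume "n \<in> range (\<lambda>j. a + m * j)"
          then obtain j where j: "n = a + m * j" by auto
          have "j \<le> m * j" using assms by simp
          hence "j \<le> N" using j n that by linarith
          thus "n \<in> (\<lambda>j. a + m * j) ` {..N}" using j by auto
        qed auto
      qed (use assms in auto)
      also have "(\<Prod>n\<in>(\<lambda>j. a + m * j) ` {..N}. 1 - fps_X ^ n) = (\<Prod>j\<le>N. ?f j)"
        unfolding f using assms by (subst prod.reindex) (auto simp: inj_on_def)
      finally show ?thesis .
    qed
    thus "\<forall>\<^sub>F N in sequentially. (\<Prod>j\<le>N. ?f j) $ k = PR (range (\<lambda>j. a + m * j)) $ k"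
      by (auto simp: eqm_def intro!: eventually_sequentiallyI[of k])
  qed
  hence "raw_has_prod ?f 0 (PR (range (\<lambda>j. a + m * j)))"
    by (simp add: raw_has_prod_def)
  hence "?f has_prod PR (range (\<lambda>j. a + m * j))" by (simp add: has_prod_def)
  thus ?thesis unfolding qpoch_inf_def by (rule has_prod_unique[symmetric])
qed

section \<open>The Jacobi triple product\<close>

fun qbinom :: "'a::comm_ring_1 \<Rightarrow> nat \<Rightarrow> nat \<Rightarrow> 'a" where
  "qbinom q n 0 = 1"
| "qbinom q 0 (Suc k) = 0"
| "qbinom q (Suc n) (Suc k) = qbinom q n (Suc k) + q ^ (n - k) * qbinom q n k"

lemma qbinom_eq_0: "n < k \<Longrightarrow> qbinom q n k = 0"
  by (induction q n k rule: qbinom.induct) auto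

lemma qbinom_closed:
  fixes q :: "'a::comm_ring_1"
  assumes "k \<le> n"
  shows "qbinom q n k * (\<Prod>i<k. 1 - q ^ Suc i) * (\<Prod>i<n-k. 1 - q ^ Suc i) = (\<Prod>i<n. 1 - q ^ Suc i)"
  using assms
proof (induction q n k rule: qbinom.induct)
  case (3 q n k)
  let ?Q = "\<lambda>m. \<Prod>i<m. 1 - q ^ Suc i"
  have k: "k \<le> n" using 3 by simp
  have B: "qbinom q n k * ?Q k * ?Q (n - k) = ?Q n" using 3 by simp
  have A: "qbinom q n (Suc k) * ?Q (Suc k) * ?Q (n - k) = ?Q n * (1 - q ^ (n - k))"
  proof (cases "k < n")
    case True
    hence "n - k = Suc (n - Suc k)" by simp
    hence "?Q (n - k) = ?Q (n - Suc k) * (1 - q ^ (n - k))" by (metis prod.lessThan_Suc)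
    moreover have "qbinom q n (Suc k) * ?Q (Suc k) * ?Q (n - Suc k) = ?Q n"
      using 3(1) True by simp
    ultimately show ?thesis by (metis mult.assoc)
  next
    case False
    hence "k = n" using k by simp
    thus ?thesis by (simp add: qbinom_eq_0)
  qed
  have q: "q ^ (n - k) * q ^ Suc k = q ^ Suc n"
  proof -
    have "n - k + Suc k = Suc n" using k by simp
    thus ?thesis by (metis power_add)
  qed
  have "qbinom q (Suc n) (Suc k) * ?Q (Suc k) * ?Q (Suc n - Suc k) =
     qbinom q n (Suc k) * ?Q (Suc k) * ?Q (n - k) +
     q ^ (n - k) * (qbinom q n k * ?Q k * ?Q (n - k)) * (1 - q ^ Suc k)"
    by (simp add: algebra_simps)
  also have "\<dots> = ?Q n * (1 - q ^ (n - k) * q ^ Suc k)"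
    unfolding A B by (simp add: algebra_simps)
  finally show ?case unfolding q by simp
qed auto

text \<open>The homogeneous form in \<open>A\<close> and \<open>B\<close> avoids negative powers of
  \<open>q\<close>: the triple product takes \<open>A = q^(m N)\<close> and
  \<open>B = -q^a\<close>.\<close>

lemma qbinomial_theorem:
  fixes A B q :: "'a::comm_ring_1"
  shows "(\<Prod>i<n. A + B * q ^ i) = (\<Sum>k\<le>n. q ^ (k * (k - 1) div 2) * qbinom q n k * A ^ (n - k) * B ^ k)"
proof (induction n)
  case (Suc n)
  let ?t = "\<lambda>n k. q ^ (k * (k - 1) div 2) * qbinom q n k * A ^ (n - k) * B ^ k"
  have tri: "Suc k * k div 2 = k * (k - 1) div 2 + k" for k :: nat
  proof -
    have "Suc k * k = k * (k - 1) + k * 2" by (cases k) (simp_all add: algebra_simps)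
    thus ?thesis by simp
  qed
  have step: "?t (Suc n) (Suc k) = ?t n (Suc k) * A + ?t n k * (B * q ^ n)" if "k \<le> n" for k
  proof -
    have q: "q ^ (Suc k * k div 2) * q ^ (n - k) = q ^ (k * (k - 1) div 2) * q ^ n"
      unfolding tri using that by (simp flip: power_add)
    have "?t (Suc n) (Suc k) = q ^ (Suc k * k div 2) * qbinom q n (Suc k) * A ^ (n - k) * B ^ Suc k +
        (q ^ (Suc k * k div 2) * q ^ (n - k)) * qbinom q n k * A ^ (n - k) * B ^ Suc k"
      by (simp add: algebra_simps)
    also have "q ^ (Suc k * k div 2) * qbinom q n (Suc k) * A ^ (n - k) * B ^ Suc k = ?t n (Suc k) * A"
    proof (cases "k < n")
      case True
      hence "n - k = Suc (n - Suc k)" by simp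
      hence "A ^ (n - k) = A ^ (n - Suc k) * A" by (metis power_Suc2)
      thus ?thesis by (simp add: algebra_simps)
    next
      case False
      thus ?thesis by (simp add: qbinom_eq_0)
    qed
    finally show ?thesis unfolding q by (simp add: algebra_simps)
  qed
  have "(\<Sum>k\<le>Suc n. ?t (Suc n) k) = ?t (Suc n) 0 + (\<Sum>k\<le>n. ?t (Suc n) (Suc k))"
    by (rule sum.atMost_Suc_shift)
  also have "\<dots> = A ^ Suc n + (\<Sum>k\<le>n. ?t n (Suc k) * A + ?t n k * (B * q ^ n))"
    using step by (intro arg_cong2[where f = "(+)"] sum.cong) auto
  also have "\<dots> = A ^ Suc n + (\<Sum>k\<le>n. ?t n (Suc k)) * A + (\<Sum>k\<le>n. ?t n k) * (B * q ^ n)"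
    by (simp add: sum.distrib sum_distrib_right)
  also have "A ^ Suc n + (\<Sum>k\<le>n. ?t n (Suc k)) * A = (\<Sum>k\<le>n. ?t n k) * A"
  proof -
    have "(\<Sum>k\<le>Suc n. ?t n k) = ?t n 0 + (\<Sum>k\<le>n. ?t n (Suc k))" by (rule sum.atMost_Suc_shift)
    moreover have "(\<Sum>k\<le>Suc n. ?t n k) = (\<Sum>k\<le>n. ?t n k)" by (simp add: qbinom_eq_0)
    ultimately have "(\<Sum>k\<le>n. ?t n k) = A ^ n + (\<Sum>k\<le>n. ?t n (Suc k))" by simp
    thus ?thesis by (simp only: distrib_right power_Suc2)
  qed
  finally have "(\<Sum>k\<le>Suc n. ?t (Suc n) k) = (\<Sum>k\<le>n. ?t n k) * (A + B * q ^ n)"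
    by (simp only: distrib_left)
  thus ?case using Suc by simp
qed simp

section \<open>Theta series and the finite form of the triple product\<close>

definition sg :: "int \<Rightarrow> real" where
  "sg n = (if even n then 1 else -1)"

lemma sg_add: "sg (m + n) = sg m * sg n" and sg_minus [simp]: "sg (- n) = sg n"
  by (auto simp: sg_def)

lemma sg_power: "(-1) ^ n = sg (int n)"
  by (auto simp: sg_def)

lemma neg_one_power_fps: "(-1) ^ n = (fps_const (sg (int n)) :: real fps)"
  by (auto simp: minus_one_power_iff sg_def simp flip: fps_const_neg)

definition thex :: "nat \<Rightarrow> nat \<Rightarrow> int \<Rightarrow> nat" where
  "thex m a n = nat (int m * (n * (n - 1) div 2) + int a * n)"

definition theta :: "nat \<Rightarrow> nat \<Rightarrow> real fps" where
  "theta m a = gf UNIV sg (thex m a)"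

text \<open>The bound serves twice: it shows that \<open>nat\<close> in \<open>thex\<close> cuts
  nothing off, and it makes every exponent occur only finitely often.\<close>

lemma thex_bound:
  assumes "0 < a" "a < m"
  shows "\<bar>n\<bar> \<le> int m * (n * (n - 1) div 2) + int a * n"
proof (cases "n \<ge> 0")
  case True
  have "n * (n - 1) \<ge> 0" using True by (cases "n = 0") auto
  hence "int m * (n * (n - 1) div 2) \<ge> 0" by simp
  moreover have "n \<le> int a * n" using True assms by (simp add: mult_le_cancel_right1)
  ultimately show ?thesis using True by simp
next
  case False
  define k where "k = - n"
  have k: "n = - k" "k > 0" using False by (auto simp: k_def)
  have "k * 2 \<le> k * (k + 1)" using k by (intro mult_left_mono) auto
  hence "k * 2 div 2 \<le> k * (k + 1) div 2" by (rule zdiv_mono1) simp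
  moreover have "n * (n - 1) = k * (k + 1)" using k by (simp add: algebra_simps)
  ultimately have "k \<le> n * (n - 1) div 2" by simp
  hence "int m * k \<le> int m * (n * (n - 1) div 2)" by (intro mult_left_mono) auto
  moreover have "k * (int a + 1) \<le> k * int m" using assms k by (intro mult_left_mono) auto
  ultimately show ?thesis using k by (simp add: algebra_simps)
qed

lemma int_thex: "0 < a \<Longrightarrow> a < m \<Longrightarrow> int (thex m a n) = int m * (n * (n - 1) div 2) + int a * n"
  using thex_bound[of a m n] by (simp add: thex_def)

lemma thex_ge: "0 < a \<Longrightarrow> a < m \<Longrightarrow> \<bar>n\<bar> \<le> int (thex m a n)"
  using thex_bound int_thex by simp

lemma adm_thex: "0 < a \<Longrightarrow> a < m \<Longrightarrow> adm UNIV (thex m a)"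
  by (rule adm_int) (rule thex_ge)

text \<open>Both sides come from the product of \<open>q^(m N) - q^(a + m i)\<close> over
  \<open>i < 2 N\<close>. The q-binomial theorem expands it; pulling the lower power out of every
  factor leaves one of the two families on the left for \<open>i < N\<close> and the other for
  \<open>i \<ge> N\<close>.\<close>

lemma theta_finite_product:
  assumes "0 < a" "a < m"
  shows "(\<Prod>i<N. (1 - fps_X ^ (a + m * i)) * (1 - fps_X ^ (m - a + m * i))) =
     (\<Sum>k\<le>2*N. fps_const (sg (int k - int N)) * fps_X ^ (thex m a (int k - int N)) * qbinom (fps_X ^ m) (2*N) k :: real fps)"
proof -
  \<comment> \<open>The power of \<open>q\<close> pulled out in total: \<open>a + m i\<close> for
    each \<open>i < N\<close>, and \<open>m N\<close> from each of the upper \<open>N\<close>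
    factors.\<close>
  define E where "E = a * N + m * (N * (N - 1) div 2) + m * N * N"
  let ?X = "fps_X :: real fps"
  let ?L = "\<Prod>i<N. (1 - ?X ^ (a + m * i)) * (1 - ?X ^ (m - a + m * i))"
  let ?c = "\<lambda>k. fps_const (sg (int k - int N)) * qbinom (?X ^ m) (2*N) k"
  have tri: "(\<Sum>i<N. i) = N * (N - 1) div 2" for N :: nat
    using Sum_Ico_nat[of 0 N] by (simp add: lessThan_atLeast0)
  have lo: "(\<Prod>i<N. ?X ^ (m * N) + (- (?X ^ a)) * (?X ^ m) ^ i) =
      fps_const (sg (int N)) * ?X ^ (a * N + m * (N * (N - 1) div 2)) * (\<Prod>i<N. 1 - ?X ^ (m - a + m * i))"
  proof -
    have "(\<Prod>i<N. ?X ^ (m * N) + (- (?X ^ a)) * (?X ^ m) ^ i) =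
        (\<Prod>i<N. (-1) * ?X ^ (a + m * i) * (1 - ?X ^ (m - a + m * (N - Suc i))))"
    proof (rule prod.cong[OF refl])
      fix i assume "i \<in> {..<N}"
      hence i: "i < N" by simp
      then obtain d where d: "N = Suc (i + d)" using less_imp_Suc_add by blast
      have "a + m * i + (m - a + m * (N - Suc i)) = m * N"
        using d assms by (simp add: algebra_simps)
      hence "?X ^ (m * N) = ?X ^ (a + m * i) * ?X ^ (m - a + m * (N - Suc i))"
        by (simp flip: power_add)
      moreover have "(- (?X ^ a)) * (?X ^ m) ^ i = - (?X ^ (a + m * i))"
        by (simp only: power_add power_mult mult_minus_left)
      moreover have "u * v + - u = (-1) * u * (1 - v)" for u v :: "real fps"
        by (simp add: algebra_simps)
      ultimately show "?X ^ (m * N) + (- (?X ^ a)) * (?X ^ m) ^ i =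
          (-1) * ?X ^ (a + m * i) * (1 - ?X ^ (m - a + m * (N - Suc i)))"
        by (simp only:)
    qed
    also have "\<dots> = (-1) ^ N * ?X ^ (\<Sum>i<N. a + m * i) * (\<Prod>i<N. 1 - ?X ^ (m - a + m * (N - Suc i)))"
      by (simp only: prod.distrib power_sum prod_constant card_lessThan)
    also have "(\<Prod>i<N. 1 - ?X ^ (m - a + m * (N - Suc i))) = (\<Prod>i<N. 1 - ?X ^ (m - a + m * i))"
      by (rule prod.nat_diff_reindex)
    also have "(\<Sum>i<N. a + m * i) = a * N + m * (N * (N - 1) div 2)"
      by (simp add: sum.distrib tri flip: sum_distrib_left)
    also have "(-1) ^ N = fps_const (sg (int N))"
      by (rule neg_one_power_fps)
    finally show ?thesis by (simp only: mult_ac)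
  qed
  have hi: "(\<Prod>i\<in>{N..<2*N}. ?X ^ (m * N) + (- (?X ^ a)) * (?X ^ m) ^ i) =
      ?X ^ (m * N * N) * (\<Prod>i<N. 1 - ?X ^ (a + m * i))"
  proof -
    have "(\<Prod>i\<in>{N..<2*N}. ?X ^ (m * N) + (- (?X ^ a)) * (?X ^ m) ^ i) =
        (\<Prod>i\<in>{0..<N}. ?X ^ (m * N) + (- (?X ^ a)) * (?X ^ m) ^ (i + N))"
      using prod.shift_bounds_nat_ivl[of _ 0 N N] by (simp add: mult_2)
    also have "\<dots> = (\<Prod>i<N. ?X ^ (m * N) * (1 - ?X ^ (a + m * i)))"
    proof (rule prod.cong)
      fix i
      have e: "(?X ^ m) ^ (i + N) = ?X ^ (m * i) * ?X ^ (m * N)"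
        by (simp only: power_add power_mult)
      have "(- (?X ^ a)) * (?X ^ m) ^ (i + N) = - (?X ^ (m * N) * ?X ^ (a + m * i))"
        unfolding e by (simp only: power_add[of _ a] mult_minus_left mult_ac)
      moreover have "u + - (u * v) = u * (1 - v)" for u v :: "real fps"
        by (simp add: algebra_simps)
      ultimately show "?X ^ (m * N) + (- (?X ^ a)) * (?X ^ m) ^ (i + N) = ?X ^ (m * N) * (1 - ?X ^ (a + m * i))"
        by (simp only:)
    qed auto
    also have "\<dots> = (?X ^ (m * N)) ^ N * (\<Prod>i<N. 1 - ?X ^ (a + m * i))"
      by (simp add: prod.distrib)
    finally show ?thesis by (simp add: power_mult)
  qed
  have "fps_const (sg (int N)) * ?X ^ E * ?L = (\<Prod>i<2*N. ?X ^ (m * N) + (- (?X ^ a)) * (?X ^ m) ^ i)"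
  proof -
    have "{..<2*N} = {..<N} \<union> {N..<2*N}" by auto
    hence "(\<Prod>i<2*N. ?X ^ (m * N) + (- (?X ^ a)) * (?X ^ m) ^ i) =
        (\<Prod>i<N. ?X ^ (m * N) + (- (?X ^ a)) * (?X ^ m) ^ i) *
        (\<Prod>i\<in>{N..<2*N}. ?X ^ (m * N) + (- (?X ^ a)) * (?X ^ m) ^ i)"
      by (simp add: prod.union_disjoint ivl_disj_int_one)
    thus ?thesis unfolding lo hi E_def by (simp add: power_add prod.distrib mult_ac)
  qed
  also have "\<dots> = (\<Sum>k\<le>2*N. (?X ^ m) ^ (k * (k - 1) div 2) * qbinom (?X ^ m) (2*N) k *
      (?X ^ (m * N)) ^ (2 * N - k) * (- (?X ^ a)) ^ k)"
    by (rule qbinomial_theorem)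
  also have "\<dots> = (\<Sum>k\<le>2*N. fps_const (sg (int N)) * ?X ^ E * (?X ^ thex m a (int k - int N) * ?c k))"
  proof (rule sum.cong[OF refl])
    fix k assume "k \<in> {..2*N}"
    hence k: "k \<le> 2 * N" by simp
    define r where "r = int k - int N"
    have N2: "int (N * (N - 1) div 2) = int N * (int N - 1) div 2" for N :: nat
      by (cases N) (auto simp: zdiv_int algebra_simps)
    have "int (m * (k * (k - 1) div 2) + m * N * (2 * N - k) + a * k) = int (E + thex m a r)"
    proof -
      have ev: "even (x * (x - 1))" for x :: int by simp
      have cancel: "2 * x = 2 * y \<Longrightarrow> x = y" for x y :: int by simp
      have "int k * (int k - 1) = 2 * (int k * (int k - 1) div 2)"
        "int N * (int N - 1) = 2 * (int N * (int N - 1) div 2)"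
        "r * (r - 1) = 2 * (r * (r - 1) div 2)"
        using ev by simp_all
      hence "2 * (int k * (int k - 1) div 2 + int N * (2 * int N - int k)) =
          2 * (int N * (int N - 1) div 2 + int N * int N + r * (r - 1) div 2)"
        unfolding r_def by (simp add: algebra_simps)
      hence "int k * (int k - 1) div 2 + int N * (2 * int N - int k) =
          int N * (int N - 1) div 2 + int N * int N + r * (r - 1) div 2" by (rule cancel)
      hence "int m * (int k * (int k - 1) div 2 + int N * (2 * int N - int k)) =
          int m * (int N * (int N - 1) div 2 + int N * int N + r * (r - 1) div 2)" by simp
      thus ?thesis using k unfolding E_def of_nat_add int_thex[OF assms] of_nat_mult N2
        by (simp add: of_nat_diff r_def algebra_simps)
    qed
    hence e: "m * (k * (k - 1) div 2) + m * N * (2 * N - k) + a * k = E + thex m a r"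
      by (simp only: of_nat_eq_iff)
    have s: "(- (?X ^ a)) ^ k = fps_const (sg (int N) * sg r) * ?X ^ (a * k)"
    proof -
      have "(- (?X ^ a)) ^ k = (-1) ^ k * ?X ^ (a * k)"
        by (metis power_minus power_mult)
      also have "(-1) ^ k = fps_const (sg (int k))" by (rule neg_one_power_fps)
      also have "sg (int k) = sg (int N) * sg r" by (simp add: r_def flip: sg_add)
      finally show ?thesis .
    qed
    have "(?X ^ m) ^ (k * (k - 1) div 2) * qbinom (?X ^ m) (2*N) k * (?X ^ (m * N)) ^ (2 * N - k) * (- (?X ^ a)) ^ k
      = ?X ^ (m * (k * (k - 1) div 2) + m * N * (2 * N - k) + a * k) * (fps_const (sg (int N) * sg r) * qbinom (?X ^ m) (2*N) k)"
      unfolding s by (simp only: power_add power_mult mult_ac)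
    also have "\<dots> = fps_const (sg (int N)) * ?X ^ E * (?X ^ thex m a r * (fps_const (sg r) * qbinom (?X ^ m) (2*N) k))"
      unfolding e by (simp only: power_add fps_const_mult[symmetric] mult_ac)
    finally show "(?X ^ m) ^ (k * (k - 1) div 2) * qbinom (?X ^ m) (2*N) k *
      (?X ^ (m * N)) ^ (2 * N - k) * (- (?X ^ a)) ^ k =
      fps_const (sg (int N)) * ?X ^ E * (?X ^ thex m a (int k - int N) * ?c k)"
      unfolding r_def .
  qed
  also have "\<dots> = fps_const (sg (int N)) * ?X ^ E * (\<Sum>k\<le>2*N. ?X ^ thex m a (int k - int N) * ?c k)"
    by (simp only: sum_distrib_left)
  finally have "?L = (\<Sum>k\<le>2*N. ?X ^ thex m a (int k - int N) * ?c k)"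
    by (subst (asm) mult_cancel_left) (auto simp: sg_def split: if_splits)
  thus ?thesis by (simp only: mult_ac)
qed

text \<open>Modulo \<open>q^T\<close> every product of the first \<open>T\<close> or more factors
  \<open>1 - q^(m i)\<close> may be replaced by the infinite product. The closed form of the
  binomial then reads \<open>x * P * P = P * P\<close>, and the unit \<open>P * P\<close>
  cancels.\<close>

lemma qbinom_limit:
  fixes m :: nat
  assumes "m > 0" "T \<le> k" "k + T \<le> 2 * N"
  shows "eqm T (qbinom (fps_X ^ m) (2*N) k * (\<Prod>i<N. 1 - fps_X ^ (m * Suc i))) 1"
proof -
  let ?X = "fps_X :: real fps"
  let ?q = "\<lambda>n. \<Prod>i<n. 1 - ?X ^ (m * Suc i)"
  define P where "P = PR ((*) m ` {0<..})"
  have q: "eqm T (?q n) P" if "T \<le> n" for n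
  proof -
    have "eqm T P (\<Prod>n\<in>(\<lambda>i. m * Suc i) ` {..<n}. 1 - ?X ^ n)"
      unfolding P_def
    proof (rule PR_eqm)
      fix x assume x: "x < T"
      show "x \<in> (*) m ` {0<..} \<longleftrightarrow> x \<in> (\<lambda>i. m * Suc i) ` {..<n}"
      proof
        assume "x \<in> (*) m ` {0<..}"
        then obtain j where j: "x = m * j" "j > 0" by auto
        have "1 * j \<le> m * j" using assms by (intro mult_le_mono) auto
        hence "j - 1 < n" using x j that by linarith
        moreover have "x = m * Suc (j - 1)" using j by simp
        ultimately show "x \<in> (\<lambda>i. m * Suc i) ` {..<n}" by blast
      next
        assume "x \<in> (\<lambda>i. m * Suc i) ` {..<n}"
        then obtain i where "x = m * Suc i" by blast
        thus "x \<in> (*) m ` {0<..}" by (intro image_eqI[of _ _ "Suc i"]) auto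
      qed
    qed (use assms in auto)
    also have "(\<Prod>n\<in>(\<lambda>i. m * Suc i) ` {..<n}. 1 - ?X ^ n) = ?q n"
      using assms by (subst prod.reindex) (auto simp: inj_on_def)
    finally show ?thesis by (rule eqm_sym)
  qed
  have "qbinom (?X ^ m) (2*N) k * ?q k * ?q (2*N - k) = ?q (2*N)"
    using qbinom_closed[of k "2*N" "?X ^ m"] assms by (simp only: power_mult)
  moreover have "(qbinom (?X ^ m) (2*N) k * ?q N) * (?q k * ?q (2*N - k)) =
      (qbinom (?X ^ m) (2*N) k * ?q k * ?q (2*N - k)) * ?q N"
    by (simp only: mult_ac)
  ultimately have 1: "(qbinom (?X ^ m) (2*N) k * ?q N) * (?q k * ?q (2*N - k)) = ?q (2*N) * ?q N"
    by (simp only:)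
  have "eqm T ((qbinom (?X ^ m) (2*N) k * ?q N) * (P * P)) ((qbinom (?X ^ m) (2*N) k * ?q N) * (?q k * ?q (2*N - k)))"
    by (intro eqm_mult eqm_refl eqm_sym[OF q]) (use assms in auto)
  also have "eqm T \<dots> (P * P)"
    unfolding 1 by (intro eqm_mult q) (use assms in auto)
  finally have "eqm T ((qbinom (?X ^ m) (2*N) k * ?q N) * (P * P) * inverse (P * P)) (P * P * inverse (P * P))"
    by (rule eqm_mult[OF _ eqm_refl])
  moreover have "P * P * inverse (P * P) = 1"
    by (intro inverse_mult_eq_1') (simp add: P_def)
  ultimately show ?thesis by (simp only: mult.assoc mult_1_right)
qed

theorem jacobi_triple_product:
  assumes "0 < a" "a < m"
  shows "theta m a = PR (range (\<lambda>j. a + m * j)) * PR (range (\<lambda>j. m - a + m * j)) * PR (range (\<lambda>j. m + m * j))"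
proof (rule eqm_imp_eq)
  fix T :: nat
  \<comment> \<open>This choice makes the two cases below exhaustive: an index \<open>k\<close>
    outside the range of \<open>qbinom_limit\<close> has distance at least \<open>T\<close> from
    \<open>N\<close>, so its term vanishes modulo \<open>q^T\<close>.\<close>
  define N where "N = 2 * T"
  let ?X = "fps_X :: real fps"
  let ?q = "\<Prod>i<N. 1 - ?X ^ (m * Suc i)"
  have PR: "eqm T (PR (range (\<lambda>j. b + m * j))) (\<Prod>i<N. 1 - ?X ^ (b + m * i))" if "b > 0" for b
  proof -
    have "eqm T (PR (range (\<lambda>j. b + m * j))) (\<Prod>n\<in>(\<lambda>i. b + m * i) ` {..<N}. 1 - ?X ^ n)"
    proof (rule PR_eqm)
      fix x assume x: "x < T"
      show "x \<in> range (\<lambda>j. b + m * j) \<longleftrightarrow> x \<in> (\<lambda>i. b + m * i) ` {..<N}"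
      proof
        assume "x \<in> range (\<lambda>j. b + m * j)"
        then obtain j where j: "x = b + m * j" by auto
        have "1 * j \<le> m * j" using assms by (intro mult_le_mono) auto
        hence "j < N" using x j unfolding N_def by linarith
        thus "x \<in> (\<lambda>i. b + m * i) ` {..<N}" using j by auto
      qed auto
    qed (use that in auto)
    also have "(\<Prod>n\<in>(\<lambda>i. b + m * i) ` {..<N}. 1 - ?X ^ n) = (\<Prod>i<N. 1 - ?X ^ (b + m * i))"
      using assms by (subst prod.reindex) (auto simp: inj_on_def)
    finally show ?thesis .
  qed
  have "eqm T (PR (range (\<lambda>j. a + m * j)) * PR (range (\<lambda>j. m - a + m * j)) * PR (range (\<lambda>j. m + m * j)))
      ((\<Prod>i<N. 1 - ?X ^ (a + m * i)) * (\<Prod>i<N. 1 - ?X ^ (m - a + m * i)) * (\<Prod>i<N. 1 - ?X ^ (m + m * i)))"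
    by (intro eqm_mult PR) (use assms in auto)
  also have "\<dots> = (\<Prod>i<N. (1 - ?X ^ (a + m * i)) * (1 - ?X ^ (m - a + m * i))) * ?q"
    by (simp add: prod.distrib)
  also have "\<dots> = (\<Sum>k\<le>2*N. fps_const (sg (int k - int N)) * ?X ^ (thex m a (int k - int N)) *
      (qbinom (?X ^ m) (2*N) k * ?q))"
    unfolding theta_finite_product[OF assms] sum_distrib_right by (simp only: mult_ac)
  also have "eqm T \<dots> (\<Sum>k\<le>2*N. fps_const (sg (int k - int N)) * ?X ^ (thex m a (int k - int N)) * 1)"
  proof (rule eqm_sum)
    fix k assume k: "k \<in> {..2*N}"
    show "eqm T (fps_const (sg (int k - int N)) * ?X ^ (thex m a (int k - int N)) * (qbinom (?X ^ m) (2*N) k * ?q))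
        (fps_const (sg (int k - int N)) * ?X ^ (thex m a (int k - int N)) * 1)"
    proof (cases "T \<le> k \<and> k + T \<le> 2 * N")
      case True
      thus ?thesis by (intro eqm_mult eqm_refl qbinom_limit) (use assms in auto)
    next
      case False
      hence "T \<le> \<bar>int k - int N\<bar>" using k by (auto simp: N_def)
      hence T: "T \<le> thex m a (int k - int N)" using thex_ge[OF assms, of "int k - int N"] by linarith
      have *: "eqm T (fps_const (sg (int k - int N)) * ?X ^ (thex m a (int k - int N)) * f) 0" for f
        using eqm_zero_X_power[OF T, of "fps_const (sg (int k - int N)) * f"] by (simp add: mult_ac)
      show ?thesis using eqm_trans[OF * eqm_sym[OF *]] .
    qed
  qed
  also have "eqm T \<dots> (theta m a)"
    unfolding eqm_def
  proof (intro allI impI)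
    fix t assume t: "t < T"
    have "(\<Sum>k\<le>2*N. fps_const (sg (int k - int N)) * ?X ^ (thex m a (int k - int N)) * 1) $ t =
        (\<Sum>k\<le>2*N. if thex m a (int k - int N) = t then sg (int k - int N) else 0)"
      by (auto simp: fps_sum_nth intro!: sum.cong)
    also have "\<dots> = (\<Sum>n\<in>{- int N..int N}. if thex m a n = t then sg n else 0)"
      by (rule sum.reindex_bij_witness[of _ "\<lambda>n. nat (n + int N)" "\<lambda>k. int k - int N"]) auto
    also have "\<dots> = (\<Sum>n\<in>{n \<in> {- int N..int N}. thex m a n = t}. sg n)"
      by (rule sum.inter_filter[symmetric]) simp
    also have "{n \<in> {- int N..int N}. thex m a n = t} = {n \<in> UNIV. thex m a n = t}"
    proof -
      have "n \<in> {- int N..int N}" if "thex m a n = t" for n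
        using thex_ge[OF assms, of n] that t by (auto simp: N_def)
      thus ?thesis by auto
    qed
    finally show "(\<Sum>k\<le>2*N. fps_const (sg (int k - int N)) * ?X ^ (thex m a (int k - int N)) * 1) $ t = theta m a $ t"
      by (simp add: theta_def gf_nth)
  qed
  finally show "eqm T (theta m a) (PR (range (\<lambda>j. a + m * j)) * PR (range (\<lambda>j. m - a + m * j)) * PR (range (\<lambda>j. m + m * j)))"
    by (rule eqm_sym)
qed

section \<open>Dissection of the quotient\<close>

abbreviation cl :: "nat \<Rightarrow> nat set \<Rightarrow> nat set" where
  "cl m R \<equiv> {n. n mod m \<in> R}"

lemma range_arith: 
  assumes "0 < a" "a < m" shows "range (\<lambda>j. a + m * j) = cl m {a}"
proof (intro equalityI subsetI)
  fix n assume "n \<in> cl m {a}"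
  hence "n = a + m * (n div m)" using assms by (metis CollectD add.commute mult_div_mod_eq singletonD)
  thus "n \<in> range (\<lambda>j. a + m * j)" by blast
qed (use assms in auto)

lemma PR_range_mult:
  assumes "0 < m" shows "PR (range (\<lambda>j. m + m * j)) = PR (cl m {0})"
proof (rule PR_cong)
  fix n :: nat assume "n > 0"
  show "n \<in> range (\<lambda>j. m + m * j) \<longleftrightarrow> n \<in> cl m {0}"
  proof
    assume "n \<in> cl m {0}"
    then obtain k where k: "n = m * k" by auto
    hence "n = m + m * (k - 1)" using \<open>n > 0\<close> by (cases k) auto
    thus "n \<in> range (\<lambda>j. m + m * j)" by blast
  qed auto
qed

definition J :: "nat \<Rightarrow> real fps" where
  "J m = PR (cl m {0})"

lemma theta_split:
  assumes "0 < a" "a < m"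
  shows "theta m a = PR (cl m {a}) * PR (cl m {m - a}) * J m"
proof -
  have "range (\<lambda>j. a + m * j) = cl m {a}" "range (\<lambda>j. m - a + m * j) = cl m {m - a}"
    using assms by (intro range_arith; simp)+
  moreover have "PR (range (\<lambda>j. m + m * j)) = J m"
    unfolding J_def using assms by (intro PR_range_mult) simp
  ultimately show ?thesis using jacobi_triple_product[OF assms] by (simp only:)
qed

text \<open>For \<open>2 * a = m\<close> the triple product contains the class of \<open>a\<close>
  twice, which a set of exponents cannot record.\<close>

lemma theta_PR:
  assumes "0 < a" "a < m" "2 * a \<noteq> m"
  shows "theta m a = PR (cl m {0, a, m - a})"
proof -
  have "theta m a = PR (cl m {a}) * PR (cl m {m - a}) * PR (cl m {0})"
    unfolding theta_split[OF assms(1,2)] J_def ..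
  also have "\<dots> = PR (cl m {0, a, m - a})"
    using assms by (subst PR_Un[symmetric], fastforce)+ (auto intro!: PR_cong)
  finally show ?thesis .
qed

lemma theta_nth_0: "0 < a \<Longrightarrow> a < m \<Longrightarrow> 2 * a \<noteq> m \<Longrightarrow> theta m a $ 0 = 1"
  by (simp add: theta_PR)

lemma J_nth_0 [simp]: "J m $ 0 = 1"
  by (simp add: J_def)

lemma J_nonzero [simp]: "J m \<noteq> 0"
  by (simp add: J_def)

lemma J_compose: "d > 0 \<Longrightarrow> m > 0 \<Longrightarrow> J m oo fps_X ^ d = J (d * m)"
  unfolding J_def by (subst PR_compose) (auto intro!: PR_cong simp: image_iff mod_eq_0_iff_dvd elim!: dvdE)

lemma Q10_eq: "Q10 = theta 10 1 * inverse (theta 10 3)"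
proof -
  have q: "qpoch_inf (fps_X ^ a) (fps_X ^ 10) = PR (cl 10 {a})" if "0 < a" "a < 10" for a
    using that by (simp add: qpoch_inf_eq_PR range_arith)
  let ?A = "PR (cl 10 {1}) * PR (cl 10 {9})" and ?B = "PR (cl 10 {3}) * PR (cl 10 {7})"
  have "Q10 = ?A / ?B"
    unfolding Q10_def using q[of 1] q[of 9] q[of 3] q[of 7] by simp
  also have "\<dots> = ?A * inverse ?B" by (rule fps_divide_unit) simp
  also have "\<dots> = ?A * J 10 * (inverse ?B * inverse (J 10))"
    using inverse_mult_eq_1'[of "J 10"] by (simp add: mult_ac)
  also have "\<dots> = theta 10 1 * inverse (theta 10 3)"
    using theta_split[of 1 10] theta_split[of 3 10] by (simp add: fps_inverse_mult)
  finally show ?thesis .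
qed

lemma c_one: "c 1 n = (theta 10 1 * inverse (theta 10 3)) $ n"
  by (simp add: c_def Q10_eq)

lemma c_minus_one: "c (-1) n = (theta 10 3 * inverse (theta 10 1)) $ n"
  by (simp add: c_def Q10_eq power_int_minus fps_inverse_mult fps_inverse_idempotent theta_nth_0 mult.commute)

section \<open>Dissection modulo 2\<close>

lemma thex_double:
  assumes "0 < a" "a < m"
  shows "2 * int (thex m a n) = int m * (n * (n - 1)) + 2 * int a * n"
proof -
  have "2 * (n * (n - 1) div 2) = n * (n - 1)" by simp
  hence "int m * (2 * (n * (n - 1) div 2)) = int m * (n * (n - 1))" by simp
  thus ?thesis by (simp add: int_thex[OF assms] algebra_simps)
qed

lemma thex_10: "0 < a \<Longrightarrow> a < 10 \<Longrightarrow> int (thex 10 a n) = 5 * n * n - (5 - int a) * n"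
  using thex_double[of a 10 n] by (simp add: algebra_simps)

lemma thex_50: "0 < a \<Longrightarrow> a < 50 \<Longrightarrow> int (thex 50 a n) = 25 * n * n - (25 - int a) * n"
  using thex_double[of a 50 n] by (simp add: algebra_simps)

lemma thex_4: "int (thex 4 1 n) = 2 * n * n - n"
  using thex_double[of 1 4 n] by (simp add: algebra_simps)

text \<open>
  The pairs \<open>(m, n)\<close> with \<open>m + n\<close> even are \<open>(u + v, u - v)\<close>, the others \<open>(1 - u - v, u - v)\<close>.
\<close>

lemma theta_product_parity:
  "theta 10 1 * alt (theta 10 3) =
     ((theta 10 2 * theta 10 4) oo fps_X ^ 2) - fps_X * ((theta 10 1 * theta 10 3) oo fps_X ^ 2)"
proof -
  let ?e = "\<lambda>(m, n). thex 10 1 m + thex 10 3 n" and ?s = "\<lambda>(m, n :: int). sg m"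
  let ?I0 = "{(m :: int, n). even (m + n)}" and ?I1 = "{(m :: int, n). odd (m + n)}"
  have alt3: "alt (theta 10 3) = gf UNIV (\<lambda>_. 1) (thex 10 3)"
    unfolding theta_def alt_gf
  proof (rule gf_cong)
    fix n :: int
    show "(-1) ^ thex 10 3 n * sg n = 1"
      unfolding sg_power thex_10[of 3 n, simplified] by (auto simp: sg_def)
  qed auto
  have adm2: "adm (UNIV \<times> UNIV) ?e"
  proof -
    have "finite {p. ?e p \<le> k}" for k
    proof (rule finite_subset)
      show "{p. ?e p \<le> k} \<subseteq> {- int k..int k} \<times> {- int k..int k}"
      proof
        fix p assume "p \<in> {p. ?e p \<le> k}"
        moreover obtain m n where "p = (m, n)" by (cases p)
        ultimately have "p = (m, n)" "thex 10 1 m + thex 10 3 n \<le> k" by auto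
        thus "p \<in> {- int k..int k} \<times> {- int k..int k}"
          using thex_ge[of 1 10 m] thex_ge[of 3 10 n] by auto
      qed
    qed simp
    thus ?thesis by (simp add: adm_def)
  qed
  have "theta 10 1 * alt (theta 10 3) = gf (UNIV \<times> UNIV) ?s ?e"
    unfolding alt3 unfolding theta_def
    by (subst gf_mult) (auto intro!: adm_thex gf_cong)
  also have "UNIV \<times> UNIV = ?I0 \<union> ?I1" by auto
  also have "gf (?I0 \<union> ?I1) ?s ?e = gf ?I0 ?s ?e + gf ?I1 ?s ?e"
    by (rule gf_Un) (use adm2 in \<open>auto intro: adm_subset\<close>)
  also have "gf ?I0 ?s ?e = gf (UNIV \<times> UNIV) (\<lambda>(u, v). sg u * sg v) (\<lambda>p. 2 * (case p of (u, v) \<Rightarrow> thex 10 2 u + thex 10 4 v))"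
  proof (rule gf_reindex)
    show "bij_betw (\<lambda>(u, v). (u + v, u - v)) (UNIV \<times> UNIV) ?I0"
      by (rule bij_betwI[where g = "\<lambda>(m, n). ((m + n) div 2, (m - n) div 2)"]) (auto, (presburger+)?)
    fix p :: "int \<times> int"
    obtain u v where p: "p = (u, v)" by (cases p)
    show "?s ((\<lambda>(u, v). (u + v, u - v)) p) = (\<lambda>(u, v). sg u * sg v) p"
      by (simp add: p sg_add)
    have "int (thex 10 1 (u + v) + thex 10 3 (u - v)) = int (2 * (thex 10 2 u + thex 10 4 v))"
      unfolding of_nat_add of_nat_mult by (simp add: thex_10 algebra_simps)
    thus "?e ((\<lambda>(u, v). (u + v, u - v)) p) = 2 * (case p of (u, v) \<Rightarrow> thex 10 2 u + thex 10 4 v)"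
      unfolding p by (simp only: of_nat_eq_iff prod.case)
  qed
  also have "\<dots> = (theta 10 2 * theta 10 4) oo fps_X ^ 2"
    unfolding theta_def by (subst gf_mult) (auto simp: gf_compose_X_power intro!: adm_thex)
  also have "gf ?I1 ?s ?e = gf (UNIV \<times> UNIV) (\<lambda>p. - (case p of (u, v) \<Rightarrow> sg u * sg v)) (\<lambda>p. 1 + 2 * (case p of (u, v) \<Rightarrow> thex 10 1 u + thex 10 3 v))"
  proof (rule gf_reindex)
    show "bij_betw (\<lambda>(u, v). (1 - u - v, u - v)) (UNIV \<times> UNIV) ?I1"
      by (rule bij_betwI[where g = "\<lambda>(m, n). ((1 - m + n) div 2, (1 - m - n) div 2)"]) (auto, (presburger+)?)
    fix p :: "int \<times> int"
    obtain u v where p: "p = (u, v)" by (cases p)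
    show "?s ((\<lambda>(u, v). (1 - u - v, u - v)) p) = - (case p of (u, v) \<Rightarrow> sg u * sg v)"
      by (auto simp: p sg_def)
    have "int (thex 10 1 (1 - u - v) + thex 10 3 (u - v)) = int (1 + 2 * (thex 10 1 u + thex 10 3 v))"
      unfolding of_nat_add of_nat_mult by (simp add: thex_10 algebra_simps)
    thus "?e ((\<lambda>(u, v). (1 - u - v, u - v)) p) = 1 + 2 * (case p of (u, v) \<Rightarrow> thex 10 1 u + thex 10 3 v)"
      unfolding p by (simp only: of_nat_eq_iff prod.case)
  qed
  also have "\<dots> = - (fps_X * ((theta 10 1 * theta 10 3) oo fps_X ^ 2))"
  proof -
    have a: "(theta 10 1 * theta 10 3) oo fps_X ^ 2 =
        gf (UNIV \<times> UNIV) (\<lambda>(u, v). sg u * sg v) (\<lambda>p. 2 * (case p of (u, v) \<Rightarrow> thex 10 1 u + thex 10 3 v))"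
      unfolding theta_def by (subst gf_mult) (auto simp: gf_compose_X_power intro!: adm_thex)
    show ?thesis
      unfolding a gf_minus
      using gf_shift[of 1 "UNIV \<times> UNIV" "\<lambda>(u, v). sg u * sg v" "\<lambda>p. 2 * (case p of (u, v) \<Rightarrow> thex 10 1 u + thex 10 3 v)"]
      by simp
  qed
  finally show ?thesis by simp
qed

definition psi :: "real fps" where
  "psi = gf UNIV (\<lambda>_. 1) (\<lambda>t :: nat. t * (t + 1) div 2)"

text \<open>Gauss's product for the triangular numbers. As \<open>n\<close> runs through the
  integers, \<open>2 n^2 - n\<close> runs once through the triangular numbers and has the parity of
  \<open>n\<close>, so \<open>psi\<close> is \<open>theta 4 1\<close> at \<open>-q\<close> and the
  triple product applies.\<close>

lemma psi_mult: "psi * PR (cl 2 {1}) = J 2"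
proof -
  have "alt (theta 4 1) = gf UNIV (\<lambda>_. 1) (thex 4 1)"
    unfolding theta_def alt_gf
  proof (rule gf_cong)
    fix n :: int
    show "(-1) ^ thex 4 1 n * sg n = 1"
      unfolding sg_power thex_4 by (auto simp: sg_def)
  qed auto
  also have "\<dots> = psi"
    unfolding psi_def
  proof (rule gf_reindex)
    \<comment> \<open>Odd \<open>t = 2 n - 1\<close> belong to \<open>n > 0\<close>, even
      \<open>t = - 2 n\<close> to \<open>n \<le> 0\<close>.\<close>
    show "bij_betw (\<lambda>t. if odd t then (int t + 1) div 2 else - (int t div 2)) UNIV UNIV"
    proof (rule bij_betwI[where g = "\<lambda>n. if n > 0 then nat (2 * n - 1) else nat (- 2 * n)"], goal_cases)
      case (3 t)
      show ?case by (cases "odd t") (auto elim!: oddE evenE)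
    next
      case (4 n)
      show ?case
      proof (cases "n > 0")
        case True
        then obtain k where "n = int k + 1" using zero_less_imp_eq_int[of n] by (metis add.commute of_nat_Suc gr0_implies_Suc)
        hence "nat (2 * n - 1) = 2 * k + 1" by simp
        thus ?thesis using True \<open>n = int k + 1\<close> by simp
      next
        case False
        then obtain k where "n = - int k" by (metis nonpos_int_cases not_less)
        hence "nat (- 2 * n) = 2 * k" by simp
        thus ?thesis using False \<open>n = - int k\<close> by simp
      qed
    qed auto
    fix t :: nat
    have e: "thex 4 1 n = t * (t + 1) div 2" if "2 * (2 * n * n - n) = int t * (int t + 1)" for n
    proof -
      have "2 * int (thex 4 1 n) = int (t * (t + 1))" using that thex_4[of n] by (simp add: algebra_simps)
      hence "2 * thex 4 1 n = t * (t + 1)" by linarith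
      thus ?thesis by simp
    qed
    show "thex 4 1 (if odd t then (int t + 1) div 2 else - (int t div 2)) = t * (t + 1) div 2"
      by (rule e) (auto elim!: oddE evenE simp: algebra_simps)
  qed auto
  finally have 1: "psi = alt (theta 4 1)" ..
  have "theta 4 1 = PR (cl 4 {0, 1, 4 - 1})" by (rule theta_PR) auto
  also have "\<dots> = PR (cl 2 {1}) * J 4"
    unfolding J_def by (subst PR_Un[symmetric]) (auto intro!: PR_cong, (presburger+)?)
  finally have "psi = alt (PR (cl 2 {1})) * alt (J 4)"
    using 1 by (simp add: alt_mult)
  also have "alt (J 4) = J 4"
    unfolding J_def by (rule alt_PR_even) (auto, (presburger+)?)
  finally have "psi * PR (cl 2 {1}) = PR (cl 2 {1}) * alt (PR (cl 2 {1})) * J 4" by (simp add: mult_ac)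
  also have "PR (cl 2 {1}) * alt (PR (cl 2 {1})) = PR ((*) 2 ` cl 2 {1})"
    by (rule PR_alt_odd) (auto, (presburger+)?)
  also have "\<dots> * J 4 = J 2"
    unfolding J_def by (subst PR_Un[symmetric]) (auto intro!: PR_cong simp: image_iff, (presburger+)?)
  finally show ?thesis .
qed

text \<open>\<open>theta 10 b\<close> is \<open>J 10\<close>, an even series, times factors with odd
  exponents; the latter double their exponents when multiplied by their image under
  \<open>-q\<close>.\<close>

lemma theta_mult_alt:
  assumes "b \<in> {1, 3}"
  shows "theta 10 b * alt (theta 10 b) = (PR (cl 10 {b, 10 - b}) * J 5 * J 5) oo fps_X ^ 2"
proof -
  let ?O = "cl 10 {b, 10 - b}"
  have "theta 10 b = PR (cl 10 {0, b, 10 - b})" by (rule theta_PR) (use assms in auto)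
  also have "\<dots> = PR ?O * J 10"
    unfolding J_def using assms by (subst PR_Un[symmetric]) (auto intro!: PR_cong)
  finally have t: "theta 10 b = PR ?O * J 10" .
  have "alt (J 10) = J 10"
    unfolding J_def by (rule alt_PR_even) (auto, (presburger+)?)
  hence "theta 10 b * alt (theta 10 b) = (PR ?O * alt (PR ?O)) * J 10 * J 10"
    unfolding t by (simp add: alt_mult mult_ac)
  also have "PR ?O * alt (PR ?O) = PR ((*) 2 ` ?O)"
    by (rule PR_alt_odd) (use assms in \<open>auto, (presburger+)?\<close>)
  also have "\<dots> = PR ?O oo fps_X ^ 2" by (rule PR_compose[symmetric]) simp
  also have "J 10 = J 5 oo fps_X ^ 2" by (simp add: J_compose)
  finally show ?thesis by (simp add: fps_compose_mult_distrib)
qed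

text \<open>With a single modulus 10, unions and disjointness of exponent sets are decided by
  comparing lists of residues.\<close>

lemma cl_5: "cl 5 {0} = cl 10 {0, 5}"
  and cl_2: "cl 2 {1} = cl 10 {1, 3, 5, 7, 9}"
  and cl_2_0: "cl 2 {0} = cl 10 {0, 2, 4, 6, 8}"
proof -
  have *: "n mod 10 \<in> {0,1,2,3,4,5,6,7,8,9}" "n mod 5 = n mod 10 mod 5" "n mod 2 = n mod 10 mod 2" for n :: nat
  proof -
    have "n mod 10 < 10" by simp
    thus "n mod 10 \<in> {0,1,2,3,4,5,6,7,8,9}" by (simp only: insert_iff empty_iff) arith
  qed (simp_all add: mod_mod_cancel)
  have r: "n mod 10 mod 5 = 0 \<longleftrightarrow> n mod 10 \<in> {0, 5}"
    "n mod 10 mod 2 = 1 \<longleftrightarrow> n mod 10 \<in> {1, 3, 5, 7, 9}"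
    "n mod 10 mod 2 = 0 \<longleftrightarrow> n mod 10 \<in> {0, 2, 4, 6, 8}" for n :: nat
    using *(1)[of n] by auto
  show "cl 5 {0} = cl 10 {0, 5}" "cl 2 {1} = cl 10 {1, 3, 5, 7, 9}" "cl 2 {0} = cl 10 {0, 2, 4, 6, 8}"
    by (simp_all only: set_eq_iff mem_Collect_eq singleton_iff r[symmetric] *(2,3)[symmetric] simp_thms)
qed

text \<open>\<open>?W\<close> is the even denominator read in \<open>q\<close> instead of
  \<open>q^2\<close>. The parity split determines both halves times \<open>?W\<close>, and
  \<open>?W\<close> cancels: in the odd half because \<open>theta 10 b\<close> is one of the two
  numerator factors, in the even half because \<open>theta 10 2 * theta 10 4 = J 2 * J 10\<close>
  and \<open>psi\<close> supplies the missing odd factors.\<close>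

lemma sec_quotient:
  assumes "a \<in> {1, 3}" "b \<in> {1, 3}" "a \<noteq> b"
  shows "sec 2 0 (theta 10 a * inverse (theta 10 b)) = psi * theta 10 a * inverse (J 5 * J 10)"
    and "sec 2 1 (theta 10 a * inverse (theta 10 b)) =
           fps_const (if a = 1 then -1 else 1) * (theta 10 a * J 10 * inverse (J 5 * J 5))"
proof -
  let ?Q = "theta 10 a * inverse (theta 10 b)"
  let ?W = "PR (cl 10 {b, 10 - b}) * J 5 * J 5"
  let ?s = "fps_const (if a = 1 then -1 else 1) :: real fps"
  have t0: "theta 10 b $ 0 = 1" using assms by (auto intro!: theta_nth_0)
  have "?Q * (?W oo fps_X ^ 2) = ?Q * (theta 10 b * alt (theta 10 b))"
    using theta_mult_alt[OF assms(2)] by simp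
  also have "\<dots> = theta 10 a * alt (theta 10 b) * (inverse (theta 10 b) * theta 10 b)"
    by (simp only: mult_ac)
  also have "inverse (theta 10 b) * theta 10 b = 1"
    by (rule inverse_mult_eq_1) (simp add: t0)
  also have "theta 10 a * alt (theta 10 b) * 1 =
      ((theta 10 2 * theta 10 4) oo fps_X ^ 2) + ?s * (fps_X * ((theta 10 1 * theta 10 3) oo fps_X ^ 2))"
  proof (cases "a = 1")
    case True
    hence "b = 3" using assms by auto
    thus ?thesis using True theta_product_parity by (simp flip: fps_const_neg)
  next
    case False
    hence ab: "a = 3" "b = 1" using assms by auto
    \<comment> \<open>Exchanging the two theta series amounts to substituting \<open>-q\<close>,
      under which only the odd half changes sign.\<close>
    have "theta 10 3 * alt (theta 10 1) = alt (theta 10 1 * alt (theta 10 3))"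
      by (simp add: alt_mult mult.commute)
    also have "\<dots> = alt ((theta 10 2 * theta 10 4) oo fps_X ^ 2) - alt (fps_X ^ 1) * alt ((theta 10 1 * theta 10 3) oo fps_X ^ 2)"
      unfolding theta_product_parity by (simp add: alt_minus alt_mult)
    also have "alt (fps_X ^ 1) = - fps_X"
      unfolding alt_X_power by (simp flip: fps_const_neg)
    finally show ?thesis using ab by (simp add: alt_compose_even)
  qed
  finally have eq: "?Q * (?W oo fps_X ^ 2) =
      ((theta 10 2 * theta 10 4) oo fps_X ^ 2) + ?s * (fps_X * ((theta 10 1 * theta 10 3) oo fps_X ^ 2))" .
  have sm: "sec 2 r (?s * f) = ?s * sec 2 r f" for r f
    by (rule fps_ext) simp
  have W0: "?W \<noteq> 0" by simp
  have c2: "sec 2 r (f oo fps_X ^ 2) = (if r = 0 then f else 0)" if "r < 2" for r f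
    using sec_monom[of 2 r 0 f] that by auto
  have x2: "sec 2 r (fps_X * (f oo fps_X ^ 2)) = (if r = 1 then f else 0)" if "r < 2" for r f
    using sec_monom[of 2 r 1 f] that by auto
  have "sec 2 0 ?Q * ?W = sec 2 0 (?Q * (?W oo fps_X ^ 2))"
    by (rule sec_mult_compose[symmetric]) auto
  also have "\<dots> = theta 10 2 * theta 10 4"
    unfolding eq sec_add sm by (simp add: c2 x2)
  finally have e0: "sec 2 0 ?Q * ?W = theta 10 2 * theta 10 4" .
  have "sec 2 1 ?Q * ?W = sec 2 1 (?Q * (?W oo fps_X ^ 2))"
    by (rule sec_mult_compose[symmetric]) auto
  also have "\<dots> = ?s * (theta 10 1 * theta 10 3)"
    unfolding eq sec_add sm by (simp add: c2 x2)
  finally have e1: "sec 2 1 ?Q * ?W = ?s * (theta 10 1 * theta 10 3)" .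
  have tt: "theta 10 x = PR (cl 10 {x, 10 - x}) * J 10" if "x \<in> {1,2,3,4}" for x
  proof -
    have "theta 10 x = PR (cl 10 {0, x, 10 - x})" using that by (intro theta_PR) auto
    also have "\<dots> = PR (cl 10 {x, 10 - x}) * J 10"
      unfolding J_def using that by (subst PR_Un[symmetric]) (auto intro!: PR_cong)
    finally show ?thesis .
  qed
  have ab: "theta 10 1 * theta 10 3 = theta 10 a * theta 10 b" using assms by auto
  have ttb: "theta 10 b = PR (cl 10 {b, 10 - b}) * J 10" using assms by (intro tt) auto
  have J5: "J 5 * inverse (J 5) = 1" "J 10 * inverse (J 10) = 1" by (auto intro: inverse_mult_eq_1')
  have iJ: "inverse (J 5 * J 5) = inverse (J 5) * inverse (J 5)" "inverse (J 5 * J 10) = inverse (J 5) * inverse (J 10)"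
    by (simp_all add: fps_inverse_mult)
  have "?s * (theta 10 a * J 10 * inverse (J 5 * J 5)) * ?W =
      ?s * (theta 10 a * (PR (cl 10 {b, 10 - b}) * J 10)) * (J 5 * inverse (J 5)) * (J 5 * inverse (J 5))"
    unfolding iJ by (simp only: mult_ac)
  also have "\<dots> = ?s * (theta 10 1 * theta 10 3)"
    unfolding ab J5 ttb[symmetric] by simp
  also have "\<dots> = sec 2 1 ?Q * ?W" using e1 ..
  finally show "sec 2 1 ?Q = ?s * (theta 10 a * J 10 * inverse (J 5 * J 5))"
    using W0 by (metis mult_right_cancel)
  \<comment> \<open>The residues 1, 3, 7, 9 modulo 10 and the multiples of 5 together cover the odd
    numbers and the multiples of 10, each once.\<close>
  have odd: "PR (cl 10 {a, 10 - a}) * PR (cl 10 {b, 10 - b}) * J 5 = PR (cl 2 {1}) * J 10"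
  proof -
    have "a = 1 \<and> b = 3 \<or> a = 3 \<and> b = 1" using assms by auto
    hence U: "cl 10 {a, 10 - a} \<union> cl 10 {b, 10 - b} = cl 10 {1, 3, 7, 9}" by auto
    have "PR (cl 10 {a, 10 - a}) * PR (cl 10 {b, 10 - b}) = PR (cl 10 {1, 3, 7, 9})"
      unfolding U[symmetric] by (rule PR_Un[symmetric]) (use assms in auto)
    moreover have "PR (cl 10 {1, 3, 7, 9}) * PR (cl 5 {0}) = PR (cl 10 {1, 3, 7, 9} \<union> cl 5 {0})"
      unfolding cl_5 by (rule PR_Un[symmetric]) auto
    moreover have "cl 10 {1, 3, 7, 9} \<union> cl 5 {0} = cl 2 {1} \<union> cl 10 {0}"
      unfolding cl_5 cl_2 by auto
    moreover have "PR (cl 2 {1} \<union> cl 10 {0}) = PR (cl 2 {1}) * PR (cl 10 {0})"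
      unfolding cl_2 by (rule PR_Un) auto
    ultimately show ?thesis by (simp only: J_def)
  qed
  have even: "theta 10 2 * theta 10 4 = J 2 * J 10"
  proof -
    have "PR (cl 10 {2, 10 - 2}) * PR (cl 10 {4, 10 - 4}) * J 10 = PR (cl 10 {2, 10 - 2} \<union> cl 10 {4, 10 - 4} \<union> cl 10 {0})"
      unfolding J_def by (subst PR_Un, (auto)[])+ simp
    also have "\<dots> = J 2" unfolding J_def cl_2_0 by (intro PR_cong) auto
    finally show ?thesis using tt[of 2] tt[of 4] by (simp add: mult_ac)
  qed
  have "psi * theta 10 a * inverse (J 5 * J 10) * ?W =
      psi * (PR (cl 10 {a, 10 - a}) * PR (cl 10 {b, 10 - b}) * J 5) * (J 5 * inverse (J 5)) * (J 10 * inverse (J 10))"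
    unfolding iJ using tt[of a] assms by (auto simp: mult_ac)
  also have "\<dots> = (psi * PR (cl 2 {1})) * J 10" unfolding odd J5 by (simp add: mult_ac)
  also have "\<dots> = sec 2 0 ?Q * ?W" unfolding psi_mult e0 even ..
  finally show "sec 2 0 ?Q = psi * theta 10 a * inverse (J 5 * J 10)"
    using W0 by (metis mult_right_cancel)
qed

section \<open>Dissection modulo 5\<close>

text \<open>On the class \<open>n = 5 u m + d\<close> the quadratic exponent is again of theta type,
  in \<open>q^5\<close> and with modulus 50; \<open>off\<close> is the exponent at
  \<open>n = d\<close>. The orientation \<open>u\<close> is free, and in the applications it is
  taken such that \<open>b < 25\<close>.\<close>

lemma theta_class:
  assumes "0 < a" "a < 10" "0 < b" "b < 50" "u \<in> {1, -1}" "r = d mod 5"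
    "\<And>m. int (thex 10 a (5 * u * m + d)) = int off + 5 * int (thex 50 b m)"
  shows "gf {n. n mod 5 = r} sg (thex 10 a) = fps_const (sg d) * (fps_X ^ off * (theta 50 b oo fps_X ^ 5))"
proof -
  have "gf {n. n mod 5 = r} sg (thex 10 a) = gf UNIV (\<lambda>m. sg d * sg m) (\<lambda>m. off + 5 * thex 50 b m)"
  proof (rule gf_reindex)
    show "bij_betw (\<lambda>m. 5 * u * m + d) UNIV {n. n mod 5 = r}"
    proof (rule bij_betwI[where g = "\<lambda>n. u * ((n - d) div 5)"], goal_cases)
      case 1
      show ?case using assms(6) by (auto simp: mult.assoc)
    next
      case (4 n)
      hence "n mod 5 = d mod 5" using assms by simp
      hence "5 dvd n - d" by (rule mod_eqE[OF _ ]) simp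
      thus ?case using assms(5) by auto
    qed (use assms(5) in auto)
    fix m
    show "sg (5 * u * m + d) = sg d * sg m" using assms(5) by (auto simp: sg_def)
    show "thex 10 a (5 * u * m + d) = off + 5 * thex 50 b m" using assms(7)[of m] by linarith
  qed
  thus ?thesis by (simp add: gf_const_mult gf_shift theta_def gf_compose_X_power)
qed

lemma theta_classes:
  "0 < a \<Longrightarrow> a < 10 \<Longrightarrow> theta 10 a = gf {n. n mod 5 = 0} sg (thex 10 a) + gf {n. n mod 5 = 1} sg (thex 10 a) +
     gf {n. n mod 5 = 2} sg (thex 10 a) + gf {n. n mod 5 = 3} sg (thex 10 a) + gf {n. n mod 5 = 4} sg (thex 10 a)"
proof -
  assume a: "0 < a" "a < 10"
  have adm: "adm S (thex 10 a)" for S by (rule adm_subset[OF adm_thex[OF a]]) simp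
  have "theta 10 a = gf ({n. n mod 5 = 0} \<union> {n. n mod 5 = 1} \<union> {n. n mod 5 = 2} \<union> {n. n mod 5 = 3} \<union> {n. n mod 5 = 4}) sg (thex 10 a)"
    unfolding theta_def by (rule gf_cong) (auto, (presburger+)?)
  thus ?thesis by (simp add: gf_Un adm disjoint_iff)
qed

abbreviation up5 :: "real fps \<Rightarrow> real fps" where "up5 f \<equiv> f oo fps_X ^ 5"

lemma theta_1_dissect:
  "theta 10 1 = fps_X ^ 0 * up5 (theta 50 21) - fps_X ^ 1 * up5 (theta 50 19) + fps_X ^ 12 * up5 (theta 50 9)
     + fps_X ^ 28 * up5 (theta 50 1) - fps_X ^ 9 * up5 (theta 50 11)"
proof -
  have "gf {n. n mod 5 = 0} sg (thex 10 1) = fps_const (sg 0) * (fps_X ^ 0 * up5 (theta 50 21))"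
    by (rule theta_class[where u = 1]) (simp_all add: thex_10[of 1, simplified] thex_50 algebra_simps)
  moreover have "gf {n. n mod 5 = 1} sg (thex 10 1) = fps_const (sg (1)) * (fps_X ^ 1 * up5 (theta 50 19))"
    by (rule theta_class[where u = "-1"]) (simp_all add: thex_10[of 1, simplified] thex_50[of 19, simplified] algebra_simps)
  moreover have "gf {n. n mod 5 = 2} sg (thex 10 1) = fps_const (sg (2)) * (fps_X ^ 12 * up5 (theta 50 9))"
    by (rule theta_class[where u = "-1"]) (simp_all add: thex_10[of 1, simplified] thex_50[of 9, simplified] algebra_simps)
  moreover have "gf {n. n mod 5 = 3} sg (thex 10 1) = fps_const (sg (-2)) * (fps_X ^ 28 * up5 (theta 50 1))"
    by (rule theta_class[where u = "1"]) (simp_all add: thex_10[of 1, simplified] thex_50[of 1, simplified] algebra_simps)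
  moreover have "gf {n. n mod 5 = 4} sg (thex 10 1) = fps_const (sg (-1)) * (fps_X ^ 9 * up5 (theta 50 11))"
    by (rule theta_class[where u = "1"]) (simp_all add: thex_10[of 1, simplified] thex_50[of 11, simplified] algebra_simps)
  ultimately show ?thesis
    using theta_classes[of 1] by (simp add: sg_def flip: fps_const_neg)
qed

lemma theta_3_dissect:
  "theta 10 3 = fps_X ^ 0 * up5 (theta 50 23) - fps_X ^ 3 * up5 (theta 50 17) - fps_X ^ 7 * up5 (theta 50 13)
     + fps_X ^ 16 * up5 (theta 50 7) + fps_X ^ 24 * up5 (theta 50 3)"
proof -
  have "gf {n. n mod 5 = 0} sg (thex 10 3) = fps_const (sg 0) * (fps_X ^ 0 * up5 (theta 50 23))"
    by (rule theta_class[where u = 1]) (simp_all add: thex_10[of 3, simplified] thex_50 algebra_simps)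
  moreover have "gf {n. n mod 5 = 1} sg (thex 10 3) = fps_const (sg (1)) * (fps_X ^ 3 * up5 (theta 50 17))"
    by (rule theta_class[where u = "-1"]) (simp_all add: thex_10[of 3, simplified] thex_50[of 17, simplified] algebra_simps)
  moreover have "gf {n. n mod 5 = 2} sg (thex 10 3) = fps_const (sg (2)) * (fps_X ^ 16 * up5 (theta 50 7))"
    by (rule theta_class[where u = "-1"]) (simp_all add: thex_10[of 3, simplified] thex_50[of 7, simplified] algebra_simps)
  moreover have "gf {n. n mod 5 = 3} sg (thex 10 3) = fps_const (sg (-2)) * (fps_X ^ 24 * up5 (theta 50 3))"
    by (rule theta_class[where u = "1"]) (simp_all add: thex_10[of 3, simplified] thex_50[of 3, simplified] algebra_simps)
  moreover have "gf {n. n mod 5 = 4} sg (thex 10 3) = fps_const (sg (-1)) * (fps_X ^ 7 * up5 (theta 50 13))"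
    by (rule theta_class[where u = "1"]) (simp_all add: thex_10[of 3, simplified] thex_50[of 13, simplified] algebra_simps)
  ultimately show ?thesis
    using theta_classes[of 3] by (simp add: sg_def flip: fps_const_neg)
qed

text \<open>For \<open>t = 5 j, 5 j + 4, 5 j + 1, 5 j + 3, 5 j + 2\<close> in the order of these
  definitions, the triangular number of \<open>t\<close> is
  \<open>5 e, 5 e, 5 e + 1, 5 e + 1, 5 e + 3\<close>, where \<open>e\<close> is the exponent
  defined.\<close>

definition eA1 :: "nat \<Rightarrow> nat" where "eA1 j = j * (5 * j + 1) div 2"
definition eA2 :: "nat \<Rightarrow> nat" where "eA2 j = (j + 1) * (5 * j + 4) div 2"
definition eB1 :: "nat \<Rightarrow> nat" where "eB1 j = j * (5 * j + 3) div 2"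
definition eB2 :: "nat \<Rightarrow> nat" where "eB2 j = (j + 1) * (5 * j + 2) div 2"
definition eC :: "nat \<Rightarrow> nat" where "eC j = 5 * (j * (j + 1)) div 2"

lemma e_double:
  "2 * eA1 j = 5 * j * j + j"
  "2 * eA2 j = 5 * j * j + 9 * j + 4"
  "2 * eB1 j = 5 * j * j + 3 * j"
  "2 * eB2 j = 5 * j * j + 7 * j + 2"
  "2 * eC j = 5 * j * j + 5 * j"
  by (simp_all add: eA1_def eA2_def eB1_def eB2_def eC_def algebra_simps)

definition N :: "(nat \<Rightarrow> nat) \<Rightarrow> real fps" where
  "N e = gf UNIV (\<lambda>_. 1) e"

lemma psi_dissect:
  "psi = up5 (N eA1 + N eA2) + fps_X * up5 (N eB1 + N eB2) + fps_X ^ 3 * up5 (N eC)"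
proof -
  let ?e = "\<lambda>t :: nat. t * (t + 1) div 2"
  have le: "t \<le> ?e t" for t by (induction t) auto
  have adm: "adm S ?e" for S by (rule adm_subset[OF adm_nat[OF le]]) simp
  have cls: "gf {t. t mod 5 = r} (\<lambda>_. 1) ?e = fps_X ^ off * up5 (N d)"
    if "r < 5" "\<And>j. (5 * j + r) * (5 * j + r + 1) = 2 * off + 5 * (2 * d j)" for r off d
  proof -
    have "gf {t. t mod 5 = r} (\<lambda>_. 1) ?e = gf UNIV (\<lambda>_. 1) (\<lambda>j. off + 5 * d j)"
    proof (rule gf_reindex)
      show "bij_betw (\<lambda>j. 5 * j + r) UNIV {t. t mod 5 = r}"
        by (rule bij_betwI[where g = "\<lambda>t. t div 5"]) (use that in auto)
      fix j
      have "(5 * j + r) * (5 * j + r + 1) = 2 * (off + 5 * d j)" using that(2)[of j] by simp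
      thus "?e (5 * j + r) = off + 5 * d j" by simp
    qed auto
    thus ?thesis by (simp add: N_def gf_shift gf_compose_X_power)
  qed
  have psi_eq: "psi = gf ({t. t mod 5 = 0} \<union> {t. t mod 5 = 1} \<union> {t. t mod 5 = 2} \<union> {t. t mod 5 = 3} \<union> {t. t mod 5 = 4}) (\<lambda>_. 1) ?e"
    unfolding psi_def by (rule gf_cong) (auto, (presburger+)?)
  \<comment> \<open>The classes of \<open>5 j + 3\<close> and \<open>5 j + 4\<close> begin with the
    triangular numbers 6 and 10, but are to carry the factors \<open>q\<close> and 1. The surplus 5
    and 10 is absorbed by \<open>eB2\<close> and \<open>eA2\<close>, which therefore start at 1 and
    2.\<close>
  have d2: "2 * (eB2 j - 1) = 5 * j * j + 7 * j" "2 * (eA2 j - 2) = 5 * j * j + 9 * j" for j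
    using e_double(2,4)[of j] by (simp_all add: diff_mult_distrib2)
  note psi_eq
  also have "gf ({t. t mod 5 = 0} \<union> {t. t mod 5 = 1} \<union> {t. t mod 5 = 2} \<union> {t. t mod 5 = 3} \<union> {t. t mod 5 = 4}) (\<lambda>_. 1) ?e =
      fps_X ^ 0 * up5 (N eA1) + fps_X ^ 1 * up5 (N eB1) + fps_X ^ 3 * up5 (N eC) + fps_X ^ 1 * up5 (N eB2) + fps_X ^ 0 * up5 (N eA2)"
  proof -
    have "gf {t. t mod 5 = 0} (\<lambda>_. 1) ?e = fps_X ^ 0 * up5 (N eA1)"
      "gf {t. t mod 5 = 1} (\<lambda>_. 1) ?e = fps_X ^ 1 * up5 (N eB1)"
      "gf {t. t mod 5 = 2} (\<lambda>_. 1) ?e = fps_X ^ 3 * up5 (N eC)"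
      "gf {t. t mod 5 = 3} (\<lambda>_. 1) ?e = fps_X ^ 6 * up5 (N (\<lambda>j. eB2 j - 1))"
      "gf {t. t mod 5 = 4} (\<lambda>_. 1) ?e = fps_X ^ 10 * up5 (N (\<lambda>j. eA2 j - 2))"
      by (rule cls, simp, unfold e_double d2, simp add: algebra_simps)+
    moreover have "fps_X ^ 6 * up5 (N (\<lambda>j. eB2 j - 1)) = fps_X ^ 1 * up5 (N eB2)"
    proof -
      have "1 \<le> eB2 j" for j using e_double(4)[of j] by linarith
      thus ?thesis unfolding N_def by (simp only: gf_shift gf_compose_X_power zero_less_numeral)
          (rule gf_cong, auto simp: diff_mult_distrib2)
    qed
    moreover have "fps_X ^ 10 * up5 (N (\<lambda>j. eA2 j - 2)) = fps_X ^ 0 * up5 (N eA2)"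
    proof -
      have "2 \<le> eA2 j" for j using e_double(2)[of j] by linarith
      thus ?thesis unfolding N_def by (simp only: gf_shift gf_compose_X_power zero_less_numeral)
          (rule gf_cong, auto simp: diff_mult_distrib2)
    qed
    moreover have "gf ({t. t mod 5 = 0} \<union> {t. t mod 5 = 1} \<union> {t. t mod 5 = 2} \<union> {t. t mod 5 = 3} \<union> {t. t mod 5 = 4}) (\<lambda>_. 1) ?e =
        gf {t. t mod 5 = 0} (\<lambda>_. 1) ?e + gf {t. t mod 5 = 1} (\<lambda>_. 1) ?e + gf {t. t mod 5 = 2} (\<lambda>_. 1) ?e
        + gf {t. t mod 5 = 3} (\<lambda>_. 1) ?e + gf {t. t mod 5 = 4} (\<lambda>_. 1) ?e"
      by (subst gf_Un, rule adm, (auto)[])+ simp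
    ultimately show ?thesis by (simp only:)
  qed
  finally show ?thesis by (simp add: fps_compose_add_distrib algebra_simps)
qed

section \<open>The shelves\<close>

text \<open>The \<open>n\<close>-th term has order at least \<open>n\<close>, so the coefficient at
  \<open>k\<close> of the infinite sum needs only the terms up to \<open>k\<close>.\<close>

definition sumable :: "(nat \<Rightarrow> real fps) \<Rightarrow> bool" where
  "sumable t \<longleftrightarrow> (\<forall>n k. k < n \<longrightarrow> t n $ k = 0)"

definition fsum :: "(nat \<Rightarrow> real fps) \<Rightarrow> real fps" where
  "fsum t = Abs_fps (\<lambda>k. \<Sum>n\<le>k. t n $ k)"

lemma sumableI: "(\<And>n. \<exists>e f. n \<le> e \<and> t n = fps_X ^ e * f) \<Longrightarrow> sumable t"
  unfolding sumable_def by (metis fps_X_power_mult_nth order_less_le_trans)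

lemma fsum_add: "fsum s + fsum t = fsum (\<lambda>n. s n + t n)"
  and fsum_diff: "fsum s - fsum t = fsum (\<lambda>n. s n - t n)"
  by (auto simp: fsum_def fps_eq_iff sum.distrib sum_subtractf)

lemma fsum_mult:
  assumes "sumable t"
  shows "f * fsum t = fsum (\<lambda>n. f * t n)"
proof (rule fps_ext)
  fix k
  have "(f * fsum t) $ k = (\<Sum>i=0..k. f $ i * (\<Sum>n\<le>k. t n $ (k - i)))"
    unfolding fps_mult_nth
  proof (rule sum.cong[OF refl])
    fix i
    have "(\<Sum>n\<le>k. t n $ (k - i)) = (\<Sum>n\<le>k - i. t n $ (k - i))"
      by (rule sum.mono_neutral_right) (use assms in \<open>auto simp: sumable_def\<close>)
    thus "f $ i * fsum t $ (k - i) = f $ i * (\<Sum>n\<le>k. t n $ (k - i))" by (simp add: fsum_def)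
  qed
  also have "\<dots> = (\<Sum>n\<le>k. \<Sum>i=0..k. f $ i * t n $ (k - i))"
    unfolding sum_distrib_left by (rule sum.swap)
  finally show "(f * fsum t) $ k = fsum (\<lambda>n. f * t n) $ k"
    by (simp add: fsum_def fps_mult_nth)
qed

lemma fsum_shift:
  assumes "sumable t"
  shows "fsum t = t 0 + fsum (\<lambda>n. t (Suc n))"
proof (rule fps_ext)
  fix k
  have "(\<Sum>n\<le>k. t (Suc n) $ k) = (\<Sum>n<k. t (Suc n) $ k)"
    by (rule sum.mono_neutral_right) (use assms in \<open>auto simp: sumable_def\<close>)
  thus "fsum t $ k = (t 0 + fsum (\<lambda>n. t (Suc n))) $ k"
    by (simp add: fsum_def sum.atMost_shift)
qed

lemma gf_nat_eq_fsum:
  assumes "\<And>n. n \<le> e n"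
  shows "gf UNIV s e = fsum (\<lambda>n. fps_const (s n) * fps_X ^ e n)"
proof (rule fps_ext)
  fix k
  have "{n \<in> UNIV. e n = k} = {n \<in> {..k}. e n = k}" using assms by auto
  hence "gf UNIV s e $ k = (\<Sum>n\<in>{n \<in> {..k}. e n = k}. s n)" by (simp only: gf_nth)
  also have "\<dots> = (\<Sum>n\<le>k. if e n = k then s n else 0)"
    by (rule sum.inter_filter) simp
  also have "\<dots> = (\<Sum>n\<le>k. (fps_const (s n) * fps_X ^ e n) $ k)"
    by (rule sum.cong) (auto simp: fps_mult_left_const_nth)
  finally show "gf UNIV s e $ k = fsum (\<lambda>n. fps_const (s n) * fps_X ^ e n) $ k"
    by (simp only: fsum_def fps_nth_Abs_fps)
qed

text \<open>The factors with exponents \<open>2 (n + 1), ..., 2 (n + L)\<close>.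
  \<open>bn_Suc\<close> lengthens the product at its upper end and \<open>bn_shift\<close> at its
  lower end; the recursions use both.\<close>

definition bn :: "nat \<Rightarrow> nat \<Rightarrow> real fps" where
  "bn n L = (\<Prod>i<L. 1 - fps_X ^ (2 * (n + Suc i)))"

lemma bn_Suc: "bn n L * (1 - fps_X ^ (2 * (n + Suc L))) = bn n (Suc L)"
  by (simp add: bn_def)

lemma bn_shift: "bn (Suc n) L * (1 - fps_X ^ (2 * Suc n)) = bn n (Suc L)"
  unfolding bn_def prod.lessThan_Suc_shift by (simp add: mult.commute)

definition sgn_n :: "nat \<Rightarrow> real fps" where "sgn_n n = fps_const ((-1) ^ n)"

lemma sgn_n_Suc [simp]: "sgn_n (Suc n) = - sgn_n n"
  by (simp add: sgn_n_def fps_const_neg)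

text \<open>
  For \<open>L = 0\<close> the series \<open>S L m\<close> is a theta series in which \<open>n\<close> and \<open>- n - 1\<close> have been paired. The
  extra factors \<open>bn n L\<close>, modelled on Bressoud's proof of Gordon's identities, are chosen such that
  the recursions \<open>S_step\<close> and \<open>S_zero\<close> hold; the truncated subtraction in \<open>eS\<close> is harmless because
  only \<open>m \<le> 24\<close> occurs.
\<close>

definition eS :: "nat \<Rightarrow> nat \<Rightarrow> nat \<Rightarrow> nat" where
  "eS L m n = 25 * n * n + (24 * Suc L - m) * n"

definition St :: "nat \<Rightarrow> nat \<Rightarrow> nat \<Rightarrow> real fps" where
  "St L m n = fps_X ^ eS L m n * (sgn_n n * bn n L * (1 - fps_X ^ (Suc m * (2 * n + Suc L))))"

definition S :: "nat \<Rightarrow> nat \<Rightarrow> real fps" where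
  "S L m = fsum (St L m)"

lemma eS_ge: "n \<le> eS L m n"
  unfolding eS_def by (cases n) auto

lemma sumable_St: "sumable (St L m)"
  by (rule sumableI) (use eS_ge in \<open>auto simp: St_def\<close>)

text \<open>A difference of two terms consists of four powers of \<open>q\<close>. Two of them yield
  the factor \<open>1 - q^(2 n)\<close> and extend \<open>bn\<close> downwards (\<open>f\<close>),
  the other two yield \<open>1 - q^(2 (n + L + 1))\<close> and extend it upwards (\<open>g\<close>).
  As \<open>f 0 = 0\<close>, the sum of the \<open>f n + g n\<close> is that of the
  \<open>f (n + 1) + g n\<close>, and such a pair is a term of the next shelf.\<close>

lemma S_step:
  assumes "m \<le> 22"
  shows "S L (m + 2) - S L m = fps_X ^ (Suc L * Suc m) * S (Suc L) (22 - m)"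
proof -
  define f where "f = (\<lambda>n. if n = 0 then 0 else sgn_n n * fps_X ^ (eS L (m + 2) n) * bn (n - 1) (Suc L) :: real fps)"
  define g where "g = (\<lambda>n. sgn_n n * fps_X ^ (eS L m n + 2 * Suc m * n + Suc m * Suc L) * bn n (Suc L) :: real fps)"
  have fg: "St L (m + 2) n - St L m n = f n + g n" for n
  proof -
    have 1: "fps_X ^ eS L m n = (fps_X ^ eS L (m + 2) n * fps_X ^ (2 * n) :: real fps)"
    proof -
      have "24 * Suc L - m = (24 * Suc L - (m + 2)) + 2" using assms by simp
      hence "eS L m n = eS L (m + 2) n + 2 * n" unfolding eS_def by (simp add: algebra_simps)
      thus ?thesis by (simp add: power_add)
    qed
    have 2: "fps_X ^ eS L (m + 2) n * fps_X ^ (Suc (m + 2) * (2 * n + Suc L)) =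
        (fps_X ^ (eS L m n + 2 * Suc m * n + Suc m * Suc L) * fps_X ^ (2 * (n + Suc L)) :: real fps)"
    proof -
      have "24 * Suc L - m = (24 * Suc L - (m + 2)) + 2" using assms by simp
      hence "eS L m n = eS L (m + 2) n + 2 * n" unfolding eS_def by (simp add: algebra_simps)
      hence "eS L (m + 2) n + Suc (m + 2) * (2 * n + Suc L) = (eS L m n + 2 * Suc m * n + Suc m * Suc L) + 2 * (n + Suc L)"
        by (simp add: algebra_simps)
      thus ?thesis by (simp only: power_add[symmetric])
    qed
    have 3: "fps_X ^ eS L m n * fps_X ^ (Suc m * (2 * n + Suc L)) = (fps_X ^ (eS L m n + 2 * Suc m * n + Suc m * Suc L) :: real fps)"
      unfolding power_add[symmetric] by (rule arg_cong[where f = "\<lambda>e. fps_X ^ e"]) (simp add: algebra_simps)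
    have f: "f n = sgn_n n * fps_X ^ (eS L (m + 2) n) * (bn n L * (1 - fps_X ^ (2 * n)))"
      using bn_shift[of "n - 1" L] by (cases n) (auto simp: f_def)
    have g: "g n = sgn_n n * fps_X ^ (eS L m n + 2 * Suc m * n + Suc m * Suc L) * (bn n L * (1 - fps_X ^ (2 * (n + Suc L))))"
      unfolding g_def bn_Suc ..
    have alg: "u1 * (s * b * (1 - w1)) - u2 * (s * b * (1 - w2)) = s * u1 * (b * (1 - y)) + s * z * (b * (1 - x))"
      if "u2 = u1 * y" "u1 * w1 = z * x" "u2 * w2 = z" for u1 u2 s b w1 w2 x y z :: "real fps"
    proof -
      have "u1 * (s * b * (1 - w1)) - u2 * (s * b * (1 - w2)) = s * b * (u1 - u1 * w1 - u2 + u2 * w2)"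
        by (simp add: algebra_simps)
      also have "\<dots> = s * b * (u1 - z * x - u1 * y + z)" unfolding that(2,3) using that(1) by simp
      finally show ?thesis by (simp add: algebra_simps)
    qed
    show ?thesis unfolding f g St_def by (rule alg[OF 1 2 3])
  qed
  have sf: "sumable f"
  proof (rule sumableI)
    fix n
    have "f n = fps_X ^ eS L (m + 2) n * (if n = 0 then 0 else sgn_n n * bn (n - 1) (Suc L))"
      by (auto simp: f_def)
    thus "\<exists>e h. n \<le> e \<and> f n = fps_X ^ e * h" using eS_ge by blast
  qed
  have "S L (m + 2) - S L m = fsum f + fsum g"
    unfolding S_def fsum_diff fsum_add fg ..
  also have "fsum f = fsum (\<lambda>n. f (Suc n))"
    using fsum_shift[OF sf] by (simp add: f_def)
  also have "\<dots> + fsum g = fsum (\<lambda>n. fps_X ^ (Suc L * Suc m) * St (Suc L) (22 - m) n)"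
    unfolding fsum_add
  proof (rule arg_cong[where f = fsum], rule ext)
    fix n
    have e1: "eS L m n + 2 * Suc m * n + Suc m * Suc L = Suc L * Suc m + eS (Suc L) (22 - m) n"
    proof -
      define a where "a = 24 * Suc L - m"
      have "24 * Suc (Suc L) - (22 - m) = a + 2 * Suc m" using assms by (simp add: a_def)
      thus ?thesis unfolding eS_def a_def[symmetric] by (simp add: algebra_simps)
    qed
    have e2: "eS L (m + 2) (Suc n) = Suc L * Suc m + eS (Suc L) (22 - m) n + Suc (22 - m) * (2 * n + Suc (Suc L))"
    proof -
      define d where "d = 22 - m"
      define e f where "e = 48 - d" and "f = Suc m"
      have A: "24 * Suc L - (m + 2) = 24 * L + d" and B: "24 * Suc (Suc L) - d = 24 * L + e"
        using assms by (auto simp: d_def e_def)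
      have i: "int e = 48 - int d" "int f = 23 - int d" using assms by (auto simp: d_def e_def f_def)
      have "int (eS L (m + 2) (Suc n)) = int (Suc L * f + eS (Suc L) d n + Suc d * (2 * n + Suc (Suc L)))"
        unfolding eS_def A B by (simp add: i algebra_simps)
      hence "int (eS L (m + 2) (Suc n)) = int (Suc L * Suc m + eS (Suc L) d n + Suc d * (2 * n + Suc (Suc L)))"
        unfolding f_def .
      thus ?thesis unfolding d_def by (simp only: of_nat_eq_iff)
    qed
    have "f (Suc n) + g n = - (sgn_n n * fps_X ^ eS L (m + 2) (Suc n) * bn n (Suc L)) + sgn_n n * fps_X ^ (Suc L * Suc m + eS (Suc L) (22 - m) n) * bn n (Suc L)"
      unfolding g_def e1 by (simp add: f_def)
    also have "\<dots> = fps_X ^ (Suc L * Suc m) * St (Suc L) (22 - m) n"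
      unfolding e2 St_def by (simp only: power_add) (simp add: algebra_simps)
    finally show "f (Suc n) + g n = fps_X ^ (Suc L * Suc m) * St (Suc L) (22 - m) n" .
  qed
  also have "\<dots> = fps_X ^ (Suc L * Suc m) * S (Suc L) (22 - m)"
    unfolding S_def fsum_mult[OF sumable_St] ..
  finally show ?thesis .
qed

text \<open>The regrouping of \<open>S_step\<close> again, now with
  \<open>(1 + x) (1 - y x) = x (1 - y) + (1 - y x^2)\<close> for \<open>x = q^(L + 1)\<close> and
  \<open>y = q^(2 n)\<close>.\<close>

lemma S_zero: "(1 + fps_X ^ Suc L) * S L 0 = S (Suc L) 24"
proof -
  define f where "f = (\<lambda>n. if n = 0 then 0 else sgn_n n * fps_X ^ (eS L 0 n + Suc L) * bn (n - 1) (Suc L) :: real fps)"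
  define g where "g = (\<lambda>n. sgn_n n * fps_X ^ eS L 0 n * bn n (Suc L) :: real fps)"
  have fg: "(1 + fps_X ^ Suc L) * St L 0 n = f n + g n" for n
  proof -
    have f: "f n = sgn_n n * (fps_X ^ eS L 0 n * fps_X ^ Suc L) * (bn n L * (1 - fps_X ^ (2 * n)))"
      using bn_shift[of "n - 1" L] by (cases n) (auto simp: f_def power_add)
    have g: "g n = sgn_n n * fps_X ^ eS L 0 n * (bn n L * (1 - fps_X ^ (2 * (n + Suc L))))"
      unfolding g_def bn_Suc ..
    have x: "fps_X ^ (Suc 0 * (2 * n + Suc L)) = (fps_X ^ (2 * n) * fps_X ^ Suc L :: real fps)"
      "fps_X ^ (2 * (n + Suc L)) = (fps_X ^ (2 * n) * (fps_X ^ Suc L * fps_X ^ Suc L) :: real fps)"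
      unfolding power_add[symmetric] by (rule arg_cong[where f = "\<lambda>e. fps_X ^ e"], simp)+
    have "(1 + x) * (u * (s * b * (1 - y * x))) = s * (u * x) * (b * (1 - y)) + s * u * (b * (1 - y * (x * x)))"
      for x y u s b :: "real fps" by (simp add: algebra_simps)
    thus ?thesis unfolding f g St_def x .
  qed
  have sf: "sumable f"
  proof (rule sumableI)
    fix n
    have "f n = fps_X ^ (eS L 0 n + Suc L) * (if n = 0 then 0 else sgn_n n * bn (n - 1) (Suc L))"
      by (auto simp: f_def)
    moreover have "n \<le> eS L 0 n + Suc L" using eS_ge[of n L 0] by simp
    ultimately show "\<exists>e h. n \<le> e \<and> f n = fps_X ^ e * h" by blast
  qed
  have "(1 + fps_X ^ Suc L) * S L 0 = fsum f + fsum g"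
    unfolding S_def fsum_mult[OF sumable_St] fg fsum_add ..
  also have "fsum f = fsum (\<lambda>n. f (Suc n))"
    using fsum_shift[OF sf] by (simp add: f_def)
  also have "\<dots> + fsum g = S (Suc L) 24"
    unfolding fsum_add S_def
  proof (rule arg_cong[where f = fsum], rule ext)
    fix n
    have e1: "eS (Suc L) 24 n = eS L 0 n" by (simp add: eS_def)
    have e2: "eS L 0 (Suc n) + Suc L = eS L 0 n + Suc 24 * (2 * n + Suc (Suc L))"
      by (simp add: eS_def algebra_simps)
    have "f (Suc n) + g n = - (sgn_n n * fps_X ^ (eS L 0 (Suc n) + Suc L) * bn n (Suc L)) + sgn_n n * fps_X ^ eS L 0 n * bn n (Suc L)"
      unfolding g_def by (simp add: f_def)
    also have "\<dots> = St (Suc L) 24 n"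
      unfolding e2 St_def e1 by (simp only: power_add) (simp add: algebra_simps)
    finally show "f (Suc n) + g n = St (Suc L) 24 n" .
  qed
  finally show ?thesis .
qed

text \<open>The denominators grow from shelf to shelf by the factor of \<open>S_zero\<close>. Hence
  the lowest entry of a shelf equals the highest one of the next, and \<open>G_step\<close> has
  nonnegative coefficients.\<close>

definition Dn :: "nat \<Rightarrow> real fps" where
  "Dn k = J 1 * (\<Prod>i<k. 1 + fps_X ^ Suc i)"

definition G :: "nat \<Rightarrow> nat \<Rightarrow> real fps" where
  "G L m = S L m * inverse (Dn L)"

lemma prod_nth_0: "(\<And>i. i \<in> A \<Longrightarrow> f i $ 0 = 1) \<Longrightarrow> (prod f A :: real fps) $ 0 = 1"
  by (induction A rule: infinite_finite_induct) auto

lemma Dn_nth_0 [simp]: "Dn k $ 0 = 1"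
  by (simp add: Dn_def prod_nth_0)

lemma inverse_Dn: "inverse (Dn k) = (1 + fps_X ^ Suc k) * inverse (Dn (Suc k))"
proof -
  have "Dn (Suc k) = (1 + fps_X ^ Suc k) * Dn k" by (simp add: Dn_def mult_ac)
  hence "inverse (Dn (Suc k)) = inverse (1 + fps_X ^ Suc k) * inverse (Dn k)" by (simp add: fps_inverse_mult)
  moreover have "(1 + fps_X ^ Suc k) * inverse (1 + fps_X ^ Suc k) = (1 :: real fps)"
    by (rule inverse_mult_eq_1') simp
  ultimately show ?thesis by (simp flip: mult.assoc)
qed

lemma G_zero: "G k 0 = G (Suc k) 24"
  unfolding G_def inverse_Dn[of k] S_zero[symmetric] by (simp only: mult_ac)

lemma G_step:
  assumes "m \<le> 22"
  shows "G k (m + 2) = G k m + fps_X ^ (Suc k * Suc m) * (1 + fps_X ^ Suc k) * G (Suc k) (22 - m)"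
proof -
  have "S k (m + 2) = S k m + fps_X ^ (Suc k * Suc m) * S (Suc k) (22 - m)"
    using S_step[OF assms, of k] by (simp add: algebra_simps)
  hence "G k (m + 2) = G k m + fps_X ^ (Suc k * Suc m) * S (Suc k) (22 - m) * inverse (Dn k)"
    unfolding G_def by (simp add: algebra_simps)
  thus ?thesis unfolding G_def inverse_Dn[of k] by (simp only: mult_ac)
qed

text \<open>
  Every shelf starts like \<open>1\<close>, up to an order that grows with its height. Unfolding the recursions
  sufficiently far thus leaves only nonnegative contributions to a given coefficient.
\<close>

lemma eqm_G:
  assumes "m \<le> 24"
  shows "eqm (Suc k) (G k m) 1"
proof -
  have bn: "eqm (Suc k) (Dn k) (bn 0 k)"
  proof -
    have "eqm (Suc k) (J 1) (\<Prod>n\<in>Suc ` {..<k}. 1 - fps_X ^ n)"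
      unfolding J_def
    proof (rule PR_eqm)
      fix n assume "0 < n" "n < Suc k"
      hence "n = Suc (n - 1)" "n - 1 \<in> {..<k}" by auto
      hence "n \<in> Suc ` {..<k}" by (rule image_eqI)
      thus "n \<in> cl 1 {0} \<longleftrightarrow> n \<in> Suc ` {..<k}" by simp
    qed auto
    also have "(\<Prod>n\<in>Suc ` {..<k}. 1 - fps_X ^ n) = (\<Prod>i<k. 1 - fps_X ^ Suc i)"
      by (subst prod.reindex) auto
    finally have "eqm (Suc k) (Dn k) ((\<Prod>i<k. 1 - fps_X ^ Suc i) * (\<Prod>i<k. 1 + fps_X ^ Suc i))"
      unfolding Dn_def by (intro eqm_mult eqm_refl)
    also have "(\<Prod>i<k. 1 - fps_X ^ Suc i) * (\<Prod>i<k. 1 + fps_X ^ Suc i) = bn 0 k"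
      unfolding bn_def prod.distrib[symmetric]
    proof (rule prod.cong[OF refl])
      fix i
      have "fps_X ^ (2 * (0 + Suc i)) = (fps_X ^ Suc i * fps_X ^ Suc i :: real fps)"
        unfolding power_add[symmetric] by (rule arg_cong[where f = "\<lambda>e. fps_X ^ e"]) simp
      moreover have "(1 - x) * (1 + x) = 1 - x * x" for x :: "real fps" by (simp add: algebra_simps)
      ultimately show "(1 - fps_X ^ Suc i) * (1 + fps_X ^ Suc i) = (1 - fps_X ^ (2 * (0 + Suc i)) :: real fps)"
        by simp
    qed
    finally show ?thesis .
  qed
  have 0: "bn 0 k $ 0 = 1" unfolding bn_def by (rule prod_nth_0) simp
  have S: "eqm (Suc k) (S k m) (bn 0 k)"
  proof -
    have "eqm (Suc k) (fsum (\<lambda>n. St k m (Suc n))) 0"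
    proof -
      have "St k m (Suc n) $ j = 0" if "j < Suc k" for n j
      proof -
        have "24 * Suc k - m \<le> (24 * Suc k - m) * Suc n" by simp
        hence "Suc k \<le> eS k m (Suc n)" unfolding eS_def using assms by simp
        thus ?thesis using that by (simp add: St_def fps_X_power_mult_nth)
      qed
      thus ?thesis by (simp add: eqm_def fsum_def)
    qed
    moreover have "eqm (Suc k) (St k m 0) (bn 0 k * 1)"
    proof -
      have "St k m 0 = bn 0 k * (1 - fps_X ^ (Suc m * Suc k))"
        by (simp add: St_def eS_def sgn_n_def)
      moreover have "eqm (Suc k) (bn 0 k * (1 - fps_X ^ (Suc m * Suc k))) (bn 0 k * 1)"
        by (intro eqm_mult eqm_refl eqm_one_minus_X_power) simp
      ultimately show ?thesis by simp
    qed
    ultimately have "eqm (Suc k) (St k m 0 + fsum (\<lambda>n. St k m (Suc n))) (bn 0 k * 1 + 0)"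
      by (intro eqm_add)
    thus ?thesis unfolding S_def by (subst fsum_shift[OF sumable_St]) simp
  qed
  have "eqm (Suc k) (G k m) (bn 0 k * inverse (bn 0 k))"
    unfolding G_def by (intro eqm_mult S eqm_inverse bn 0 Dn_nth_0)
  also have "bn 0 k * inverse (bn 0 k) = 1" using 0 by (intro inverse_mult_eq_1') simp
  finally show ?thesis .
qed

text \<open>The coefficients up to \<open>K\<close> are followed down from shelf
  \<open>K + k\<close>, where they are those of 1. Within a shelf the entries are reached from
  \<open>m = 0\<close> upwards.\<close>

lemma nn_G:
  assumes "even m" "m \<le> 24"
  shows "nn (G k m)"
proof -
  define pos where "pos = (\<lambda>K (f :: real fps). \<forall>j\<le>K. 0 \<le> f $ j)"
  have pos_mult: "pos K (f * g)" if "pos K f" "pos K g" for K f g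
    using that unfolding pos_def fps_mult_nth by (auto intro!: sum_nonneg)
  have pos_add: "pos K (f + g)" if "pos K f" "pos K g" for K f g
    using that unfolding pos_def by auto
  have "pos K (G k (2 * i))" if "i \<le> 12" for K i
  proof -
    have "\<forall>i\<le>12. pos K (G k' (2 * i))" if "k' \<le> K + k" for k'
      using that
    proof (induction k' rule: inc_induct)
      case base
      show ?case
      proof (intro allI impI)
        fix i :: nat assume "i \<le> 12"
        hence "eqm (Suc (K + k)) (G (K + k) (2 * i)) 1" by (intro eqm_G) simp
        thus "pos K (G (K + k) (2 * i))" by (auto simp: eqm_def pos_def)
      qed
    next
      case (step n)
      show ?case
      proof (intro allI impI)
        fix i :: nat assume "i \<le> 12"
        thus "pos K (G n (2 * i))"
        proof (induction i)
          case 0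
          show ?case using step.IH[rule_format, of 12] by (simp add: G_zero)
        next
          case (Suc i)
          have e: "22 - 2 * i = 2 * (11 - i)" by simp
          have "G n (2 * Suc i) = G n (2 * i) + fps_X ^ (Suc n * Suc (2 * i)) * (1 + fps_X ^ Suc n) * G (Suc n) (2 * (11 - i))"
            using G_step[of "2 * i" n] Suc.prems unfolding e by (simp only: mult_Suc_right add.commute[of 2])
          moreover have "pos K (G (Suc n) (2 * (11 - i)))" using step.IH by simp
          moreover have "pos K (fps_X ^ (Suc n * Suc (2 * i)))" "pos K (1 + fps_X ^ Suc n)"
            by (auto simp: pos_def)
          ultimately show ?case using Suc by (auto intro!: pos_add pos_mult)
        qed
      qed
    qed
    thus ?thesis using that by auto
  qed
  moreover have "m div 2 \<le> 12" "2 * (m div 2) = m" using assms by auto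
  ultimately have "pos K (G k m)" for K by metis
  thus ?thesis by (auto simp: nn_def pos_def)
qed

section \<open>The partition series \<open>P b\<close> and their comparison\<close>

definition P :: "nat \<Rightarrow> real fps" where
  "P b = theta 50 b * inverse (J 1)"

text \<open>The summands of \<open>theta 50 b\<close> at \<open>- n\<close> and \<open>n + 1\<close>
  have opposite signs and exponents that differ by \<open>b (2 n + 1)\<close>; together they form
  the \<open>n\<close>-th term of the bottom shelf.\<close>

lemma P_eq_G:
  assumes "0 < b" "b < 25"
  shows "P b = G 0 (b - 1)"
proof -
  have b50: "0 < b" "b < 50" using assms by auto
  have adm: "adm T (thex 50 b)" for T by (rule adm_subset[OF adm_thex[OF b50]]) simp
  have e1: "thex 50 b (- int n) = eS 0 (b - 1) n" for n
  proof -
    define d where "d = 25 - b"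
    have A: "24 * Suc 0 - (b - 1) = d" and B: "Suc (b - 1) = b" and i: "int d = 25 - int b"
      using assms by (auto simp: d_def)
    have "int (thex 50 b (- int n)) = int (eS 0 (b - 1) n)"
      unfolding thex_50[OF b50] eS_def A B by (simp add: i algebra_simps)
    thus ?thesis by simp
  qed
  have e2: "thex 50 b (int n + 1) = eS 0 (b - 1) n + Suc (b - 1) * (2 * n + Suc 0)" for n
  proof -
    define d where "d = 25 - b"
    have A: "24 * Suc 0 - (b - 1) = d" and B: "Suc (b - 1) = b" and i: "int d = 25 - int b"
      using assms by (auto simp: d_def)
    have "int (thex 50 b (int n + 1)) = int (eS 0 (b - 1) n + Suc (b - 1) * (2 * n + Suc 0))"
      unfolding thex_50[OF b50] eS_def A B by (simp add: i algebra_simps)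
    thus ?thesis by (simp only: of_nat_eq_iff)
  qed
  have "theta 50 b = gf ({..0} \<union> {0<..}) sg (thex 50 b)"
    unfolding theta_def by (rule gf_cong) auto
  also have "\<dots> = gf {..0} sg (thex 50 b) + gf {0<..} sg (thex 50 b)"
    by (rule gf_Un[OF adm]) auto
  also have "gf {..0} sg (thex 50 b) = gf UNIV (\<lambda>n. (-1) ^ n) (eS 0 (b - 1))"
    by (rule gf_reindex[where h = "\<lambda>n. - int n"])
       (auto simp: e1 sg_power intro!: bij_betwI[where g = "\<lambda>n. nat (- n)"])
  also have "gf {0<..} sg (thex 50 b) = gf UNIV (\<lambda>n. - ((-1) ^ n)) (\<lambda>n. eS 0 (b - 1) n + Suc (b - 1) * (2 * n + Suc 0))"
    by (rule gf_reindex[where h = "\<lambda>n. int n + 1"])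
       (auto simp: e2 sg_power sg_def intro!: bij_betwI[where g = "\<lambda>n. nat (n - 1)"])
  also have "gf UNIV (\<lambda>n. (-1) ^ n) (eS 0 (b - 1)) + \<dots> = fsum (St 0 (b - 1))"
  proof -
    let ?r = "\<lambda>n. Suc (b - 1) * (2 * n + Suc 0)"
    have A: "gf UNIV (\<lambda>n. (-1) ^ n) (eS 0 (b - 1)) = fsum (\<lambda>n. fps_const ((-1) ^ n) * fps_X ^ eS 0 (b - 1) n)"
      by (rule gf_nat_eq_fsum[OF eS_ge])
    have "n \<le> eS 0 (b - 1) n + ?r n" for n
      using eS_ge[of n 0 "b - 1"] by simp
    hence B: "gf UNIV (\<lambda>n. - ((-1) ^ n)) (\<lambda>n. eS 0 (b - 1) n + ?r n) =
        fsum (\<lambda>n. fps_const (- ((-1) ^ n)) * fps_X ^ (eS 0 (b - 1) n + ?r n))"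
      by (rule gf_nat_eq_fsum)
    show ?thesis unfolding A B fsum_add
    proof (rule arg_cong[where f = fsum], rule ext)
      fix n
      have alg: "s * u + (- s) * (u * v) = u * (s * 1 * (1 - v))" for s u v :: "real fps"
        by (simp add: algebra_simps)
      have "bn n 0 = 1" by (simp add: bn_def)
      thus "fps_const ((-1) ^ n) * fps_X ^ eS 0 (b - 1) n + fps_const (- ((-1) ^ n)) * fps_X ^ (eS 0 (b - 1) n + ?r n) = St 0 (b - 1) n"
        unfolding St_def sgn_n_def power_add fps_const_neg[symmetric] by (simp only: alg)
    qed
  qed
  finally show ?thesis by (simp add: P_def G_def S_def Dn_def)
qed

lemma P_prod:
  assumes "0 < b" "b < 25"
  shows "P b = inverse (PR (cl 50 (- {0, b, 50 - b})))"
proof -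
  have "J 1 = PR (cl 50 {0, b, 50 - b} \<union> cl 50 (- {0, b, 50 - b}))"
    unfolding J_def by (rule PR_cong) auto
  also have "\<dots> = PR (cl 50 {0, b, 50 - b}) * PR (cl 50 (- {0, b, 50 - b}))"
    by (rule PR_Un) auto
  also have "PR (cl 50 {0, b, 50 - b}) = theta 50 b"
    by (rule theta_PR[symmetric]) (use assms in auto)
  finally have "inverse (J 1) = inverse (theta 50 b) * inverse (PR (cl 50 (- {0, b, 50 - b})))"
    by (simp add: fps_inverse_mult)
  moreover have "theta 50 b * inverse (theta 50 b) = 1"
    using assms by (intro inverse_mult_eq_1') (simp add: theta_nth_0)
  ultimately show ?thesis by (simp add: P_def flip: mult.assoc)
qed

abbreviation g :: "nat \<Rightarrow> real fps" where "g \<equiv> G 1"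

lemma P_1: "P 1 = g 24"
  using P_eq_G[of 1] G_zero[of 0] by simp

lemma P_step:
  assumes "0 < b" "b + 2 < 25"
  shows "P (b + 2) = P b + fps_X ^ b * (1 + fps_X) * g (23 - b)"
  using G_step[of "b - 1" 0] assms by (simp add: P_eq_G Suc_diff_le numeral_2_eq_2)

lemma nn_P: "0 < b \<Longrightarrow> b < 25 \<Longrightarrow> nn (P b)"
  by (simp add: P_prod nn_inverse_PR)

lemma nn_g: "even m \<Longrightarrow> m \<le> 24 \<Longrightarrow> nn (g m)"
  by (rule nn_G)

definition lef :: "real fps \<Rightarrow> real fps \<Rightarrow> bool" (infix "\<sqsubseteq>" 50) where
  "f \<sqsubseteq> h \<longleftrightarrow> nn (h - f)"

lemma lefD: "f \<sqsubseteq> h \<Longrightarrow> f $ k \<le> h $ k"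
  by (simp add: lef_def nn_def)

lemma lefI: "(\<And>k. f $ k \<le> h $ k) \<Longrightarrow> f \<sqsubseteq> h"
  by (simp add: lef_def nn_def)

lemma lef_refl [simp]: "f \<sqsubseteq> f"
  by (simp add: lef_def)

lemma lef_trans [trans]: "f \<sqsubseteq> h \<Longrightarrow> h \<sqsubseteq> l \<Longrightarrow> f \<sqsubseteq> l"
  by (meson lefD lefI order_trans)

lemma lef_add: "f \<sqsubseteq> h \<Longrightarrow> f' \<sqsubseteq> h' \<Longrightarrow> f + f' \<sqsubseteq> h + h'"
  by (rule lefI) (auto dest: lefD intro: add_mono)

lemma lef_mult: "nn f \<Longrightarrow> h \<sqsubseteq> l \<Longrightarrow> f * h \<sqsubseteq> f * l"
  unfolding lef_def using nn_mult[of f "l - h"] by (simp add: algebra_simps)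

lemma lef_nn_add: "nn h \<Longrightarrow> f \<sqsubseteq> f + h"
  by (simp add: lef_def)

lemma G_mono_step: "even m \<Longrightarrow> m \<le> 22 \<Longrightarrow> G k m \<sqsubseteq> G k (m + 2)"
  by (subst G_step, simp, rule lef_nn_add) (auto intro!: nn_mult nn_add nn_G)

lemma G_mono:
  assumes "even m" "even n" "m \<le> n" "n \<le> 24"
  shows "G k m \<sqsubseteq> G k n"
proof -
  obtain d where n: "n = m + 2 * d" using assms by (metis dvdE dvd_diff_nat le_add_diff_inverse)
  have "m + 2 * d \<le> 24 \<Longrightarrow> G k m \<sqsubseteq> G k (m + 2 * d)"
  proof (induction d)
    case (Suc d)
    hence "G k m \<sqsubseteq> G k (m + 2 * d)" by simp
    also have "\<dots> \<sqsubseteq> G k (m + 2 * d + 2)" using Suc assms by (intro G_mono_step) auto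
    finally show ?case by simp
  qed simp
  thus ?thesis using n assms by simp
qed

lemma P_mono:
  assumes "odd a" "odd b" "a \<le> b" "b < 25"
  shows "P a \<sqsubseteq> P b"
proof -
  have "0 < a" "0 < b" using assms by (auto intro: odd_pos)
  thus ?thesis using assms by (simp add: P_eq_G) (intro G_mono; auto)
qed

text \<open>Unfolded on shelf 2, both \<open>g 24 - g 12\<close> and \<open>g 12 - g 0\<close> are
  sums of six increments. Those of the first arise from those of the second by the factor
  \<open>q^24\<close> and a lowering of the shelf index.\<close>

lemma g_24_le: "g 24 \<sqsubseteq> g 12 + fps_X ^ 24 * g 12"
proof -
  let ?h = "\<lambda>m. (1 + fps_X ^ 2) * G 2 m"
  have st: "g (m + 2) = g m + fps_X ^ (2 * Suc m) * ?h (22 - m)" if "m \<le> 22" for m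
    using G_step[OF that, of 1] by (simp add: numeral_2_eq_2 mult.assoc)
  have nh: "nn (?h m)" if "even m" "m \<le> 24" for m
    using that by (auto intro!: nn_mult nn_add nn_G)
  have mh: "?h m \<sqsubseteq> ?h n" if "even m" "even n" "m \<le> n" "n \<le> 24" for m n
    using that by (intro lef_mult G_mono) (auto intro!: nn_add)
  have 1: "g 24 = g 12 + (fps_X ^ 26 * ?h 10 + fps_X ^ 30 * ?h 8 + fps_X ^ 34 * ?h 6 + fps_X ^ 38 * ?h 4 + fps_X ^ 42 * ?h 2 + fps_X ^ 46 * ?h 0)"
    using st[of 22] st[of 20] st[of 18] st[of 16] st[of 14] st[of 12] by simp
  have 2: "g 12 = g 0 + (fps_X ^ 2 * ?h 22 + fps_X ^ 6 * ?h 20 + fps_X ^ 10 * ?h 18 + fps_X ^ 14 * ?h 16 + fps_X ^ 18 * ?h 14 + fps_X ^ 22 * ?h 12)"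
    using st[of 10] st[of 8] st[of 6] st[of 4] st[of 2] st[of 0] by (simp add: numeral_2_eq_2[symmetric])
  have "fps_X ^ 26 * ?h 10 + fps_X ^ 30 * ?h 8 + fps_X ^ 34 * ?h 6 + fps_X ^ 38 * ?h 4 + fps_X ^ 42 * ?h 2 + fps_X ^ 46 * ?h 0
     \<sqsubseteq> fps_X ^ 26 * ?h 22 + fps_X ^ 30 * ?h 20 + fps_X ^ 34 * ?h 18 + fps_X ^ 38 * ?h 16 + fps_X ^ 42 * ?h 14 + fps_X ^ 46 * ?h 12"
    by (intro lef_add lef_mult mh) auto
  also have "\<dots> = fps_X ^ 24 * (fps_X ^ 2 * ?h 22 + fps_X ^ 6 * ?h 20 + fps_X ^ 10 * ?h 18 + fps_X ^ 14 * ?h 16 + fps_X ^ 18 * ?h 14 + fps_X ^ 22 * ?h 12)"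
    by (simp only: distrib_left mult.assoc[symmetric] power_add[symmetric]) simp
  also have "\<dots> \<sqsubseteq> fps_X ^ 24 * g 12"
    unfolding 2 using nn_g[of 0] by (intro lef_mult) (auto simp: lef_def)
  finally show ?thesis unfolding 1 by (intro lef_add lef_refl)
qed

text \<open>The part 1 is allowed as soon as \<open>b > 1\<close>, so the coefficients are
  nondecreasing. \<open>P 1\<close>, which starts \<open>1 + 0 q\<close>, does not have this
  property.\<close>

lemma nn_remove_P:
  assumes "1 < b" "b < 25"
  shows "nn ((1 - fps_X) * P b)"
proof -
  have "(1 - fps_X ^ 1) * inverse (PR (cl 50 (- {0, b, 50 - b}))) = inverse (PR (cl 50 (- {0, b, 50 - b}) - {1}))"
    by (rule inverse_PR_remove) (use assms in auto)
  thus ?thesis using assms by (simp add: P_prod nn_inverse_PR)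
qed

lemma nn_remove2_P:
  assumes "2 < b" "b < 25"
  shows "nn ((1 - fps_X) * (1 - fps_X ^ 2) * P b)"
proof -
  let ?S = "cl 50 (- {0, b, 50 - b})"
  have "(1 - fps_X ^ 2) * inverse (PR ?S) = inverse (PR (?S - {2}))"
    by (rule inverse_PR_remove) (use assms in auto)
  moreover have "(1 - fps_X ^ 1) * inverse (PR (?S - {2})) = inverse (PR (?S - {2} - {1}))"
    by (rule inverse_PR_remove) (use assms in auto)
  ultimately show ?thesis using assms by (simp add: P_prod nn_inverse_PR mult.assoc)
qed

definition K :: "real fps" where "K = inverse (J 2)"

lemma nn_K: "nn K"
  by (simp add: K_def J_def nn_inverse_PR)

lemma nn_remove_K: "nn ((1 - fps_X ^ 2) * K)"
proof -
  have "(1 - fps_X ^ 2) * inverse (PR (cl 2 {0})) = inverse (PR (cl 2 {0} - {2}))"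
    by (rule inverse_PR_remove) auto
  thus ?thesis by (simp add: K_def J_def nn_inverse_PR)
qed

section \<open>The ten residue classes modulo 10\<close>

lemma sec5_mult:
  assumes "s < 5"
  shows "sec 5 s ((fps_X ^ i * up5 f) * (fps_X ^ j * up5 h)) =
    (if (i + j) mod 5 = s then fps_X ^ ((i + j) div 5) * (f * h) else 0)"
proof -
  have "(fps_X ^ i * up5 f) * (fps_X ^ j * up5 h) = fps_X ^ (i + j) * up5 (f * h)"
    by (simp add: fps_compose_mult_distrib power_add mult_ac)
  thus ?thesis using sec_monom[of 5 s "i + j" "f * h"] assms by simp
qed

definition AA :: "real fps" where "AA = N eA1 + N eA2"
definition BB :: "real fps" where "BB = N eB1 + N eB2"
definition CC :: "real fps" where "CC = N eC"

text \<open>One factor \<open>inverse (J 1)\<close> is kept apart: together with a component of the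
  theta series it becomes a \<open>P b\<close>.\<close>

lemma sec5_quotient:
  fixes a s :: nat
  assumes "a \<in> {1, 3}" "b \<in> {1, 3}" "a \<noteq> b" "s < 5"
  shows "sec 5 s (sec 2 0 (theta 10 a * inverse (theta 10 b))) = sec 5 s (psi * theta 10 a) * (inverse (J 1) * K)"
    and "sec 5 s (sec 2 1 (theta 10 a * inverse (theta 10 b))) =
       fps_const (if a = 1 then -1 else 1) * (sec 5 s (theta 10 a) * (inverse (J 1) * (J 2 * inverse (J 1))))"
proof -
  have inv: "inverse (up5 f) = up5 (inverse f)" if "f $ 0 \<noteq> 0" for f :: "real fps"
    using that by (intro fps_inverse_compose[symmetric]) auto
  have J: "J 5 = up5 (J 1)" "J 10 = up5 (J 2)" by (simp_all add: J_compose)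
  have "inverse (J 5 * J 10) = up5 (inverse (J 1) * K)"
    unfolding J fps_inverse_mult K_def by (simp add: inv fps_compose_mult_distrib)
  thus "sec 5 s (sec 2 0 (theta 10 a * inverse (theta 10 b))) = sec 5 s (psi * theta 10 a) * (inverse (J 1) * K)"
    unfolding sec_quotient(1)[OF assms(1-3)] using assms by (simp add: sec_mult_compose)
  have "theta 10 a * J 10 * inverse (J 5 * J 5) = theta 10 a * up5 (inverse (J 1) * (J 2 * inverse (J 1)))"
    unfolding J fps_inverse_mult by (simp add: inv fps_compose_mult_distrib mult.assoc)
  moreover have "sec 5 s (fps_const x * f) = fps_const x * sec 5 s f" for x f
    by (rule fps_ext) simp
  ultimately show "sec 5 s (sec 2 1 (theta 10 a * inverse (theta 10 b))) =
       fps_const (if a = 1 then -1 else 1) * (sec 5 s (theta 10 a) * (inverse (J 1) * (J 2 * inverse (J 1))))"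
    unfolding sec_quotient(2)[OF assms(1-3)] using assms(4) by (simp only: sec_mult_compose zero_less_numeral)
qed

lemma psi_dissect_AA: "psi = fps_X ^ 0 * up5 AA + fps_X ^ 1 * up5 BB + fps_X ^ 3 * up5 CC"
  using psi_dissect by (simp add: AA_def BB_def CC_def)

lemma less5: "0 < (5::nat)" "1 < (5::nat)" "2 < (5::nat)" "3 < (5::nat)" "4 < (5::nat)"
  by simp_all

lemmas sec5_mults = sec5_mult[OF less5(1)] sec5_mult[OF less5(2)] sec5_mult[OF less5(3)]
  sec5_mult[OF less5(4)] sec5_mult[OF less5(5)]

lemmas sec5_monoms = sec_monom[OF less5(1) less5(1)] sec_monom[OF less5(1) less5(2)]
  sec_monom[OF less5(1) less5(3)] sec_monom[OF less5(1) less5(4)] sec_monom[OF less5(1) less5(5)]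

lemmas sec5_simps = distrib_left distrib_right left_diff_distrib right_diff_distrib sec_add sec_diff

lemma sec5_theta_1:
  "sec 5 0 (theta 10 1) = theta 50 21" "sec 5 1 (theta 10 1) = - theta 50 19"
  "sec 5 2 (theta 10 1) = fps_X ^ 2 * theta 50 9" "sec 5 3 (theta 10 1) = fps_X ^ 5 * theta 50 1"
  "sec 5 4 (theta 10 1) = - (fps_X * theta 50 11)"
  unfolding theta_1_dissect sec_add sec_diff by (simp_all only: sec5_monoms) simp_all

lemma sec5_theta_3:
  "sec 5 0 (theta 10 3) = theta 50 23" "sec 5 1 (theta 10 3) = fps_X ^ 3 * theta 50 7"
  "sec 5 2 (theta 10 3) = - (fps_X * theta 50 13)" "sec 5 3 (theta 10 3) = - theta 50 17"
  "sec 5 4 (theta 10 3) = fps_X ^ 4 * theta 50 3"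
  unfolding theta_3_dissect sec_add sec_diff by (simp_all only: sec5_monoms) simp_all

lemma sec5_psi_theta_1:
  "sec 5 0 (psi * theta 10 1) = AA * theta 50 21 - fps_X ^ 2 * (BB * theta 50 11) + fps_X ^ 3 * (CC * theta 50 9)"
  "sec 5 1 (psi * theta 10 1) = BB * theta 50 21 - AA * theta 50 19 + fps_X ^ 6 * (CC * theta 50 1)"
  "sec 5 2 (psi * theta 10 1) = fps_X ^ 2 * (AA * theta 50 9) - BB * theta 50 19 - fps_X ^ 2 * (CC * theta 50 11)"
  "sec 5 3 (psi * theta 10 1) = fps_X ^ 5 * (AA * theta 50 1) + fps_X ^ 2 * (BB * theta 50 9) + CC * theta 50 21"
  "sec 5 4 (psi * theta 10 1) = fps_X ^ 5 * (BB * theta 50 1) - fps_X * (AA * theta 50 11) - CC * theta 50 19"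
  unfolding psi_dissect_AA theta_1_dissect sec5_simps by (simp_all only: sec5_mults) simp_all

lemma sec5_psi_theta_3:
  "sec 5 0 (psi * theta 10 3) = AA * theta 50 23 + fps_X ^ 5 * (BB * theta 50 3) - fps_X ^ 2 * (CC * theta 50 13)"
  "sec 5 1 (psi * theta 10 3) = fps_X ^ 3 * (AA * theta 50 7) + BB * theta 50 23 - fps_X * (CC * theta 50 17)"
  "sec 5 2 (psi * theta 10 3) = fps_X ^ 3 * (BB * theta 50 7) + fps_X ^ 5 * (CC * theta 50 3) - fps_X * (AA * theta 50 13)"
  "sec 5 3 (psi * theta 10 3) = CC * theta 50 23 - AA * theta 50 17 - fps_X * (BB * theta 50 13)"
  "sec 5 4 (psi * theta 10 3) = fps_X ^ 4 * (AA * theta 50 3) - BB * theta 50 17 + fps_X ^ 3 * (CC * theta 50 7)"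
  unfolding psi_dissect_AA theta_3_dissect sec5_simps by (simp_all only: sec5_mults) simp_all

section \<open>Positivity\<close>

text \<open>Coefficients at integer positions, zero at negative ones, so that multiplication by a
  power of \<open>q\<close> is a shift of the argument without case distinctions.\<close>

definition ext :: "real fps \<Rightarrow> int \<Rightarrow> real" where
  "ext f x = (if x < 0 then 0 else f $ nat x)"

lemma ext_int [simp]: "ext f (int k) = f $ k"
  by (simp add: ext_def)

lemma ext_add: "ext (f + h) x = ext f x + ext h x"
  and ext_diff: "ext (f - h) x = ext f x - ext h x"
  by (auto simp: ext_def)

lemma ext_X_mult: "ext (fps_X ^ a * f) x = ext f (x - int a)"
proof (cases "x < int a")
  case False
  hence "\<not> nat x < a" "nat x - a = nat (x - int a)" by auto
  thus ?thesis using False by (simp add: ext_def fps_X_power_mult_nth)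
qed (auto simp: ext_def fps_X_power_mult_nth)

lemma ext_X_mult1: "ext (fps_X * f) x = ext f (x - 1)"
  using ext_X_mult[of 1] by simp

lemma ext_nonneg: "nn f \<Longrightarrow> 0 \<le> ext f x"
  by (simp add: ext_def nn_def)

lemma ext_lef: "f \<sqsubseteq> h \<Longrightarrow> ext f x \<le> ext h x"
  by (simp add: ext_def lefD)

text \<open>Terms with \<open>e j > x\<close> vanish, so any \<open>m > x\<close> will do. A common
  \<open>m\<close> allows sums over different exponent sequences to be compared term by
  term.\<close>

lemma ext_N_mult:
  assumes "\<And>j. j \<le> e j" "x < int m"
  shows "ext (N e * f) x = (\<Sum>j<m. ext f (x - int (e j)))"
proof (cases "x < 0")
  case True
  thus ?thesis by (simp add: ext_def)
next
  case False
  then obtain k where x: "x = int k" by (metis nonneg_int_cases not_less)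
  have adm: "adm UNIV e" using assms(1) by (rule adm_nat)
  have "(N e * f) $ k = (\<Sum>j | j \<in> UNIV \<and> e j \<le> k. 1 * f $ (k - e j))"
    unfolding N_def by (rule gf_mult_nth[OF adm])
  also have "\<dots> = (\<Sum>j | j \<in> UNIV \<and> e j \<le> k. ext f (x - int (e j)))"
    by (intro sum.cong refl) (auto simp: x ext_def nat_diff_distrib)
  also have "\<dots> = (\<Sum>j<m. ext f (x - int (e j)))"
  proof (rule sum.mono_neutral_left)
    show "{j. j \<in> UNIV \<and> e j \<le> k} \<subseteq> {..<m}"
      using assms(2) x le_trans[OF assms(1)] by fastforce
  qed (auto simp: ext_def x)
  finally show ?thesis by (simp add: x)
qed

definition incr :: "(int \<Rightarrow> real) \<Rightarrow> bool" where
  "incr F \<longleftrightarrow> (\<forall>x y. x \<le> y \<longrightarrow> F x \<le> F y) \<and> (\<forall>x. 0 \<le> F x)"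

text \<open>Monotone along each parity class, as holds for every nonnegative series times
  \<open>K\<close>.\<close>

definition incr2 :: "(int \<Rightarrow> real) \<Rightarrow> bool" where
  "incr2 F \<longleftrightarrow> (\<forall>x y. x \<le> y \<longrightarrow> even (y - x) \<longrightarrow> F x \<le> F y) \<and> (\<forall>x. 0 \<le> F x)"

lemma incrD: "incr F \<Longrightarrow> x \<le> y \<Longrightarrow> F x \<le> F y" and incr_nonneg: "incr F \<Longrightarrow> 0 \<le> F x"
  by (auto simp: incr_def)

lemma incr2D: "incr2 F \<Longrightarrow> x \<le> y \<Longrightarrow> even (y - x) \<Longrightarrow> F x \<le> F y"
  and incr2_nonneg: "incr2 F \<Longrightarrow> 0 \<le> F x"
  by (auto simp: incr2_def)

lemma ext_step:
  assumes "nn ((1 - fps_X ^ a) * f)"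
  shows "ext f (x - int a) \<le> ext f x"
proof -
  have "0 \<le> ext ((1 - fps_X ^ a) * f) x" using assms by (rule ext_nonneg)
  also have "(1 - fps_X ^ a) * f = f - fps_X ^ a * f" by (simp add: algebra_simps)
  finally show ?thesis by (simp add: ext_diff ext_X_mult)
qed

lemma ext_steps:
  assumes "nn ((1 - fps_X ^ a) * f)"
  shows "ext f (x - int (d * a)) \<le> ext f x"
proof (induction d)
  case (Suc d)
  have "ext f (x - int (d * a) - int a) \<le> ext f (x - int (d * a))"
    by (rule ext_step[OF assms])
  also have "x - int (d * a) - int a = x - int (Suc d * a)" by simp
  finally show ?case using Suc by linarith
qed simp

lemma ext_nonneg':
  assumes "nn ((1 - fps_X ^ a) * f)" "a > 0"
  shows "0 \<le> ext f x"
proof -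
  have "ext f (x - int (nat (x + 1) * a)) \<le> ext f x" by (rule ext_steps[OF assms(1)])
  moreover have "nat (x + 1) \<le> nat (x + 1) * a" using assms by simp
  hence "x - int (nat (x + 1) * a) < 0" by linarith
  ultimately show ?thesis by (simp add: ext_def)
qed

lemma incr_ext: "nn ((1 - fps_X) * f) \<Longrightarrow> incr (ext f)"
  unfolding incr_def
proof (intro conjI allI impI)
  fix x y :: int
  assume *: "nn ((1 - fps_X) * f)" and "x \<le> y"
  hence "x = y - int (nat (y - x) * 1)" by simp
  thus "ext f x \<le> ext f y" using ext_steps[of 1 f y "nat (y - x)"] * by simp
qed (use ext_nonneg'[of 1 f] in simp)

lemma incr2_ext: "nn ((1 - fps_X ^ 2) * f) \<Longrightarrow> incr2 (ext f)"
  unfolding incr2_def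
proof (intro conjI allI impI)
  fix x y :: int
  assume *: "nn ((1 - fps_X ^ 2) * f)" and "x \<le> y" "even (y - x)"
  then obtain d where "y - x = 2 * d" by (elim evenE)
  hence "x = y - int (nat d * 2)" using \<open>x \<le> y\<close> by simp
  thus "ext f x \<le> ext f y" using ext_steps[of 2 f y "nat d"] * by simp
qed (use ext_nonneg'[of 2 f] in simp)

section \<open>Interlacing of the exponents of \<open>AA\<close>, \<open>BB\<close> and
  \<open>CC\<close>\<close>

lemma e_ge: "j \<le> eA1 j" "j \<le> eA2 j" "j \<le> eB1 j" "j \<le> eB2 j" "j \<le> eC j"
proof -
  have "j \<le> j * j" by simp
  thus "j \<le> eA1 j" "j \<le> eA2 j" "j \<le> eB1 j" "j \<le> eB2 j" "j \<le> eC j"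
    using e_double[of j] by linarith+
qed

text \<open>Counted from \<open>eB2 j\<close> and with \<open>i = j + 1\<close>, the exponents
  \<open>eA2 j\<close>, \<open>eA1 i\<close>, \<open>eB1 i\<close>, \<open>eC i\<close>,
  \<open>eB2 i\<close> follow at distances \<open>i, 2 i, 3 i, 4 i, 5 i + 1\<close>. All comparisons
  below rest on this pattern.\<close>

lemma e_rel:
  "int (eB1 j) = int (eA1 j) + int j"
  "int (eC j) = int (eA1 j) + 2 * int j"
  "int (eA2 j) = int (eB2 j) + int j + 1"
  "int (eA1 (Suc j)) = int (eB2 j) + 2 * int j + 2"
  "int (eB2 (Suc j)) = int (eB2 j) + 5 * int j + 6"
  "int (eB1 (Suc j)) = int (eB2 j) + 3 * int j + 3"
  "int (eC (Suc j)) = int (eB2 j) + 4 * int j + 4"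
  using e_double[of j] e_double[of "Suc j"] by (simp_all add: algebra_simps)

lemma A_Suc: "int (eA1 (Suc j)) = int (eB1 j) + 4 * int j + 3"
  and C_Suc: "int (eC (Suc j)) = int (eB1 j) + 6 * int j + 5"
  using e_double[of j] e_double[of "Suc j"] by (simp_all add: algebra_simps)

lemma e_vals0:
  "eA1 0 = 0" "eA1 1 = 3" "eA1 2 = 11" "eA1 3 = 24"
  "eA2 0 = 2" "eA2 1 = 9" "eA2 2 = 21"
  "eB1 0 = 0" "eB1 1 = 4" "eB2 0 = 1" "eB2 1 = 7" "eB2 2 = 18"
  "eC 0 = 0" "eC 1 = 5" "eC 2 = 15" "eC 3 = 30"
  by (simp_all add: eA1_def eA2_def eB1_def eB2_def eC_def)

lemmas e_vals = e_vals0 e_vals0[unfolded One_nat_def]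

abbreviation Sm :: "nat \<Rightarrow> (int \<Rightarrow> real) \<Rightarrow> (nat \<Rightarrow> nat) \<Rightarrow> int \<Rightarrow> real" where
  "Sm m F e x \<equiv> (\<Sum>j<m. F (x - int (e j)))"

lemma ext_AA: "x < int m \<Longrightarrow> ext (AA * f) x = Sm m (ext f) eA1 x + Sm m (ext f) eA2 x"
  and ext_BB: "x < int m \<Longrightarrow> ext (BB * f) x = Sm m (ext f) eB1 x + Sm m (ext f) eB2 x"
  and ext_CC: "x < int m \<Longrightarrow> ext (CC * f) x = Sm m (ext f) eC x"
  unfolding AA_def BB_def CC_def distrib_right ext_add
  by (simp_all only: ext_N_mult[OF e_ge(1)] ext_N_mult[OF e_ge(2)] ext_N_mult[OF e_ge(3)]
      ext_N_mult[OF e_ge(4)] ext_N_mult[OF e_ge(5)])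

text \<open>Initial terms are split off for individual treatment. The variants that keep
  \<open>m + 1\<close> terms serve where a sequence is matched with another at a shifted
  index.\<close>

lemma sum_1: "(\<Sum>j<m+1. f j) = f 0 + (\<Sum>j<m. f (j + 1))"
  and sum_2: "(\<Sum>j<m+2. f j) = f 0 + f 1 + (\<Sum>j<m. f (j + 2))"
  and sum_21: "(\<Sum>j<m+2. f j) = f 0 + (\<Sum>j<m+1. f (j + 1))"
  and sum_3: "(\<Sum>j<m+3. f j) = f 0 + f 1 + f 2 + (\<Sum>j<m. f (j + 3))"
  and sum_32: "(\<Sum>j<m+3. f j) = f 0 + f 1 + (\<Sum>j<m+1. f (j + 2))"
  and sum_4: "(\<Sum>j<m+4. f j) = f 0 + f 1 + f 2 + f 3 + (\<Sum>j<m. f (j + 4))"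
  and sum_43: "(\<Sum>j<m+4. f j) = f 0 + f 1 + f 2 + (\<Sum>j<m+1. f (j + 3))"
  for m :: nat and f :: "nat \<Rightarrow> real"
  by (induction m) (simp_all add: numeral_eq_Suc)

text \<open>Moved by 2, the exponents of \<open>BB\<close> include 2, 3, 6, 9, 20, those of
  \<open>AA\<close> include 0, 2, 3, 9. The common ones cancel and 6 and 20 remain as a loss against
  0. Each later exponent of \<open>BB\<close> exceeds a partner in \<open>AA\<close>.\<close>

lemma A_minus_B_bound:
  assumes F: "incr F"
  shows "F x - F (x - 6) - F (x - 20) + Sm (m + 3) F eB1 (x - 2) + Sm (m + 3) F eB2 (x - 2)
    \<le> Sm (m + 3) F eA1 x + Sm (m + 3) F eA2 x"
proof -
  have "(\<Sum>j<m+1. F (x - 2 - int (eB1 (j + 2)))) \<le> (\<Sum>j<m+1. F (x - int (eA1 (j + 2))))"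
    by (intro sum_mono incrD[OF F]) (simp add: e_rel)
  moreover have "(\<Sum>j<m. F (x - 2 - int (eB2 (j + 3)))) \<le> (\<Sum>j<m. F (x - int (eA2 (j + 2))))"
    by (intro sum_mono incrD[OF F]) (use e_rel(3,5)[of "j + 2" for j] in \<open>simp add: numeral_eq_Suc\<close>)
  moreover have "(\<Sum>j<m+1. F (x - int (eA2 (j + 2)))) = (\<Sum>j<m. F (x - int (eA2 (j + 2)))) + F (x - int (eA2 (m + 2)))"
    by simp
  moreover have "0 \<le> F (x - int (eA2 (m + 2)))" by (rule incr_nonneg[OF F])
  moreover have "Sm (m + 3) F eA1 x = F x + F (x - 3) + (\<Sum>j<m+1. F (x - int (eA1 (j + 2))))"
    "Sm (m + 3) F eA2 x = F (x - 2) + F (x - 9) + (\<Sum>j<m+1. F (x - int (eA2 (j + 2))))"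
    "Sm (m + 3) F eB1 (x - 2) = F (x - 2) + F (x - 6) + (\<Sum>j<m+1. F (x - 2 - int (eB1 (j + 2))))"
    unfolding sum_32 by (simp_all add: e_vals)
  moreover have "Sm (m + 3) F eB2 (x - 2) = F (x - 3) + F (x - 9) + F (x - 20) + (\<Sum>j<m. F (x - 2 - int (eB2 (j + 3))))"
    unfolding sum_3 by (simp add: e_vals)
  ultimately show ?thesis by linarith
qed

text \<open>For \<open>i = j + 1\<close> the exponents \<open>eB2 j\<close>, \<open>eA2 j\<close>,
  \<open>eA1 i\<close>, \<open>eB1 i\<close> are in arithmetic progression with difference
  \<open>i\<close>, so the assumption on \<open>F\<close> settles each group of four. The exponents
  \<open>eA1 0\<close> and \<open>eB1 0\<close> cancel, and \<open>x < int m\<close> makes the shift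
  of the index harmless.\<close>

lemma B_minus_A_nonneg:
  assumes F: "\<And>i y. 0 < i \<Longrightarrow> F (y - i) + F (y - 2 * i) \<le> F y + F (y - 3 * i)"
    and neg: "\<And>y. y < 0 \<Longrightarrow> F y = 0" and x: "x < int m"
  shows "Sm m F eA1 x + Sm m F eA2 x \<le> Sm m F eB1 x + Sm m F eB2 x"
proof -
  have last: "(\<Sum>j<m. F (x - int (e j))) = F (x - int (e 0)) + (\<Sum>j<m. F (x - int (e (j + 1))))"
    if "m \<le> e m" for e :: "nat \<Rightarrow> nat"
    using sum_1[of "\<lambda>j. F (x - int (e j))" m] neg[of "x - int (e m)"] x that by simp
  have "(\<Sum>j<m. F (x - int (eA1 (j + 1))) + F (x - int (eA2 j))) \<le> (\<Sum>j<m. F (x - int (eB2 j)) + F (x - int (eB1 (j + 1))))"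
  proof (rule sum_mono)
    fix j
    have e: "x - int (eA1 (j + 1)) = x - int (eB2 j) - 2 * (int j + 1)" "x - int (eA2 j) = x - int (eB2 j) - (int j + 1)"
      "x - int (eB1 (j + 1)) = x - int (eB2 j) - 3 * (int j + 1)"
      using e_rel[of j] by auto
    show "F (x - int (eA1 (j + 1))) + F (x - int (eA2 j)) \<le> F (x - int (eB2 j)) + F (x - int (eB1 (j + 1)))"
      unfolding e using F[of "int j + 1" "x - int (eB2 j)"] by simp
  qed
  thus ?thesis using last[of eA1] last[of eB1] e_ge by (simp add: sum.distrib e_vals)
qed

lemma C_le_A:
  assumes F: "incr F"
  shows "Sm (m + 1) F eC x + F (x - 2) \<le> Sm (m + 1) F eA1 x + Sm (m + 1) F eA2 x"
proof -
  have "Sm (m + 1) F eC x \<le> Sm (m + 1) F eA1 x"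
    by (intro sum_mono incrD[OF F]) (simp add: e_rel)
  moreover have "0 \<le> (\<Sum>j<m. F (x - int (eA2 (j + 1))))" by (intro sum_nonneg incr_nonneg[OF F])
  ultimately show ?thesis unfolding sum_1[of "\<lambda>j. F (x - int (eA2 j))" m] by (simp add: e_vals)
qed

lemma C_le_B:
  assumes F: "incr F" and "y \<le> x + 1"
  shows "Sm m F eC (y - 1) \<le> Sm m F eB1 x + Sm m F eB2 x"
proof -
  have "Sm m F eC (y - 1) \<le> Sm m F eB1 x"
    by (intro sum_mono incrD[OF F]) (use assms in \<open>simp add: e_rel\<close>)
  moreover have "0 \<le> Sm m F eB2 x" by (intro sum_nonneg incr_nonneg[OF F])
  ultimately show ?thesis by simp
qed

text \<open>\<open>eA1 (j + 1)\<close> is matched with \<open>eB1 j\<close> and \<open>eA2 j\<close>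
  with \<open>eB2 j\<close>. The term of \<open>eA1 0\<close> is met by \<open>eC 0\<close>, and
  \<open>eC 1 = 5\<close> leaves the surplus \<open>F (x - 7)\<close>.\<close>

lemma A_le_B_plus_C:
  assumes F: "incr F"
  shows "Sm (m + 2) F eA1 (x - 2) + Sm (m + 2) F eA2 (x - 2) + F (x - 7)
    \<le> Sm (m + 2) F eB1 x + Sm (m + 2) F eB2 x + Sm (m + 2) F eC (x - 2)"
proof -
  have "(\<Sum>j<m+1. F (x - 2 - int (eA1 (j + 1)))) \<le> (\<Sum>j<m+1. F (x - int (eB1 j)))"
    by (intro sum_mono incrD[OF F]) (simp add: A_Suc)
  moreover have "Sm (m + 2) F eA2 (x - 2) \<le> Sm (m + 2) F eB2 x"
    by (intro sum_mono incrD[OF F]) (simp add: e_rel)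
  moreover have "0 \<le> (\<Sum>j<m. F (x - 2 - int (eC (j + 2))))" "0 \<le> F (x - int (eB1 (m + 1)))"
    by (intro sum_nonneg incr_nonneg[OF F])+
  moreover have "Sm (m + 2) F eB1 x = (\<Sum>j<m+1. F (x - int (eB1 j))) + F (x - int (eB1 (m + 1)))"
    by simp
  ultimately show ?thesis
    unfolding sum_21[of "\<lambda>j. F (x - 2 - int (eA1 j))" m] sum_2[of "\<lambda>j. F (x - 2 - int (eC j))" m]
    by (simp add: e_vals)
qed

text \<open>\<open>eB1 (j + 1)\<close> is matched with \<open>eA1 (j + 1)\<close>,
  \<open>eB2 (j + 1)\<close> with \<open>eA2 j\<close>, and the two initial terms with
  \<open>eC 0\<close> and \<open>eA1 0\<close>; the term of \<open>eC 1\<close> is the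
  surplus.\<close>

lemma B_le_C_plus_A:
  assumes F: "incr F"
  shows "Sm (m + 2) F eB1 (x - 5) + Sm (m + 2) F eB2 (x - 5) + F (x - 5)
    \<le> Sm (m + 2) F eC x + Sm (m + 2) F eA1 (x - 1) + Sm (m + 2) F eA2 (x - 1)"
proof -
  have "(\<Sum>j<m+1. F (x - 5 - int (eB1 (j + 1)))) \<le> (\<Sum>j<m+1. F (x - 1 - int (eA1 (j + 1))))"
    by (intro sum_mono incrD[OF F]) (use e_rel(1)[of "Suc j" for j] in simp)
  moreover have "(\<Sum>j<m+1. F (x - 5 - int (eB2 (j + 1)))) \<le> (\<Sum>j<m+1. F (x - 1 - int (eA2 j)))"
    by (intro sum_mono incrD[OF F]) (simp add: e_rel)
  moreover have "0 \<le> (\<Sum>j<m. F (x - int (eC (j + 2))))" "0 \<le> F (x - 1 - int (eA2 (m + 1)))"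
    by (intro sum_nonneg incr_nonneg[OF F])+
  moreover have "Sm (m + 2) F eA2 (x - 1) = (\<Sum>j<m+1. F (x - 1 - int (eA2 j))) + F (x - 1 - int (eA2 (m + 1)))"
    by simp
  moreover have "F (x - 5) \<le> F x" "F (x - 6) \<le> F (x - 1)" by (intro incrD[OF F]; simp)+
  ultimately show ?thesis
    unfolding sum_21[of "\<lambda>j. F (x - 5 - int (eB1 j))" m] sum_21[of "\<lambda>j. F (x - 5 - int (eB2 j))" m]
      sum_21[of "\<lambda>j. F (x - 1 - int (eA1 j))" m] sum_2[of "\<lambda>j. F (x - int (eC j))" m]
    by (simp add: e_vals)
qed

text \<open>Only the term of \<open>eA1 1 = 3\<close>, at position \<open>x - 7\<close>, finds no
  partner and appears as an error.\<close>

lemma A_le_B_plus: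
  assumes F: "incr F"
  shows "Sm (m + 2) F eA1 (x - 4) + Sm (m + 2) F eA2 (x - 4)
    \<le> Sm (m + 2) F eB1 x + Sm (m + 2) F eB2 x + F (x - 7)"
proof -
  have "(\<Sum>j<m. F (x - 4 - int (eA1 (j + 2)))) \<le> (\<Sum>j<m. F (x - int (eB1 (j + 1))))"
    by (intro sum_mono incrD[OF F]) (use A_Suc[of "Suc j" for j] in simp)
  moreover have "Sm (m + 2) F eA2 (x - 4) \<le> Sm (m + 2) F eB2 x"
    by (intro sum_mono incrD[OF F]) (simp add: e_rel)
  moreover have "0 \<le> F (x - int (eB1 (m + 1)))" "F (x - 4) \<le> F x"
    by (rule incr_nonneg[OF F]) (intro incrD[OF F], simp)
  moreover have "(\<Sum>j<m+1. F (x - int (eB1 (j + 1)))) = (\<Sum>j<m. F (x - int (eB1 (j + 1)))) + F (x - int (eB1 (m + 1)))"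
    by simp
  ultimately show ?thesis
    unfolding sum_2[of "\<lambda>j. F (x - 4 - int (eA1 j))" m] sum_21[of "\<lambda>j. F (x - int (eB1 j))" m]
    by (simp add: e_vals)
qed

text \<open>Matching \<open>eC (j + 1)\<close> with \<open>eB1 j\<close> and \<open>eC 0\<close>
  with \<open>eB2 0\<close> makes all distances even (\<open>6 j + 8\<close> and 2), so monotonicity
  along parity classes suffices.\<close>

lemma C_le_B_parity:
  assumes F: "incr2 F"
  shows "Sm (m + 1) F eC (x - 3) \<le> Sm (m + 1) F eB1 x + Sm (m + 1) F eB2 x"
proof -
  have "(\<Sum>j<m. F (x - 3 - int (eC (j + 1)))) \<le> (\<Sum>j<m. F (x - int (eB1 j)))"
  proof (intro sum_mono incr2D[OF F])
    fix j
    have "x - int (eB1 j) - (x - 3 - int (eC (j + 1))) = 2 * (3 * int j + 4)"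
      using C_Suc[of j] by simp
    thus "x - 3 - int (eC (j + 1)) \<le> x - int (eB1 j)" "even (x - int (eB1 j) - (x - 3 - int (eC (j + 1))))"
      by presburger+
  qed
  moreover have "F (x - 3) \<le> F (x - 1)" by (intro incr2D[OF F]) auto
  moreover have "0 \<le> F (x - int (eB1 m))" "0 \<le> (\<Sum>j<m. F (x - int (eB2 (j + 1))))"
    by (intro sum_nonneg incr2_nonneg[OF F])+
  ultimately show ?thesis
    unfolding sum_1[of "\<lambda>j. F (x - 3 - int (eC j))" m] sum_1[of "\<lambda>j. F (x - int (eB2 j))" m]
    by (simp add: e_vals)
qed

section \<open>Comparison of blocks of coefficients by parity\<close>

definition blk :: "(int \<Rightarrow> real) \<Rightarrow> nat \<Rightarrow> nat \<Rightarrow> int \<Rightarrow> real" where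
  "blk H a b x = (\<Sum>i\<in>{a..<b}. H (x - int i))"

lemma blk_mono:
  assumes H: "incr2 H" and "even ((x - int a) - (y - int u))" "y - int u \<le> x - int a" "b + u = d + a"
  shows "blk H u d y \<le> blk H a b x"
proof -
  have "blk H u d y = (\<Sum>i\<in>{a..<b}. H (y - int u + int a - int i))"
    unfolding blk_def
  proof (rule sum.reindex_bij_witness[of _ "\<lambda>i. i + u - a" "\<lambda>i. i + a - u"])
    fix i assume "i \<in> {u..<d}"
    thus "H (y - int u + int a - int (i + a - u)) = H (y - int i)" by (simp add: of_nat_diff)
  qed (use assms(4) in auto)
  also have "\<dots> \<le> blk H a b x"
    unfolding blk_def
  proof (intro sum_mono incr2D[OF H])
    fix i
    show "y - int u + int a - int i \<le> x - int i" using assms(3) by simp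
    have "x - int i - (y - int u + int a - int i) = (x - int a) - (y - int u)" by simp
    thus "even (x - int i - (y - int u + int a - int i))" using assms(2) by (simp only:)
  qed
  finally show ?thesis .
qed

lemma blk_split: "a \<le> b \<Longrightarrow> b \<le> d \<Longrightarrow> blk H a d x = blk H a b x + blk H b d x"
  unfolding blk_def by (rule sum.atLeastLessThan_concat[symmetric])

lemma blk_nonneg: "incr2 H \<Longrightarrow> 0 \<le> blk H a b x"
  unfolding blk_def by (intro sum_nonneg incr2_nonneg)

text \<open>
  As \<open>H\<close> is increasing along each parity class only, the shifts on the two sides are matched by
  parity. The first few terms are matched individually; beyond them, each block of length 3 fits
  at a suitable parity into one of the blocks of length 6.
\<close>

lemma block_bound_1:
  assumes H: "incr2 H"
  shows "H x + H (x - 1) + blk H 0 7 (x - 6) + blk H 0 7 (x - 20) + blk H 0 7 (x - 44)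
      + Sm (m + 4) (blk H 0 3) eC (x - 4) + Sm (m + 4) (blk H 0 3) eC (x - 28)
    \<le> blk H 0 7 x + Sm (m + 4) (blk H 7 13) eA1 x + Sm (m + 4) (blk H 7 13) eA2 x"
proof -
  let ?T = "blk H 0 3" and ?L = "blk H 7 13"
  have tail: "?T (x - 4 - int (eC (j + 4))) + ?T (x - 28 - int (eC (j + 4))) \<le>
      ?L (x - int (eA1 (j + 4))) + ?L (x - int (eA2 (j + 3)))" for j
  proof -
    have a: "int (eC (j + 4)) = int (eA1 (j + 4)) + 2 * int j + 8"
      "int (eC (j + 4)) = int (eA2 (j + 3)) + 3 * int j + 12"
      using e_rel(2)[of "j + 4"] e_rel(7)[of "j + 3"] e_rel(3)[of "j + 3"] by (simp_all add: numeral_eq_Suc)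
    have "?T (x - 28 - int (eC (j + 4))) \<le> blk H 8 11 (x - int (eA1 (j + 4)))"
      by (rule blk_mono[OF H]; (unfold a(1))?; simp)
    moreover have "?L y = blk H 7 8 y + blk H 8 11 y + blk H 11 13 y" for y
      using blk_split[of 7 8 13 H y] blk_split[of 8 11 13 H y] by simp
    moreover have "?T (x - 4 - int (eC (j + 4))) \<le> ?L (x - int (eA2 (j + 3)))"
    proof (cases "even j")
      case True
      have "?T (x - 4 - int (eC (j + 4))) \<le> blk H 8 11 (x - int (eA2 (j + 3)))"
        by (rule blk_mono[OF H]; (unfold a(2))?; use True in simp)
      thus ?thesis
        using blk_split[of 7 8 13 H "x - int (eA2 (j + 3))"] blk_split[of 8 11 13 H "x - int (eA2 (j + 3))"]
          blk_nonneg[OF H, of 7 8 "x - int (eA2 (j + 3))"] blk_nonneg[OF H, of 11 13 "x - int (eA2 (j + 3))"] by simp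
    next
      case False
      have "?T (x - 4 - int (eC (j + 4))) \<le> blk H 7 10 (x - int (eA2 (j + 3)))"
        by (rule blk_mono[OF H]; (unfold a(2))?; use False in simp)
      thus ?thesis using blk_split[of 7 10 13 H "x - int (eA2 (j + 3))"] blk_nonneg[OF H, of 10 13 "x - int (eA2 (j + 3))"] by simp
    qed
    ultimately show ?thesis
      using blk_nonneg[OF H, of 7 8 "x - int (eA1 (j + 4))"] blk_nonneg[OF H, of 11 13 "x - int (eA1 (j + 4))"]
      by (smt (verit))
  qed
  have "(\<Sum>j<m. ?T (x - 4 - int (eC (j + 4)))) + (\<Sum>j<m. ?T (x - 28 - int (eC (j + 4)))) \<le>
      (\<Sum>j<m. ?L (x - int (eA1 (j + 4)))) + (\<Sum>j<m. ?L (x - int (eA2 (j + 3))))"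
    unfolding sum.distrib[symmetric] by (rule sum_mono) (rule tail)
  moreover have "(\<Sum>j<m+1. ?L (x - int (eA2 (j + 3)))) = (\<Sum>j<m. ?L (x - int (eA2 (j + 3)))) + ?L (x - int (eA2 (m + 3)))"
    by simp
  moreover have "0 \<le> ?L (x - int (eA2 (m + 3)))" by (rule blk_nonneg[OF H])
  moreover have "H x + H (x - 1) + blk H 0 7 (x - 6) + blk H 0 7 (x - 20) + blk H 0 7 (x - 44)
      + (?T (x - 4) + ?T (x - 9) + ?T (x - 19) + ?T (x - 34)) + (?T (x - 28) + ?T (x - 33) + ?T (x - 43) + ?T (x - 58))
    \<le> blk H 0 7 x + (?L x + ?L (x - 3) + ?L (x - 11) + ?L (x - 24)) + (?L (x - 2) + ?L (x - 9) + ?L (x - 21))"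
  proof -
    have
    "H (x - 6) \<le> H (x - 2)"
    "H (x - 24) \<le> H (x - 10)"
    "H (x - 26) \<le> H (x - 12)"
    "H (x - 34) \<le> H (x - 12)"
    "H (x - 44) \<le> H (x - 14)"
    "H (x - 46) \<le> H (x - 16)"
    "H (x - 48) \<le> H (x - 18)"
    "H (x - 50) \<le> H (x - 18)"
    "H (x - 58) \<le> H (x - 32)"
    "H (x - 60) \<le> H (x - 32)"
    "H (x - 25) \<le> H (x - 3)"
    "H (x - 35) \<le> H (x - 11)"
    "H (x - 43) \<le> H (x - 13)"
    "H (x - 45) \<le> H (x - 13)"
    "H (x - 45) \<le> H (x - 15)"
    "H (x - 47) \<le> H (x - 17)"
    "H (x - 49) \<le> H (x - 19)"
    "H (x - 59) \<le> H (x - 31)"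
    "0 \<le> H (x - 31)"
    "0 \<le> H (x - 33)"
      by (rule incr2D[OF H] incr2_nonneg[OF H]; simp)+
    moreover have "blk H 0 7 y = H y + H (y - 1) + H (y - 2) + H (y - 3) + H (y - 4) + H (y - 5) + H (y - 6)"
      "?T y = H y + H (y - 1) + H (y - 2)"
      "?L y = H (y - 7) + H (y - 8) + H (y - 9) + H (y - 10) + H (y - 11) + H (y - 12)" for y
      by (simp_all add: blk_def atLeastLessThan_nat_numeral sum.atLeastLessThan_Suc numeral_eq_Suc)
    ultimately show ?thesis by simp
  qed
  ultimately show ?thesis
    unfolding sum_4[of "\<lambda>j. ?T (x - 4 - int (eC j))" m] sum_4[of "\<lambda>j. ?T (x - 28 - int (eC j))" m]
      sum_4[of "\<lambda>j. ?L (x - int (eA1 j))" m] sum_43[of "\<lambda>j. ?L (x - int (eA2 j))" m]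
    by (simp add: e_vals)
qed

text \<open>In the tail, the block of length 7 at \<open>eC (j + 2)\<close> lies at an even distance
  below the first seven entries of the block of length 10 at \<open>eB2 (j + 1)\<close>. The block
  of length 3 goes to \<open>eB1 (j + 2)\<close>, where its position depends on the parity of
  \<open>j\<close>. The terms \<open>H (x - 4) + H (x - 5)\<close> are left over for
  strictness.\<close>

lemma block_bound_2:
  assumes H: "incr2 H"
  shows "H (x - 4) + H (x - 5) + blk H 0 3 (x - 7) + blk H 0 3 (x - 31)
      + Sm (m + 2) (blk H 0 7) eC (x - 3) + Sm (m + 2) (blk H 0 3) eC (x - 27)
    \<le> Sm (m + 2) (blk H 3 13) eB1 x + Sm (m + 2) (blk H 3 13) eB2 x"
proof -
  let ?T = "blk H 0 3" and ?S = "blk H 0 7" and ?L = "blk H 3 13"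
  have tail: "?S (x - 3 - int (eC (j + 2))) + ?T (x - 27 - int (eC (j + 2))) \<le>
      ?L (x - int (eB1 (j + 2))) + ?L (x - int (eB2 (j + 1)))" for j
  proof -
    have a: "int (eC (j + 2)) = int (eB1 (j + 2)) + int j + 2"
      "int (eC (j + 2)) = int (eB2 (j + 1)) + 4 * int j + 8"
      using e_rel(1,2)[of "j + 2"] e_rel(7)[of "j + 1"] by (simp_all add: numeral_eq_Suc)
    have "?S (x - 3 - int (eC (j + 2))) \<le> blk H 3 10 (x - int (eB2 (j + 1)))"
      by (rule blk_mono[OF H]; (unfold a(2))?; simp)
    moreover have "?T (x - 27 - int (eC (j + 2))) \<le> ?L (x - int (eB1 (j + 2)))"
    proof (cases "even j")
      case True
      have "?T (x - 27 - int (eC (j + 2))) \<le> blk H 3 6 (x - int (eB1 (j + 2)))"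
        by (rule blk_mono[OF H]; (unfold a(1))?; use True in simp)
      thus ?thesis using blk_split[of 3 6 13 H "x - int (eB1 (j + 2))"] blk_nonneg[OF H, of 6 13 "x - int (eB1 (j + 2))"] by simp
    next
      case False
      have "?T (x - 27 - int (eC (j + 2))) \<le> blk H 4 7 (x - int (eB1 (j + 2)))"
        by (rule blk_mono[OF H]; (unfold a(1))?; use False in simp)
      thus ?thesis
        using blk_split[of 3 4 13 H "x - int (eB1 (j + 2))"] blk_split[of 4 7 13 H "x - int (eB1 (j + 2))"]
          blk_nonneg[OF H, of 3 4 "x - int (eB1 (j + 2))"] blk_nonneg[OF H, of 7 13 "x - int (eB1 (j + 2))"] by simp
    qed
    ultimately show ?thesis
      using blk_split[of 3 10 13 H "x - int (eB2 (j + 1))"] blk_nonneg[OF H, of 10 13 "x - int (eB2 (j + 1))"] by simp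
  qed
  have "(\<Sum>j<m. ?S (x - 3 - int (eC (j + 2)))) + (\<Sum>j<m. ?T (x - 27 - int (eC (j + 2)))) \<le>
      (\<Sum>j<m. ?L (x - int (eB1 (j + 2)))) + (\<Sum>j<m. ?L (x - int (eB2 (j + 1))))"
    unfolding sum.distrib[symmetric] by (rule sum_mono) (rule tail)
  moreover have "(\<Sum>j<m+1. ?L (x - int (eB2 (j + 1)))) = (\<Sum>j<m. ?L (x - int (eB2 (j + 1)))) + ?L (x - int (eB2 (m + 1)))"
    by simp
  moreover have "0 \<le> ?L (x - int (eB2 (m + 1)))" by (rule blk_nonneg[OF H])
  moreover have "H (x - 4) + H (x - 5) + ?T (x - 7) + ?T (x - 31)
      + (?S (x - 3) + ?S (x - 8)) + (?T (x - 27) + ?T (x - 32))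
    \<le> (?L x + ?L (x - 4)) + ?L (x - 1)"
  proof -
    have
    "H (x - 28) \<le> H (x - 6)"
    "H (x - 32) \<le> H (x - 10)"
    "H (x - 34) \<le> H (x - 12)"
    "0 \<le> H (x - 12)"
    "0 \<le> H (x - 16)"
    "H (x - 27) \<le> H (x - 7)"
    "H (x - 29) \<le> H (x - 11)"
    "H (x - 31) \<le> H (x - 11)"
    "H (x - 33) \<le> H (x - 13)"
    "H (x - 33) \<le> H (x - 15)"
      by (rule incr2D[OF H] incr2_nonneg[OF H]; simp)+
    moreover have "?S y = H y + H (y - 1) + H (y - 2) + H (y - 3) + H (y - 4) + H (y - 5) + H (y - 6)"
      "?T y = H y + H (y - 1) + H (y - 2)"
      "?L y = H (y - 3) + H (y - 4) + H (y - 5) + H (y - 6) + H (y - 7) + H (y - 8) + H (y - 9) + H (y - 10) + H (y - 11) + H (y - 12)" for y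
      by (simp_all add: blk_def atLeastLessThan_nat_numeral sum.atLeastLessThan_Suc numeral_eq_Suc)
    ultimately show ?thesis by simp
  qed
  ultimately show ?thesis
    unfolding sum_2[of "\<lambda>j. ?S (x - 3 - int (eC j))" m] sum_2[of "\<lambda>j. ?T (x - 27 - int (eC j))" m]
      sum_2[of "\<lambda>j. ?L (x - int (eB1 j))" m] sum_21[of "\<lambda>j. ?L (x - int (eB2 j))" m]
    by (simp add: e_vals)
qed

section \<open>Positivity of the even classes\<close>

lemma nn_N: "nn (N e)"
  by (simp add: nn_def N_def gf_nth sum_nonneg)

lemma nn_AA: "nn AA" and nn_BB: "nn BB" and nn_CC: "nn CC"
  by (simp_all add: AA_def BB_def CC_def nn_add nn_N)

lemma inverse_PR_nth_0 [simp]: "inverse (PR T) $ 0 = 1"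
  by simp

lemma K_nth_0 [simp]: "K $ 0 = 1"
  by (simp add: K_def)

lemma P_nth_0: "0 < b \<Longrightarrow> b < 25 \<Longrightarrow> P b $ 0 = 1"
  by (simp add: P_prod)

lemma g_nth_0: "m \<le> 24 \<Longrightarrow> g m $ 0 = 1"
  using eqm_G[of m 1] by (simp add: eqm_def)

lemma incr_PK: "1 < b \<Longrightarrow> b < 25 \<Longrightarrow> incr (ext (P b * K))"
  by (rule incr_ext) (use nn_mult[OF nn_remove_P nn_K] in \<open>simp add: mult.assoc\<close>)

lemma incr2_mult_K:
  assumes "nn f" shows "incr2 (ext (f * K))"
proof (rule incr2_ext)
  have "(1 - fps_X ^ 2) * (f * K) = f * ((1 - fps_X ^ 2) * K)" by (simp only: mult_ac)
  thus "nn ((1 - fps_X ^ 2) * (f * K))" using nn_mult[OF assms nn_remove_K] by (simp only:)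
qed

lemma PK_ge_1:
  assumes "1 < b" "b < 25" "0 \<le> x"
  shows "1 \<le> ext (P b * K) x"
proof -
  have "ext (P b * K) 0 \<le> ext (P b * K) x" by (rule incrD[OF incr_PK]) (use assms in auto)
  thus ?thesis using assms by (simp add: ext_def P_nth_0)
qed

lemma incr2_ge_1:
  assumes "incr2 F" "F 0 = 1" "even x" "0 \<le> x"
  shows "1 \<le> F x"
  using incr2D[OF assms(1), of 0 x] assms by simp

lemma lef_mult_right: "nn f \<Longrightarrow> h \<sqsubseteq> l \<Longrightarrow> h * f \<sqsubseteq> l * f"
  using lef_mult[of f h l] by (simp add: mult.commute)

lemma ext_mult_mono:
  assumes "nn f" "a \<le> b" "odd a" "odd b" "b < 25"
  shows "ext (f * (P a * K)) x \<le> ext (f * (P b * K)) x"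
  by (intro ext_lef lef_mult lef_mult_right P_mono nn_K assms)

lemma P_3: "P 3 = P 1 + fps_X * (1 + fps_X) * g 22"
  using P_step[of 1] by (simp add: numeral_3_eq_3)

text \<open>\<open>P 11\<close> exceeds \<open>P 9\<close> by \<open>q^8\<close> times
  \<open>q (1 + q) g 14\<close>, and the latter is below \<open>P 3 - P 1\<close>, hence below
  \<open>P 9\<close>.\<close>

lemma P_11_le: "P 11 \<sqsubseteq> P 9 + fps_X ^ 8 * P 9"
proof -
  have p: "P 11 = P 9 + fps_X ^ 8 * (fps_X * (1 + fps_X) * g 14)"
    using P_step[of 9] by (simp add: mult.assoc[symmetric] power_Suc2[symmetric])
  have "fps_X * (1 + fps_X) * g 14 \<sqsubseteq> fps_X * (1 + fps_X) * g 22"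
    by (intro lef_mult G_mono nn_mult nn_add) auto
  also have "\<dots> \<sqsubseteq> P 3"
    unfolding P_3 using nn_P[of 1] by (simp add: lef_def)
  also have "\<dots> \<sqsubseteq> P 9" by (rule P_mono) auto
  finally show ?thesis unfolding p by (intro lef_add lef_refl lef_mult) auto
qed

text \<open>On \<open>P 11\<close> the first two terms may lose \<open>F (x - 20)\<close>. By
  \<open>P_11_le\<close> this is covered by the \<open>CC\<close> terms at \<open>x - 8\<close> and
  \<open>x - 18\<close>, and the one at \<open>x - 3\<close> gives strictness.\<close>

lemma pos_1_0:
  assumes "k \<ge> 3"
  shows "0 < (AA * (P 21 * K) - fps_X ^ 2 * (BB * (P 11 * K)) + fps_X ^ 3 * (CC * (P 9 * K))) $ k"
proof -
  define x where "x = int k"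
  have xle: "x \<le> int k" by (simp add: x_def)
  let ?F = "ext (P 11 * K)" and ?F9 = "ext (P 9 * K)"
  have F: "incr ?F" "incr ?F9" by (rule incr_PK; simp)+
  have "ext (AA * (P 11 * K)) x \<le> ext (AA * (P 21 * K)) x"
    by (rule ext_mult_mono) (auto simp: nn_AA)
  moreover have "?F x - ?F (x - 6) - ?F (x - 20) + ext (fps_X ^ 2 * (BB * (P 11 * K))) x \<le> ext (AA * (P 11 * K)) x"
    using A_minus_B_bound[OF F(1), of x k] unfolding ext_X_mult
    using xle by (simp add: ext_AA[of x "k + 3"] ext_BB[of "x - 2" "k + 3"])
  moreover have "?F (x - 6) \<le> ?F x" by (rule incrD[OF F(1)]) simp
  moreover have "?F9 (x - 3) + ?F9 (x - 8) + ?F9 (x - 18) \<le> ext (fps_X ^ 3 * (CC * (P 9 * K))) x"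
  proof -
    have "ext (fps_X ^ 3 * (CC * (P 9 * K))) x = Sm (k + 3) ?F9 eC (x - 3)"
      unfolding ext_X_mult using xle by (simp add: ext_CC[of "x - 3" "k + 3"])
    moreover have "0 \<le> (\<Sum>j<k. ?F9 (x - 3 - int (eC (j + 3))))" by (intro sum_nonneg incr_nonneg[OF F(2)])
    ultimately show ?thesis unfolding sum_3[of "\<lambda>j. ?F9 (x - 3 - int (eC j))" k] by (simp add: e_vals)
  qed
  moreover have "?F (x - 20) \<le> ?F9 (x - 20) + ?F9 (x - 28)"
  proof -
    have "P 11 * K \<sqsubseteq> (P 9 + fps_X ^ 8 * P 9) * K" by (intro lef_mult_right nn_K P_11_le)
    hence "?F (x - 20) \<le> ext ((P 9 + fps_X ^ 8 * P 9) * K) (x - 20)" by (rule ext_lef)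
    also have "(P 9 + fps_X ^ 8 * P 9) * K = P 9 * K + fps_X ^ 8 * (P 9 * K)" by (simp add: algebra_simps)
    finally show ?thesis by (simp add: ext_add ext_X_mult)
  qed
  moreover have "?F9 (x - 20) \<le> ?F9 (x - 8)" "?F9 (x - 28) \<le> ?F9 (x - 18)" by (intro incrD[OF F(2)]; simp)+
  moreover have "1 \<le> ?F9 (x - 3)" by (rule PK_ge_1) (use assms in \<open>auto simp: x_def\<close>)
  ultimately have "0 < ext (AA * (P 21 * K) - fps_X ^ 2 * (BB * (P 11 * K)) + fps_X ^ 3 * (CC * (P 9 * K))) x"
    unfolding ext_add ext_diff by linarith
  thus ?thesis by (simp add: x_def)
qed

text \<open>The polynomial \<open>(1 - q^i) (1 - q^(2 i))\<close> is
  \<open>(1 - q) (1 - q^2)\<close> times two geometric sums, so the case \<open>i = 1\<close>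
  implies all others. The claim is its expansion.\<close>

lemma nn_two_factors:
  assumes "nn ((1 - fps_X) * (1 - fps_X ^ 2) * f)" "0 < i"
  shows "ext f (y - i) + ext f (y - 2 * i) \<le> ext f y + ext f (y - 3 * i)"
proof -
  define n where "n = nat i"
  have i: "i = int n" using assms by (simp add: n_def)
  let ?X = "fps_X :: real fps"
  have 1: "1 - ?X ^ n = (1 - ?X) * (\<Sum>r<n. ?X ^ r)" by (rule one_diff_power_eq)
  have 2: "1 - ?X ^ (2 * n) = (1 - ?X ^ 2) * (\<Sum>r<n. (?X ^ 2) ^ r)"
    using one_diff_power_eq[of "?X ^ 2" n] by (simp only: power_mult)
  have s: "nn (\<Sum>r\<in>A. t r)" if "\<And>r. nn (t r)" for A :: "nat set" and t
    using that by (induction A rule: infinite_finite_induct) (auto intro: nn_add)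
  have "nn ((\<Sum>r<n. ?X ^ r) * (\<Sum>r<n. (?X ^ 2) ^ r) * ((1 - ?X) * (1 - ?X ^ 2) * f))"
    by (intro nn_mult assms s) (auto simp flip: power_mult)
  also have "(\<Sum>r<n. ?X ^ r) * (\<Sum>r<n. (?X ^ 2) ^ r) * ((1 - ?X) * (1 - ?X ^ 2) * f) = (1 - ?X ^ n) * (1 - ?X ^ (2 * n)) * f"
    unfolding 1 2 by (simp only: mult_ac)
  also have "\<dots> = f - ?X ^ n * f - ?X ^ (2 * n) * f + ?X ^ (3 * n) * f"
  proof -
    have "?X ^ (3 * n) = ?X ^ n * ?X ^ (2 * n)" by (simp flip: power_add)
    thus ?thesis by (simp add: algebra_simps)
  qed
  finally have "0 \<le> ext (f - ?X ^ n * f - ?X ^ (2 * n) * f + ?X ^ (3 * n) * f) y" by (rule ext_nonneg)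
  thus ?thesis unfolding ext_add ext_diff ext_X_mult by (simp add: i)
qed

text \<open>The first two terms, compared on \<open>P 19\<close>, give only a nonnegative
  contribution; strictness comes from the \<open>CC\<close> term. As \<open>P 1 * K\<close> is
  monotone by parity only, its position \<open>x - 6\<close> serves even \<open>x\<close> and
  \<open>x - 11\<close> odd \<open>x\<close>, whence the threshold 11.\<close>

lemma pos_1_1:
  assumes "k \<ge> 11"
  shows "0 < (BB * (P 21 * K) - AA * (P 19 * K) + fps_X ^ 6 * (CC * (P 1 * K))) $ k"
proof -
  define x where "x = int k"
  have xle: "x \<le> int k" by (simp add: x_def)
  let ?F = "ext (P 19 * K)" and ?F1 = "ext (P 1 * K)"
  have F1: "incr2 ?F1" by (intro incr2_mult_K nn_P) auto
  have "ext (BB * (P 19 * K)) x \<le> ext (BB * (P 21 * K)) x"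
    by (rule ext_mult_mono) (auto simp: nn_BB)
  moreover have "ext (AA * (P 19 * K)) x \<le> ext (BB * (P 19 * K)) x"
  proof -
    have "nn ((1 - fps_X) * (1 - fps_X ^ 2) * (P 19 * K))"
      using nn_mult[OF nn_remove2_P[of 19] nn_K] by (simp add: mult.assoc)
    hence "?F (y - i) + ?F (y - 2 * i) \<le> ?F y + ?F (y - 3 * i)" if "0 < i" for i y
      using that by (rule nn_two_factors)
    hence "Sm (k + 1) ?F eA1 x + Sm (k + 1) ?F eA2 x \<le> Sm (k + 1) ?F eB1 x + Sm (k + 1) ?F eB2 x"
      by (rule B_minus_A_nonneg) (auto simp: x_def ext_def)
    thus ?thesis using xle by (simp add: ext_AA[of x "k + 1"] ext_BB[of x "k + 1"])
  qed
  moreover have "?F1 (x - 6) + ?F1 (x - 11) \<le> ext (fps_X ^ 6 * (CC * (P 1 * K))) x"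
  proof -
    have "ext (fps_X ^ 6 * (CC * (P 1 * K))) x = Sm (k + 2) ?F1 eC (x - 6)"
      unfolding ext_X_mult using xle by (simp add: ext_CC[of "x - 6" "k + 2"])
    moreover have "0 \<le> (\<Sum>j<k. ?F1 (x - 6 - int (eC (j + 2))))" by (intro sum_nonneg incr2_nonneg[OF F1])
    ultimately show ?thesis unfolding sum_2[of "\<lambda>j. ?F1 (x - 6 - int (eC j))" k] by (simp add: e_vals)
  qed
  moreover have "0 < ?F1 (x - 6) + ?F1 (x - 11)"
  proof -
    have z: "?F1 0 = 1" by (simp add: ext_def P_nth_0)
    have nn: "0 \<le> ?F1 (x - 6)" "0 \<le> ?F1 (x - 11)" by (rule incr2_nonneg[OF F1])+
    show ?thesis
    proof (cases "even x")
      case True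
      have "1 \<le> ?F1 (x - 6)" by (rule incr2_ge_1[OF F1 z]) (use assms True in \<open>auto simp: x_def\<close>)
      thus ?thesis using nn by linarith
    next
      case False
      have "1 \<le> ?F1 (x - 11)" by (rule incr2_ge_1[OF F1 z]) (use assms False in \<open>auto simp: x_def\<close>)
      thus ?thesis using nn by linarith
    qed
  qed
  ultimately have "0 < ext (BB * (P 21 * K) - AA * (P 19 * K) + fps_X ^ 6 * (CC * (P 1 * K))) x"
    unfolding ext_add ext_diff by linarith
  thus ?thesis by (simp add: x_def)
qed

text \<open>The pattern of the simpler classes: positive terms are lowered, or negative ones raised,
  to a common \<open>P b\<close>, here \<open>P 9\<close>. The exponents then decide and leave a
  coefficient of \<open>P b * K\<close> as surplus.\<close>

lemma pos_1_2:
  assumes "k \<ge> 7"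
  shows "0 < (BB * (P 19 * K) + fps_X ^ 2 * (CC * (P 11 * K)) - fps_X ^ 2 * (AA * (P 9 * K))) $ k"
proof -
  define x where "x = int k"
  have xle: "x \<le> int k" by (simp add: x_def)
  let ?F = "ext (P 9 * K)"
  have F: "incr ?F" by (rule incr_PK) auto
  have "ext (BB * (P 9 * K)) x \<le> ext (BB * (P 19 * K)) x"
    by (rule ext_mult_mono) (auto simp: nn_BB)
  moreover have "ext (fps_X ^ 2 * (CC * (P 9 * K))) x \<le> ext (fps_X ^ 2 * (CC * (P 11 * K))) x"
    unfolding ext_X_mult by (rule ext_mult_mono) (auto simp: nn_CC)
  moreover have "ext (fps_X ^ 2 * (AA * (P 9 * K))) x + ?F (x - 7) \<le> ext (BB * (P 9 * K)) x + ext (fps_X ^ 2 * (CC * (P 9 * K))) x"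
    using A_le_B_plus_C[OF F, of x k] unfolding ext_X_mult
    using xle by (simp add: ext_AA[of "x - 2" "k + 2"] ext_BB[of x "k + 2"] ext_CC[of "x - 2" "k + 2"])
  moreover have "1 \<le> ?F (x - 7)" by (rule PK_ge_1) (use assms in \<open>auto simp: x_def\<close>)
  ultimately have "0 < ext (BB * (P 19 * K) + fps_X ^ 2 * (CC * (P 11 * K)) - fps_X ^ 2 * (AA * (P 9 * K))) x"
    unfolding ext_add ext_diff by linarith
  thus ?thesis by (simp add: x_def)
qed

lemma ext_CC_ge: "incr (ext f) \<Longrightarrow> ext f (int k) \<le> ext (CC * f) (int k)"
  using ext_CC[of "int k" "k + 1" f] sum_1[of "\<lambda>j. ext f (int k - int (eC j))" k]
  by (simp add: e_vals sum_nonneg incr_nonneg)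

lemma pos_1_3:
  "0 < (fps_X ^ 5 * (AA * (P 1 * K)) + fps_X ^ 2 * (BB * (P 9 * K)) + CC * (P 21 * K)) $ k"
proof -
  define x where "x = int k"
  have xle: "x \<le> int k" by (simp add: x_def)
  have "0 \<le> ext (fps_X ^ 5 * (AA * (P 1 * K))) x" "0 \<le> ext (fps_X ^ 2 * (BB * (P 9 * K))) x"
    by (intro ext_nonneg nn_mult nn_AA nn_BB nn_K nn_P nn_X_power; simp)+
  moreover have "ext (P 21 * K) x \<le> ext (CC * (P 21 * K)) x"
    unfolding x_def by (intro ext_CC_ge incr_PK) auto
  moreover have "1 \<le> ext (P 21 * K) x" by (rule PK_ge_1) (auto simp: x_def)
  ultimately have "0 < ext (fps_X ^ 5 * (AA * (P 1 * K)) + fps_X ^ 2 * (BB * (P 9 * K)) + CC * (P 21 * K)) x"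
    unfolding ext_add ext_diff by linarith
  thus ?thesis by (simp add: x_def)
qed

lemma pos_1_4:
  assumes "k \<ge> 5"
  shows "0 < (fps_X * (AA * (P 11 * K)) + CC * (P 19 * K) - fps_X ^ 5 * (BB * (P 1 * K))) $ k"
proof -
  define x where "x = int k"
  have xle: "x \<le> int k" by (simp add: x_def)
  let ?F = "ext (P 11 * K)"
  have F: "incr ?F" by (rule incr_PK) auto
  have "ext (CC * (P 11 * K)) x \<le> ext (CC * (P 19 * K)) x"
    by (rule ext_mult_mono) (auto simp: nn_CC)
  moreover have "ext (fps_X ^ 5 * (BB * (P 1 * K))) x \<le> ext (fps_X ^ 5 * (BB * (P 11 * K))) x"
    unfolding ext_X_mult by (rule ext_mult_mono) (auto simp: nn_BB)
  moreover have "ext (fps_X ^ 5 * (BB * (P 11 * K))) x + ?F (x - 5) \<le> ext (CC * (P 11 * K)) x + ext (fps_X * (AA * (P 11 * K))) x"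
    using B_le_C_plus_A[OF F, of x k] unfolding ext_X_mult ext_X_mult1
    using xle by (simp add: ext_AA[of "x - 1" "k + 2"] ext_BB[of "x - 5" "k + 2"] ext_CC[of x "k + 2"])
  moreover have "1 \<le> ?F (x - 5)" by (rule PK_ge_1) (use assms in \<open>auto simp: x_def\<close>)
  ultimately have "0 < ext (fps_X * (AA * (P 11 * K)) + CC * (P 19 * K) - fps_X ^ 5 * (BB * (P 1 * K))) x"
    unfolding ext_add ext_diff by linarith
  thus ?thesis by (simp add: x_def)
qed

lemma pos_3_0:
  assumes "k \<ge> 2"
  shows "0 < (AA * (P 23 * K) + fps_X ^ 5 * (BB * (P 3 * K)) - fps_X ^ 2 * (CC * (P 13 * K))) $ k"
proof -
  define x where "x = int k"
  have xle: "x \<le> int k" by (simp add: x_def)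
  let ?F = "ext (P 13 * K)"
  have F: "incr ?F" by (rule incr_PK) auto
  have "ext (AA * (P 13 * K)) x \<le> ext (AA * (P 23 * K)) x"
    by (rule ext_mult_mono) (auto simp: nn_AA)
  moreover have "0 \<le> ext (fps_X ^ 5 * (BB * (P 3 * K))) x"
    by (intro ext_nonneg nn_mult nn_BB nn_K nn_P nn_X_power; simp)
  moreover have "ext (fps_X ^ 2 * (CC * (P 13 * K))) x + ?F (x - 2) \<le> ext (AA * (P 13 * K)) x"
  proof -
    have "Sm (k + 1) ?F eC (x - 2) \<le> Sm (k + 1) ?F eC x"
      by (intro sum_mono incrD[OF F]) simp
    thus ?thesis
      using C_le_A[OF F, of x k] unfolding ext_X_mult
      using xle by (simp add: ext_AA[of x "k + 1"] ext_CC[of "x - 2" "k + 1"])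
  qed
  moreover have "1 \<le> ?F (x - 2)" by (rule PK_ge_1) (use assms in \<open>auto simp: x_def\<close>)
  ultimately have "0 < ext (AA * (P 23 * K) + fps_X ^ 5 * (BB * (P 3 * K)) - fps_X ^ 2 * (CC * (P 13 * K))) x"
    unfolding ext_add ext_diff by linarith
  thus ?thesis by (simp add: x_def)
qed

lemma pos_3_1:
  assumes "k \<ge> 3"
  shows "0 < (fps_X ^ 3 * (AA * (P 7 * K)) + BB * (P 23 * K) - fps_X * (CC * (P 17 * K))) $ k"
proof -
  define x where "x = int k"
  have xle: "x \<le> int k" by (simp add: x_def)
  let ?F = "ext (P 17 * K)" and ?F7 = "ext (P 7 * K)"
  have F: "incr ?F" "incr ?F7" by (rule incr_PK; simp)+
  have "ext (BB * (P 17 * K)) x \<le> ext (BB * (P 23 * K)) x"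
    by (rule ext_mult_mono) (auto simp: nn_BB)
  moreover have "ext (fps_X * (CC * (P 17 * K))) x \<le> ext (BB * (P 17 * K)) x"
    using C_le_B[OF F(1), of x x "k + 1"] unfolding ext_X_mult1
    using xle by (simp add: ext_BB[of x "k + 1"] ext_CC[of "x - 1" "k + 1"])
  moreover have "?F7 (x - 3) \<le> ext (fps_X ^ 3 * (AA * (P 7 * K))) x"
  proof -
    have "0 \<le> (\<Sum>j<k. ?F7 (x - 3 - int (eA1 (j + 1))))" "0 \<le> Sm (k + 1) ?F7 eA2 (x - 3)"
      by (intro sum_nonneg incr_nonneg[OF F(2)])+
    thus ?thesis
      unfolding ext_X_mult using sum_1[of "\<lambda>j. ?F7 (x - 3 - int (eA1 j))" k]
      using xle by (simp add: ext_AA[of "x - 3" "k + 1"] e_vals)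
  qed
  moreover have "1 \<le> ?F7 (x - 3)" by (rule PK_ge_1) (use assms in \<open>auto simp: x_def\<close>)
  ultimately have "0 < ext (fps_X ^ 3 * (AA * (P 7 * K)) + BB * (P 23 * K) - fps_X * (CC * (P 17 * K))) x"
    unfolding ext_add ext_diff by linarith
  thus ?thesis by (simp add: x_def)
qed

text \<open>The three steps from \<open>P 17\<close> to \<open>P 23\<close> are compared with those
  from \<open>P 1\<close> to \<open>P 7\<close>: they carry an extra \<open>q^16\<close> and smaller
  entries of the shelf.\<close>

lemma P_23_le: "P 23 \<sqsubseteq> P 17 + fps_X ^ 16 * P 13"
proof -
  let ?Y = "fps_X * (1 + fps_X) :: real fps"
  have p23: "P 23 = P 17 + (fps_X ^ 16 * (?Y * g 6) + fps_X ^ 18 * (?Y * g 4) + fps_X ^ 20 * (?Y * g 2))"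
    using P_step[of 17] P_step[of 19] P_step[of 21]
    by (simp add: mult.assoc[symmetric] power_Suc2[symmetric])
  have p7: "P 7 = P 1 + (?Y * g 22 + fps_X ^ 2 * (?Y * g 20) + fps_X ^ 4 * (?Y * g 18))"
    using P_3 P_step[of 3] P_step[of 5]
    by (simp add: mult.assoc[symmetric] power_Suc2[symmetric])
  have Y: "?Y * g a \<sqsubseteq> ?Y * g b" if "even a" "even b" "a \<le> b" "b \<le> 24" for a b
    using that by (intro lef_mult G_mono nn_mult nn_add) auto
  have "fps_X ^ 16 * (?Y * g 6) + fps_X ^ 18 * (?Y * g 4) + fps_X ^ 20 * (?Y * g 2)
    \<sqsubseteq> fps_X ^ 16 * (?Y * g 22) + fps_X ^ 18 * (?Y * g 20) + fps_X ^ 20 * (?Y * g 18)"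
    by (intro lef_add lef_mult Y) auto
  also have "\<dots> = fps_X ^ 16 * (?Y * g 22 + fps_X ^ 2 * (?Y * g 20) + fps_X ^ 4 * (?Y * g 18))"
    by (simp only: distrib_left mult.assoc[symmetric] power_add[symmetric]) simp
  also have "\<dots> \<sqsubseteq> fps_X ^ 16 * P 7"
    unfolding p7 using nn_P[of 1] by (intro lef_mult) (auto simp: lef_def)
  also have "\<dots> \<sqsubseteq> fps_X ^ 16 * P 13" by (intro lef_mult P_mono) auto
  finally show ?thesis unfolding p23 by (intro lef_add lef_refl)
qed

text \<open>Here the negative term has the largest index, so monotonicity of \<open>P\<close> goes
  the wrong way. \<open>P_23_le\<close> bounds the excess of \<open>P 23\<close> over
  \<open>P 17\<close>, and its factor \<open>q^16\<close> is far more than needed for the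
  \<open>BB\<close> term to absorb it.\<close>

lemma pos_3_3:
  assumes "k \<ge> 2"
  shows "0 < (AA * (P 17 * K) + fps_X * (BB * (P 13 * K)) - CC * (P 23 * K)) $ k"
proof -
  define x where "x = int k"
  have xle: "x \<le> int k" by (simp add: x_def)
  let ?F = "ext (P 17 * K)" and ?F13 = "ext (P 13 * K)"
  have F: "incr ?F" "incr ?F13" by (rule incr_PK; simp)+
  have "ext (CC * (P 23 * K)) x \<le> ext (CC * (P 17 * K)) x + ext (fps_X ^ 16 * (CC * (P 13 * K))) x"
  proof -
    have "CC * (P 23 * K) \<sqsubseteq> CC * ((P 17 + fps_X ^ 16 * P 13) * K)"
      by (intro lef_mult lef_mult_right P_23_le nn_K nn_CC)
    also have "CC * ((P 17 + fps_X ^ 16 * P 13) * K) = CC * (P 17 * K) + fps_X ^ 16 * (CC * (P 13 * K))"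
      by (simp add: algebra_simps)
    finally have "ext (CC * (P 23 * K)) x \<le> ext (CC * (P 17 * K) + fps_X ^ 16 * (CC * (P 13 * K))) x"
      by (rule ext_lef)
    thus ?thesis by (simp add: ext_add)
  qed
  moreover have "ext (CC * (P 17 * K)) x + ?F (x - 2) \<le> ext (AA * (P 17 * K)) x"
    using C_le_A[OF F(1), of x k] using xle by (simp add: ext_AA[of x "k + 1"] ext_CC[of x "k + 1"])
  moreover have "ext (fps_X ^ 16 * (CC * (P 13 * K))) x \<le> ext (fps_X * (BB * (P 13 * K))) x"
    using C_le_B[OF F(2), of "x - 15" "x - 1" "k + 1"] unfolding ext_X_mult1 ext_X_mult
    using xle by (simp add: ext_BB[of "x - 1" "k + 1"] ext_CC[of "x - 16" "k + 1"])
  moreover have "1 \<le> ?F (x - 2)" by (rule PK_ge_1) (use assms in \<open>auto simp: x_def\<close>)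
  ultimately have "0 < ext (AA * (P 17 * K) + fps_X * (BB * (P 13 * K)) - CC * (P 23 * K)) x"
    unfolding ext_add ext_diff by linarith
  thus ?thesis by (simp add: x_def)
qed

section \<open>Two-sided bounds in terms of \<open>g 12\<close> and the two hardest classes\<close>

definition pol :: "nat \<Rightarrow> nat \<Rightarrow> real fps" where
  "pol a b = (\<Sum>i\<in>{a..<b}. fps_X ^ i)"

lemma nn_pol: "nn (pol a b)"
  unfolding pol_def nn_def fps_sum_nth by (auto intro!: sum_nonneg)

lemma ext_pol: "ext (pol a b * f) = blk (ext f) a b"
proof
  fix x
  have s: "ext (\<Sum>i\<in>A. t i) x = (\<Sum>i\<in>A. ext (t i) x)" for A :: "nat set" and t
    by (induction A rule: infinite_finite_induct) (auto simp: ext_add, auto simp: ext_def)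
  show "ext (pol a b * f) x = blk (ext f) a b x"
    unfolding pol_def sum_distrib_right s blk_def ext_X_mult ..
qed

lemma pol_split: "a \<le> b \<Longrightarrow> b \<le> d \<Longrightarrow> pol a d = pol a b + pol b d"
  unfolding pol_def by (rule sum.atLeastLessThan_concat[symmetric])

lemma pol_2: "pol a (a + 2) = fps_X ^ a * (1 + fps_X)"
  by (simp add: pol_def numeral_2_eq_2 algebra_simps)

lemma P_step_pol:
  assumes "0 < b" "b + 2 < 25"
  shows "P (b + 2) = P b + pol b (b + 2) * g (23 - b)"
  unfolding P_step[OF assms] pol_2 ..

text \<open>A step from an odd \<open>b' \<le> 11\<close> adds an entry with index
  \<open>23 - b' \<ge> 12\<close>; this is where the limit 13 and the entry \<open>g 12\<close>
  belong together.\<close>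

lemma P_diff_lower:
  assumes "odd a" "odd b" "a \<le> b" "b \<le> 13"
  shows "P a + pol a b * g 12 \<sqsubseteq> P b"
proof -
  have "even (b - a)" using assms by simp
  then obtain d where "b - a = 2 * d" by (elim evenE)
  hence b: "b = a + 2 * d" using assms by simp
  have a0: "0 < a" using assms by (auto intro: odd_pos)
  have "a + 2 * d \<le> 13 \<Longrightarrow> P a + pol a (a + 2 * d) * g 12 \<sqsubseteq> P (a + 2 * d)"
  proof (induction d)
    case 0
    show ?case by (simp add: pol_def)
  next
    case (Suc d)
    let ?b = "a + 2 * d"
    have "P a + pol a (?b + 2) * g 12 = (P a + pol a ?b * g 12) + pol ?b (?b + 2) * g 12"
      by (subst pol_split[of a ?b]) (auto simp: algebra_simps)
    also have "\<dots> \<sqsubseteq> P ?b + pol ?b (?b + 2) * g (23 - ?b)"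
      by (intro lef_add lef_mult G_mono nn_pol Suc.IH) (use Suc.prems assms in auto)
    also have "\<dots> = P (?b + 2)" by (rule P_step_pol[symmetric]) (use a0 Suc.prems in auto)
    finally show ?case by simp
  qed
  thus ?thesis using b assms by simp
qed

text \<open>\<open>P 1\<close> is \<open>g 24\<close> itself, and every later step adds entries
  below \<open>g 24\<close>.\<close>

lemma P_upper:
  assumes "odd b" "b \<le> 13"
  shows "P b \<sqsubseteq> pol 0 b * g 24"
proof -
  obtain d where "b = 2 * d + 1" using assms(1) by (elim oddE)
  hence b: "b = 1 + 2 * d" by simp
  have "1 + 2 * d \<le> 13 \<Longrightarrow> P (1 + 2 * d) \<sqsubseteq> pol 0 (1 + 2 * d) * g 24"
  proof (induction d)
    case 0
    show ?case using P_1 by (simp add: pol_def)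
  next
    case (Suc d)
    let ?b = "1 + 2 * d"
    have "P (?b + 2) = P ?b + pol ?b (?b + 2) * g (23 - ?b)"
      by (rule P_step_pol) (use Suc.prems in auto)
    also have "\<dots> \<sqsubseteq> pol 0 ?b * g 24 + pol ?b (?b + 2) * g 24"
      by (intro lef_add lef_mult G_mono nn_pol Suc.IH) (use Suc.prems in auto)
    also have "\<dots> = pol 0 (?b + 2) * g 24"
      using pol_split[of 0 ?b "?b + 2"] by (simp add: algebra_simps)
    finally show ?case by simp
  qed
  thus ?thesis using b assms by simp
qed

lemma ext_PK_le_blk:
  assumes "odd b" "b \<le> 13"
  shows "ext (P b * K) y \<le> blk (ext (g 12 * K)) 0 b y + blk (ext (g 12 * K)) 0 b (y - 24)"
proof -
  have "P b * K \<sqsubseteq> (pol 0 b * (g 12 + fps_X ^ 24 * g 12)) * K"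
    using assms by (intro lef_mult_right nn_K lef_trans[OF P_upper] lef_mult nn_pol g_24_le)
  also have "(pol 0 b * (g 12 + fps_X ^ 24 * g 12)) * K = pol 0 b * (g 12 * K) + fps_X ^ 24 * (pol 0 b * (g 12 * K))"
    by (simp add: algebra_simps)
  finally have "ext (P b * K) y \<le> ext (pol 0 b * (g 12 * K) + fps_X ^ 24 * (pol 0 b * (g 12 * K))) y"
    by (rule ext_lef)
  thus ?thesis by (simp add: ext_add ext_X_mult ext_pol)
qed

lemma incr2_h: "incr2 (ext (g 12 * K))"
  by (intro incr2_mult_K nn_g) auto

lemma h_pair_pos:
  assumes "1 \<le> x"
  shows "0 < ext (g 12 * K) x + ext (g 12 * K) (x - 1)"
proof -
  have z: "ext (g 12 * K) 0 = 1" using g_nth_0[of 12] by (simp add: ext_def)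
  have nn: "0 \<le> ext (g 12 * K) x" "0 \<le> ext (g 12 * K) (x - 1)" by (rule incr2_nonneg[OF incr2_h])+
  show ?thesis
  proof (cases "even x")
    case True
    have "1 \<le> ext (g 12 * K) x" by (rule incr2_ge_1[OF incr2_h z]) (use assms True in auto)
    thus ?thesis using nn by linarith
  next
    case False
    have "1 \<le> ext (g 12 * K) (x - 1)" by (rule incr2_ge_1[OF incr2_h z]) (use assms False in auto)
    thus ?thesis using nn by linarith
  qed
qed

lemma lef_K_pol: "P a + pol a b * g 12 \<sqsubseteq> P b \<Longrightarrow> P a * K + pol a b * (g 12 * K) \<sqsubseteq> P b * K"
  using lef_mult_right[OF nn_K] by (fastforce simp: algebra_simps)

text \<open>\<open>1 - q^2\<close> divides \<open>1 - q^6\<close> with a nonnegative quotient. This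
  lets a lower bound for \<open>P 7\<close> pass to the difference of \<open>P 7 * K\<close> at
  distance 6.\<close>

lemma nn_six_K: "nn ((1 - fps_X ^ 6) * K)"
proof -
  have "(1 - fps_X ^ 6 :: real fps) = (1 + fps_X ^ 2 + fps_X ^ 4) * (1 - fps_X ^ 2)"
    by (simp add: algebra_simps flip: power_add)
  hence "(1 - fps_X ^ 6) * K = (1 + fps_X ^ 2 + fps_X ^ 4) * ((1 - fps_X ^ 2) * K)"
    by (simp only: mult.assoc)
  moreover have "nn ((1 + fps_X ^ 2 + fps_X ^ 4) * ((1 - fps_X ^ 2) * K))"
    by (intro nn_mult nn_add nn_remove_K nn_X_power nn_1)
  ultimately show ?thesis by (simp only:)
qed

text \<open>The excess of \<open>P 13\<close> over \<open>P 7\<close> has to pay for the whole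
  \<open>CC\<close> term and for the losses in comparing \<open>AA\<close> with \<open>BB\<close> on
  \<open>P 7\<close>. Everything is expressed in blocks of coefficients of \<open>g 12 * K\<close>,
  and \<open>block_bound_1\<close> concludes.\<close>

lemma pos_3_2:
  assumes "1 \<le> x"
  shows "0 < ext (AA * (P 13 * K) - fps_X ^ 2 * (BB * (P 7 * K)) - fps_X ^ 4 * (CC * (P 3 * K))) x"
proof -
  define m where "m = nat x"
  have xle: "x \<le> int m" by (simp add: m_def)
  let ?h = "g 12 * K" and ?H = "ext (g 12 * K)" and ?F = "ext (P 7 * K)" and ?F3 = "ext (P 3 * K)"
  have F: "incr ?F" by (rule incr_PK) auto
  have "ext (AA * (P 7 * K)) x + ext (AA * (pol 7 13 * ?h)) x \<le> ext (AA * (P 13 * K)) x"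
  proof -
    have "AA * (P 7 * K + pol 7 13 * ?h) \<sqsubseteq> AA * (P 13 * K)"
      by (intro lef_mult nn_AA lef_K_pol P_diff_lower) auto
    hence "ext (AA * (P 7 * K + pol 7 13 * ?h)) x \<le> ext (AA * (P 13 * K)) x" by (rule ext_lef)
    thus ?thesis by (simp add: distrib_left ext_add)
  qed
  moreover have "ext (AA * (pol 7 13 * ?h)) x = Sm (m + 4) (blk ?H 7 13) eA1 x + Sm (m + 4) (blk ?H 7 13) eA2 x"
    using ext_AA[of x "m + 4" "pol 7 13 * ?h"] xle unfolding ext_pol by simp
  moreover have "?F x - ?F (x - 6) - ?F (x - 20) + ext (fps_X ^ 2 * (BB * (P 7 * K))) x \<le> ext (AA * (P 7 * K)) x"
    using A_minus_B_bound[OF F, of x m] unfolding ext_X_mult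
    using xle by (simp add: ext_AA[of x "m + 3"] ext_BB[of "x - 2" "m + 3"])
  \<comment> \<open>This difference is kept instead of being bounded by 0, since
    \<open>block_bound_1\<close> needs it.\<close>
  moreover have "blk ?H 0 7 x - blk ?H 0 7 (x - 6) \<le> ?F x - ?F (x - 6)"
  proof -
    have "pol 0 7 * g 12 = g 12 + pol 1 7 * g 12"
      using pol_split[of 0 1 7] by (simp add: distrib_right) (simp add: pol_def)
    also have "\<dots> \<sqsubseteq> P 1 + pol 1 7 * g 12"
      unfolding P_1 by (intro lef_add lef_refl G_mono) auto
    also have "\<dots> \<sqsubseteq> P 7" by (rule P_diff_lower) auto
    finally have "((1 - fps_X ^ 6) * K) * (pol 0 7 * g 12) \<sqsubseteq> ((1 - fps_X ^ 6) * K) * P 7"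
      by (intro lef_mult nn_six_K)
    moreover have "((1 - fps_X ^ 6) * K) * f = f * K - fps_X ^ 6 * (f * K)" for f
      by (simp add: algebra_simps)
    ultimately have "ext ((pol 0 7 * g 12) * K - fps_X ^ 6 * ((pol 0 7 * g 12) * K)) x \<le> ext (P 7 * K - fps_X ^ 6 * (P 7 * K)) x"
      by (simp only: ext_lef)
    thus ?thesis by (simp add: ext_diff ext_X_mult mult.assoc ext_pol)
  qed
  moreover have "?F (x - 20) \<le> blk ?H 0 7 (x - 20) + blk ?H 0 7 (x - 44)"
    using ext_PK_le_blk[of 7 "x - 20"] by simp
  moreover have "ext (fps_X ^ 4 * (CC * (P 3 * K))) x \<le> Sm (m + 4) (blk ?H 0 3) eC (x - 4) + Sm (m + 4) (blk ?H 0 3) eC (x - 28)"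
  proof -
    have "ext (fps_X ^ 4 * (CC * (P 3 * K))) x = Sm (m + 4) ?F3 eC (x - 4)"
      unfolding ext_X_mult using xle by (simp add: ext_CC[of "x - 4" "m + 4"])
    also have "\<dots> \<le> (\<Sum>j<m+4. blk ?H 0 3 (x - 4 - int (eC j)) + blk ?H 0 3 (x - 4 - int (eC j) - 24))"
      by (intro sum_mono ext_PK_le_blk) auto
    also have "\<dots> = Sm (m + 4) (blk ?H 0 3) eC (x - 4) + Sm (m + 4) (blk ?H 0 3) eC (x - 28)"
      unfolding sum.distrib by (intro arg_cong2[where f = "(+)"] sum.cong refl arg_cong[where f = "blk ?H 0 3"]) simp
    finally show ?thesis .
  qed
  moreover have "?H x + ?H (x - 1) + blk ?H 0 7 (x - 6) + blk ?H 0 7 (x - 20) + blk ?H 0 7 (x - 44)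
      + Sm (m + 4) (blk ?H 0 3) eC (x - 4) + Sm (m + 4) (blk ?H 0 3) eC (x - 28)
    \<le> blk ?H 0 7 x + Sm (m + 4) (blk ?H 7 13) eA1 x + Sm (m + 4) (blk ?H 7 13) eA2 x"
    by (rule block_bound_1[OF incr2_h])
  moreover have "0 < ?H x + ?H (x - 1)" using assms by (rule h_pair_pos)
  ultimately show ?thesis unfolding ext_diff by linarith
qed

text \<open>\<open>P 17\<close> is lowered to \<open>P 7\<close> plus blocks of \<open>g 12\<close>.
  The part \<open>P 3\<close> of \<open>P 7\<close> pays for the \<open>AA\<close> term up to one
  coefficient; the remainder of \<open>P 7\<close> and the blocks pay for the \<open>CC\<close>
  term.\<close>

lemma pos_3_4:
  assumes "k \<ge> 5"
  shows "0 < (BB * (P 17 * K) - fps_X ^ 4 * (AA * (P 3 * K)) - fps_X ^ 3 * (CC * (P 7 * K))) $ k"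
proof -
  define x where "x = int k"
  have xle: "x \<le> int k" by (simp add: x_def)
  let ?h = "g 12 * K" and ?H = "ext (g 12 * K)" and ?F3 = "ext (P 3 * K)"
  have F: "incr ?F3" by (rule incr_PK) auto
  \<comment> \<open>\<open>R\<close> occurs both with \<open>BB\<close> and, negatively, with
    \<open>CC\<close>. As \<open>(BB - q^3 CC) K\<close> is nonnegative, a lower bound for
    \<open>R\<close> alone handles both occurrences.\<close>
  define R where "R = P 7 - P 3"
  have P7: "P 7 * K = P 3 * K + R * K" by (simp add: R_def algebra_simps)
  have pols: "ext (BB * (pol a b * ?h)) x = Sm (k + 2) (blk ?H a b) eB1 x + Sm (k + 2) (blk ?H a b) eB2 x" for a b
    using ext_BB[of x "k + 2" "pol a b * ?h"] xle unfolding ext_pol by simp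
  have split: "Sm (k + 2) (blk ?H 3 13) e x = Sm (k + 2) (blk ?H 3 7) e x + Sm (k + 2) (blk ?H 7 13) e x" for e
    unfolding sum.distrib[symmetric] by (intro sum.cong refl blk_split) auto
  have "ext (BB * (P 7 * K)) x + ext (BB * (pol 7 13 * ?h)) x \<le> ext (BB * (P 17 * K)) x"
  proof -
    have "BB * (P 7 * K + pol 7 13 * ?h) \<sqsubseteq> BB * (P 13 * K)"
      by (intro lef_mult nn_BB lef_K_pol P_diff_lower) auto
    also have "\<dots> \<sqsubseteq> BB * (P 17 * K)"
      by (intro lef_mult nn_BB lef_mult_right nn_K P_mono) auto
    finally have "ext (BB * (P 7 * K + pol 7 13 * ?h)) x \<le> ext (BB * (P 17 * K)) x" by (rule ext_lef)
    thus ?thesis by (simp add: distrib_left ext_add)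
  qed
  moreover have "ext (BB * (P 7 * K)) x = ext (BB * (P 3 * K)) x + ext (BB * (R * K)) x"
    unfolding P7 distrib_left ext_add ..
  moreover have "ext (fps_X ^ 3 * (CC * (P 7 * K))) x = ext (fps_X ^ 3 * (CC * (P 3 * K))) x + ext (fps_X ^ 3 * (CC * (R * K))) x"
    unfolding P7 distrib_left ext_add ..
  moreover have "ext (BB * (pol 3 7 * ?h)) x - ext (fps_X ^ 3 * (CC * (pol 3 7 * ?h))) x \<le> ext (BB * (R * K)) x - ext (fps_X ^ 3 * (CC * (R * K))) x"
  proof -
    have "nn ((BB - fps_X ^ 3 * CC) * K)"
      unfolding nn_def
    proof
      fix i
      have "incr2 (ext (1 * K))" by (rule incr2_mult_K) simp
      hence "Sm (i + 1) (ext K) eC (int i - 3) \<le> Sm (i + 1) (ext K) eB1 (int i) + Sm (i + 1) (ext K) eB2 (int i)"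
        by (intro C_le_B_parity) simp
      hence "0 \<le> ext (BB * K) (int i) - ext (CC * K) (int i - 3)"
        using ext_BB[of "int i" "i + 1" K] ext_CC[of "int i - 3" "i + 1" K] by linarith
      also have "\<dots> = ext ((BB - fps_X ^ 3 * CC) * K) (int i)"
        by (simp only: left_diff_distrib ext_diff mult.assoc ext_X_mult of_nat_numeral)
      finally show "0 \<le> ((BB - fps_X ^ 3 * CC) * K) $ i" by simp
    qed
    moreover have "pol 3 7 * g 12 \<sqsubseteq> R"
      using P_diff_lower[of 3 7] by (simp add: R_def lef_def algebra_simps)
    ultimately have "((BB - fps_X ^ 3 * CC) * K) * (pol 3 7 * g 12) \<sqsubseteq> ((BB - fps_X ^ 3 * CC) * K) * R"
      by (rule lef_mult)
    moreover have "((BB - fps_X ^ 3 * CC) * K) * f = BB * (f * K) - fps_X ^ 3 * (CC * (f * K))" for f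
      by (simp add: algebra_simps)
    ultimately have "ext (BB * ((pol 3 7 * g 12) * K) - fps_X ^ 3 * (CC * ((pol 3 7 * g 12) * K))) x \<le> ext (BB * (R * K) - fps_X ^ 3 * (CC * (R * K))) x"
      by (simp only: ext_lef)
    thus ?thesis by (simp only: ext_diff mult.assoc)
  qed
  moreover note pols[of 3 7] pols[of 7 13] split[of eB1] split[of eB2]
  moreover have "ext (fps_X ^ 3 * (CC * (pol 3 7 * ?h))) x = Sm (k + 2) (blk ?H 3 7) eC (x - 3)"
    using ext_CC[of "x - 3" "k + 2" "pol 3 7 * ?h"] xle unfolding ext_pol ext_X_mult by simp
  moreover have "Sm (k + 2) (blk ?H 0 7) eC (x - 3) = Sm (k + 2) (blk ?H 0 3) eC (x - 3) + Sm (k + 2) (blk ?H 3 7) eC (x - 3)"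
    unfolding sum.distrib[symmetric] by (intro sum.cong refl blk_split) auto
  moreover have "ext (fps_X ^ 4 * (AA * (P 3 * K))) x \<le> ext (BB * (P 3 * K)) x + ?F3 (x - 7)"
    using A_le_B_plus[OF F, of x k] unfolding ext_X_mult
    using xle by (simp add: ext_AA[of "x - 4" "k + 2"] ext_BB[of x "k + 2"])
  moreover have "?F3 (x - 7) \<le> blk ?H 0 3 (x - 7) + blk ?H 0 3 (x - 31)"
    using ext_PK_le_blk[of 3 "x - 7"] by simp
  moreover have "ext (fps_X ^ 3 * (CC * (P 3 * K))) x \<le> Sm (k + 2) (blk ?H 0 3) eC (x - 3) + Sm (k + 2) (blk ?H 0 3) eC (x - 27)"
  proof -
    have "ext (fps_X ^ 3 * (CC * (P 3 * K))) x = Sm (k + 2) ?F3 eC (x - 3)"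
      unfolding ext_X_mult using xle by (simp add: ext_CC[of "x - 3" "k + 2"])
    also have "\<dots> \<le> (\<Sum>j<k+2. blk ?H 0 3 (x - 3 - int (eC j)) + blk ?H 0 3 (x - 3 - int (eC j) - 24))"
      by (intro sum_mono ext_PK_le_blk) auto
    also have "\<dots> = Sm (k + 2) (blk ?H 0 3) eC (x - 3) + Sm (k + 2) (blk ?H 0 3) eC (x - 27)"
      unfolding sum.distrib by (intro arg_cong2[where f = "(+)"] sum.cong refl arg_cong[where f = "blk ?H 0 3"]) simp
    finally show ?thesis .
  qed
  moreover have "?H (x - 4) + ?H (x - 5) + blk ?H 0 3 (x - 7) + blk ?H 0 3 (x - 31)
      + Sm (k + 2) (blk ?H 0 7) eC (x - 3) + Sm (k + 2) (blk ?H 0 3) eC (x - 27)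
    \<le> Sm (k + 2) (blk ?H 3 13) eB1 x + Sm (k + 2) (blk ?H 3 13) eB2 x"
    by (rule block_bound_2[OF incr2_h])
  moreover have "0 < ?H (x - 4) + ?H (x - 5)" using h_pair_pos[of "x - 4"] assms by (simp add: x_def)
  ultimately have "0 < ext (BB * (P 17 * K) - fps_X ^ 4 * (AA * (P 3 * K)) - fps_X ^ 3 * (CC * (P 7 * K))) x"
    unfolding ext_diff by linarith
  thus ?thesis by (simp add: x_def)
qed

section \<open>Positivity of the odd classes\<close>

definition U :: "real fps" where "U = J 2 * inverse (J 1)"

text \<open>Euler's series for partitions into odd parts. It contains the part 1, so
  \<open>P b * U\<close> is nondecreasing even for \<open>b = 1\<close>.\<close>

lemma U_eq: "U = inverse (PR (cl 2 {1}))"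
proof -
  have "J 1 = PR (cl 2 {1} \<union> cl 2 {0})" unfolding J_def by (rule PR_cong) auto
  also have "\<dots> = PR (cl 2 {1}) * J 2" unfolding J_def by (rule PR_Un) auto
  finally have "inverse (J 1) = inverse (PR (cl 2 {1})) * inverse (J 2)" by (simp add: fps_inverse_mult)
  moreover have "J 2 * inverse (J 2) = 1" by (rule inverse_mult_eq_1') simp
  ultimately show ?thesis by (simp add: U_def mult.left_commute)
qed

lemma PU_ge_1:
  assumes "0 < b" "b < 25"
  shows "1 \<le> (P b * U) $ k"
proof -
  have "(1 - fps_X ^ 1) * inverse (PR (cl 2 {1})) = inverse (PR (cl 2 {1} - {1}))"
    by (rule inverse_PR_remove) auto
  hence "nn (P b * ((1 - fps_X) * U))" using assms by (simp add: U_eq nn_mult nn_P nn_inverse_PR)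
  hence "nn ((1 - fps_X) * (P b * U))" by (simp only: mult.left_commute)
  hence "incr (ext (P b * U))" by (rule incr_ext)
  hence "ext (P b * U) 0 \<le> ext (P b * U) (int k)" by (rule incrD) simp
  thus ?thesis using assms by (simp add: ext_def P_nth_0 U_eq)
qed

section \<open>The first coefficients\<close>

definition qt :: "nat \<Rightarrow> nat \<Rightarrow> real fps" where
  "qt a b = theta 10 a * inverse (theta 10 b)"

text \<open>The range of \<open>m\<close> is the smallest symmetric one that covers all exponents
  below 110: at \<open>m = 5\<close> one has 105 for \<open>a = 1\<close>, and for
  \<open>|m| \<ge> 6\<close> at least 156.\<close>

definition theta_terms :: "nat \<Rightarrow> (nat \<times> int) list" where
  "theta_terms a = map (\<lambda>m. (thex 10 a m, if even m then 1 else -1)) [-5..5]"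

text \<open>
  The coefficients are listed in reverse order, so that the entry at position \<open>e - 1\<close> of the list
  for \<open>n\<close> is the coefficient with index \<open>n - e\<close>.
\<close>

primrec quotient_coeffs :: "(nat \<times> int) list \<Rightarrow> (nat \<times> int) list \<Rightarrow> nat \<Rightarrow> int list" where
  "quotient_coeffs a b 0 = []"
| "quotient_coeffs a b (Suc n) = (let xs = quotient_coeffs a b n in
     (sum_list (map (\<lambda>(e, s). if e = n then s else 0) a)
      - sum_list (map (\<lambda>(e, s). if 0 < e \<and> e \<le> n then s * xs ! (e - 1) else 0) b)) # xs)"

text \<open>In a reversed list the head \<open>v\<close> has index \<open>length xs\<close>.\<close>

primrec check_signs :: "nat list \<Rightarrow> nat list \<Rightarrow> int list \<Rightarrow> bool" where
  "check_signs Z R [] = True"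
| "check_signs Z R (v # xs) = ((if length xs \<in> set Z then v = 0
     else sgn v = (if length xs mod 10 \<in> set R then 1 else -1)) \<and> check_signs Z R xs)"

lemma thex_small:
  assumes "a \<in> {1, 3}" "thex 10 a m < 110"
  shows "m \<in> {-5..5}"
proof (rule ccontr)
  assume "m \<notin> {-5..5}"
  hence "6 \<le> \<bar>m\<bar>" by auto
  hence "6 * \<bar>m\<bar> \<le> \<bar>m\<bar> * \<bar>m\<bar>" by (intro mult_right_mono) auto
  hence m: "6 * \<bar>m\<bar> \<le> m * m" by (simp add: abs_mult[symmetric])
  have "5 * (m * m) - 4 * \<bar>m\<bar> \<le> int (thex 10 a m)"
    using assms thex_10[of a m] by (auto simp: mult.assoc)
  thus False using m assms \<open>6 \<le> \<bar>m\<bar>\<close> by linarith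
qed

lemma sum_terms:
  "(\<Sum>m\<in>{-5..5}. F (thex 10 a m) * sg m) = sum_list (map (\<lambda>(e, s). F e * real_of_int s) (theta_terms a))"
proof -
  have "(\<Sum>m\<in>{-5..5}. F (thex 10 a m) * sg m) = (\<Sum>m\<in>set [-5..5]. F (thex 10 a m) * sg m)"
    by (simp only: set_upto)
  also have "\<dots> = sum_list (map (\<lambda>m. F (thex 10 a m) * sg m) [-5..5])"
    by (rule sum.distinct_set_conv_list) simp
  also have "map (\<lambda>m. F (thex 10 a m) * sg m) [-5..5] = map (\<lambda>(e, s). F e * real_of_int s) (theta_terms a)"
    unfolding theta_terms_def map_map by (intro map_cong) (auto simp: sg_def)
  finally show ?thesis .
qed

lemma theta_small:
  assumes "a \<in> {1, 3}" "n < 110"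
  shows "theta 10 a $ n = (\<Sum>m\<in>{-5..5}. (if thex 10 a m = n then 1 else 0) * sg m)"
proof -
  have "theta 10 a $ n = (\<Sum>m\<in>{m \<in> {-5..5}. thex 10 a m = n}. sg m)"
    unfolding theta_def gf_nth
    by (rule sum.cong) (use thex_small[OF assms(1)] assms(2) in auto)
  also have "\<dots> = (\<Sum>m\<in>{-5..5}. if thex 10 a m = n then sg m else 0)"
    by (rule sum.inter_filter) simp
  also have "\<dots> = (\<Sum>m\<in>{-5..5}. (if thex 10 a m = n then 1 else 0) * sg m)"
    by (intro sum.cong) auto
  finally show ?thesis .
qed

text \<open>The coefficient of \<open>qt a b * theta 10 b = theta 10 a\<close> at \<open>n\<close>,
  solved for the summand with \<open>m = 0\<close>. The condition \<open>0 < thex 10 b m\<close>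
  excludes exactly this summand from the second sum.\<close>

lemma qt_rec:
  assumes "a \<in> {1, 3}" "b \<in> {1, 3}" "n < 110"
  shows "qt a b $ n = (\<Sum>m\<in>{-5..5}. (if thex 10 a m = n then 1 else 0) * sg m)
    - (\<Sum>m\<in>{-5..5}. (if 0 < thex 10 b m \<and> thex 10 b m \<le> n then qt a b $ (n - thex 10 b m) else 0) * sg m)"
proof -
  have b: "0 < b" "b < 10" using assms by auto
  have "theta 10 b $ 0 = 1" using assms by (intro theta_nth_0) auto
  hence "theta 10 b * inverse (theta 10 b) = 1" by (intro inverse_mult_eq_1') simp
  hence "theta 10 b * qt a b = theta 10 a" by (simp add: qt_def mult.left_commute)
  hence "theta 10 a $ n = (theta 10 b * qt a b) $ n" by simp
  also have "\<dots> = (\<Sum>m | m \<in> UNIV \<and> thex 10 b m \<le> n. sg m * qt a b $ (n - thex 10 b m))"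
    unfolding theta_def by (rule gf_mult_nth[OF adm_thex[OF b]])
  also have "{m. m \<in> UNIV \<and> thex 10 b m \<le> n} = {m \<in> {-5..5}. thex 10 b m \<le> n}"
  proof -
    have "m \<in> {-5..5}" if "thex 10 b m \<le> n" for m
      by (rule thex_small[OF assms(2)]) (use that assms(3) in linarith)
    thus ?thesis by auto
  qed
  also have "(\<Sum>m\<in>\<dots>. sg m * qt a b $ (n - thex 10 b m)) =
      (\<Sum>m\<in>{-5..5}. if thex 10 b m \<le> n then sg m * qt a b $ (n - thex 10 b m) else 0)"
    by (rule sum.inter_filter) simp
  also have "\<dots> = qt a b $ n + (\<Sum>m\<in>{-5..5} - {0}. if thex 10 b m \<le> n then sg m * qt a b $ (n - thex 10 b m) else 0)"
    by (subst sum.remove[of _ 0]) (auto simp: thex_def sg_def)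
  also have "(\<Sum>m\<in>{-5..5} - {0}. if thex 10 b m \<le> n then sg m * qt a b $ (n - thex 10 b m) else 0) =
      (\<Sum>m\<in>{-5..5}. (if 0 < thex 10 b m \<and> thex 10 b m \<le> n then qt a b $ (n - thex 10 b m) else 0) * sg m)"
  proof (rule sum.mono_neutral_cong_left)
    show "\<forall>i\<in>{-5..5} - ({-5..5} - {0}). (if 0 < thex 10 b i \<and> thex 10 b i \<le> n then qt a b $ (n - thex 10 b i) else 0) * sg i = 0"
      by (auto simp: thex_def)
    fix m :: int assume "m \<in> {-5..5} - {0}"
    hence "0 < thex 10 b m" using thex_ge[OF b, of m] by auto
    thus "(if thex 10 b m \<le> n then sg m * qt a b $ (n - thex 10 b m) else 0) =
      (if 0 < thex 10 b m \<and> thex 10 b m \<le> n then qt a b $ (n - thex 10 b m) else 0) * sg m" by simp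
  qed auto
  finally show ?thesis unfolding theta_small[OF assms(1,3)] by simp
qed

lemma quotient_coeffs_correct:
  assumes "a \<in> {1, 3}" "b \<in> {1, 3}" "n \<le> 110"
  shows "length (quotient_coeffs (theta_terms a) (theta_terms b) n) = n \<and>
    (\<forall>i<n. real_of_int (quotient_coeffs (theta_terms a) (theta_terms b) n ! i) = qt a b $ (n - 1 - i))"
  using assms(3)
proof (induction n)
  case (Suc n)
  define xs where "xs = quotient_coeffs (theta_terms a) (theta_terms b) n"
  have xs: "length xs = n" "\<And>i. i < n \<Longrightarrow> real_of_int (xs ! i) = qt a b $ (n - 1 - i)"
    using Suc by (auto simp: xs_def)
  define v where "v = sum_list (map (\<lambda>(e, s). if e = n then s else 0) (theta_terms a))
      - sum_list (map (\<lambda>(e, s). if 0 < e \<and> e \<le> n then s * xs ! (e - 1) else 0) (theta_terms b))"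
  have r: "quotient_coeffs (theta_terms a) (theta_terms b) (Suc n) = v # xs"
    by (simp only: quotient_coeffs.simps Let_def v_def xs_def)
  have sl: "real_of_int (sum_list ys) = sum_list (map real_of_int ys)" for ys
    by (induction ys) auto
  have "real_of_int v = sum_list (map (\<lambda>(e, s). (if e = n then 1 else 0) * real_of_int s) (theta_terms a))
      - sum_list (map (\<lambda>(e, s). (if 0 < e \<and> e \<le> n then qt a b $ (n - e) else 0) * real_of_int s) (theta_terms b))"
    unfolding v_def of_int_diff sl map_map
    by (intro arg_cong2[where f = "(-)"] arg_cong[where f = sum_list] map_cong) (auto simp: xs(2))
  also have "\<dots> = qt a b $ n"
    unfolding sum_terms[of "\<lambda>e. if e = n then 1 else 0" a, symmetric]
      sum_terms[of "\<lambda>e. if 0 < e \<and> e \<le> n then qt a b $ (n - e) else 0" b, symmetric]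
    by (rule qt_rec[symmetric]) (use assms Suc.prems in auto)
  finally have v: "real_of_int v = qt a b $ n" .
  have "real_of_int ((v # xs) ! i) = qt a b $ (Suc n - 1 - i)" if "i < Suc n" for i
    using that v xs(2)[of "i - 1"] by (cases i) auto
  thus ?case unfolding r using xs(1) by simp
qed simp

lemma check_signs_nth:
  assumes "check_signs Z R xs" "i < length xs" "n = length xs - 1 - i"
  shows "(n \<in> set Z \<longrightarrow> xs ! i = 0) \<and> (n \<notin> set Z \<longrightarrow> sgn (xs ! i) = (if n mod 10 \<in> set R then 1 else -1))"
  using assms
proof (induction xs arbitrary: i)
  case (Cons v xs)
  show ?case
  proof (cases i)
    case 0
    thus ?thesis using Cons.prems by (auto split: if_splits)
  next
    case (Suc j)
    thus ?thesis using Cons.IH[of j] Cons.prems by simp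
  qed
qed simp

lemma small_coeffs:
  assumes "a \<in> {1, 3}" "b \<in> {1, 3}" "check_signs Z R (quotient_coeffs (theta_terms a) (theta_terms b) 110)" "n < 110"
  shows "(n \<in> set Z \<longrightarrow> qt a b $ n = 0) \<and>
    (n \<notin> set Z \<longrightarrow> sgn (qt a b $ n) = (if n mod 10 \<in> set R then 1 else -1))"
proof -
  let ?xs = "quotient_coeffs (theta_terms a) (theta_terms b) 110"
  have r: "length ?xs = 110" "real_of_int (?xs ! (109 - n)) = qt a b $ n"
    using quotient_coeffs_correct[of a b 110] assms by auto
  have "sgn (real_of_int z) = real_of_int (sgn z)" for z by (simp add: sgn_if)
  thus ?thesis
    using check_signs_nth[OF assms(3), of "109 - n" n] r assms(4) by (auto simp: r(2)[symmetric])
qed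

lemma check_signs_1: "check_signs [2, 5, 7, 9, 15, 17, 22, 27, 37, 47] [0, 2, 3, 6, 9] (quotient_coeffs (theta_terms 1) (theta_terms 3) 110)"
  by code_simp

lemma check_signs_3: "check_signs [3, 4, 5, 6, 9, 13, 19, 23, 29, 39] [0, 1, 2, 3, 9] (quotient_coeffs (theta_terms 3) (theta_terms 1) 110)"
  by code_simp

section \<open>The sign pattern\<close>

lemma qt_even:
  assumes "(a, b) \<in> {(1, 3), (3, 1)}" "s < 5"
  shows "qt a b $ (10 * k + 2 * s) = (sec 5 s (psi * theta 10 a) * (inverse (J 1) * K)) $ k"
proof -
  have "sec 5 s (sec 2 0 (qt a b)) = sec 5 s (psi * theta 10 a) * (inverse (J 1) * K)"
    unfolding qt_def by (rule sec5_quotient(1)) (use assms in auto)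
  moreover have "qt a b $ (10 * k + 2 * s) = sec 5 s (sec 2 0 (qt a b)) $ k" by (simp add: algebra_simps)
  ultimately show ?thesis by (simp only:)
qed

lemma qt_odd:
  assumes "(a, b) \<in> {(1, 3), (3, 1)}" "s < 5"
  shows "qt a b $ (10 * k + (2 * s + 1)) = (if a = 1 then -1 else 1) * (sec 5 s (theta 10 a) * (inverse (J 1) * U)) $ k"
proof -
  have "sec 5 s (sec 2 1 (qt a b)) = fps_const (if a = 1 then -1 else 1) * (sec 5 s (theta 10 a) * (inverse (J 1) * U))"
    unfolding qt_def U_def by (rule sec5_quotient(2)) (use assms in auto)
  moreover have "qt a b $ (10 * k + (2 * s + 1)) = sec 5 s (sec 2 1 (qt a b)) $ k" by (simp add: algebra_simps)
  ultimately show ?thesis by (simp only: fps_mult_left_const_nth)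
qed

lemma theta_PK: "theta 50 b * (inverse (J 1) * f) = P b * f"
  by (simp add: P_def mult.assoc)

lemma distribute:
  "(f + f') * (inverse (J 1) * l) = f * (inverse (J 1) * l) + f' * (inverse (J 1) * l)"
  "(f - f') * (inverse (J 1) * l) = f * (inverse (J 1) * l) - f' * (inverse (J 1) * l)"
  "(fps_X ^ e * f) * (inverse (J 1) * l) = fps_X ^ e * (f * (inverse (J 1) * l))"
  "(fps_X * f) * (inverse (J 1) * l) = fps_X * (f * (inverse (J 1) * l))"
  "(AA * f) * (inverse (J 1) * l) = AA * (f * (inverse (J 1) * l))"
  "(BB * f) * (inverse (J 1) * l) = BB * (f * (inverse (J 1) * l))"
  "(CC * f) * (inverse (J 1) * l) = CC * (f * (inverse (J 1) * l))"
  "(- f) * (inverse (J 1) * l) = - (f * (inverse (J 1) * l))"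
  by (simp_all add: algebra_simps)

lemma signs_1_even:
  assumes "k \<ge> 11"
  shows "qt 1 3 $ (10 * k) > 0" "qt 1 3 $ (10 * k + 2) > 0" "qt 1 3 $ (10 * k + 4) < 0"
    "qt 1 3 $ (10 * k + 6) > 0" "qt 1 3 $ (10 * k + 8) < 0"
  using qt_even[of 1 3 0 k] qt_even[of 1 3 1 k] qt_even[of 1 3 2 k] qt_even[of 1 3 3 k] qt_even[of 1 3 4 k]
    pos_1_0[of k] pos_1_1[of k] pos_1_2[of k] pos_1_3[of k] pos_1_4[of k] assms
  unfolding sec5_psi_theta_1 distribute theta_PK by simp_all

lemma signs_3_even:
  assumes "k \<ge> 11"
  shows "qt 3 1 $ (10 * k) > 0" "qt 3 1 $ (10 * k + 2) > 0" "qt 3 1 $ (10 * k + 4) < 0"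
    "qt 3 1 $ (10 * k + 6) < 0" "qt 3 1 $ (10 * k + 8) < 0"
proof -
  \<comment> \<open>This class has a common factor \<open>q\<close>, hence \<open>pos_3_2\<close> is
    used at \<open>k - 1\<close>.\<close>
  have "0 < (fps_X * (AA * (P 13 * K)) - fps_X ^ 3 * (BB * (P 7 * K)) - fps_X ^ 5 * (CC * (P 3 * K))) $ k"
  proof -
    have "fps_X * (AA * (P 13 * K)) - fps_X ^ 3 * (BB * (P 7 * K)) - fps_X ^ 5 * (CC * (P 3 * K)) =
       fps_X * (AA * (P 13 * K) - fps_X ^ 2 * (BB * (P 7 * K)) - fps_X ^ 4 * (CC * (P 3 * K)))"
      by (simp add: right_diff_distrib mult.assoc[symmetric] power_Suc[symmetric] eval_nat_numeral)
    thus ?thesis using pos_3_2[of "int k - 1"] assms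
      by (simp only: ext_int[symmetric] ext_X_mult1)
  qed
  thus "qt 3 1 $ (10 * k) > 0" "qt 3 1 $ (10 * k + 2) > 0" "qt 3 1 $ (10 * k + 4) < 0"
    "qt 3 1 $ (10 * k + 6) < 0" "qt 3 1 $ (10 * k + 8) < 0"
    using qt_even[of 3 1 0 k] qt_even[of 3 1 1 k] qt_even[of 3 1 2 k] qt_even[of 3 1 3 k] qt_even[of 3 1 4 k]
      pos_3_0[of k] pos_3_1[of k] pos_3_3[of k] pos_3_4[of k] assms
    unfolding sec5_psi_theta_3 distribute theta_PK by simp_all
qed

lemma PU_pos: "0 < b \<Longrightarrow> b < 25 \<Longrightarrow> 0 < (P b * U) $ k"
  using PU_ge_1[of b k] by simp

text \<open>Each component is a power of \<open>q\<close> times \<open>P b * U\<close> up to sign;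
  the powers are at most 5, so \<open>k \<ge> 11\<close> is beyond all of them.\<close>

lemma signs_1_odd:
  assumes "k \<ge> 11"
  shows "qt 1 3 $ (10 * k + 1) < 0" "qt 1 3 $ (10 * k + 3) > 0" "qt 1 3 $ (10 * k + 5) < 0"
    "qt 1 3 $ (10 * k + 7) < 0" "qt 1 3 $ (10 * k + 9) > 0"
  using qt_odd[of 1 3 0 k] qt_odd[of 1 3 1 k] qt_odd[of 1 3 2 k] qt_odd[of 1 3 3 k] qt_odd[of 1 3 4 k]
    PU_pos[of 21 k] PU_pos[of 19 k] PU_pos[of 9 "k - 2"] PU_pos[of 1 "k - 5"] PU_pos[of 11 "k - 1"] assms
  unfolding sec5_theta_1 distribute theta_PK by (simp_all add: fps_X_power_mult_nth)

lemma signs_3_odd: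
  assumes "k \<ge> 11"
  shows "qt 3 1 $ (10 * k + 1) > 0" "qt 3 1 $ (10 * k + 3) > 0" "qt 3 1 $ (10 * k + 5) < 0"
    "qt 3 1 $ (10 * k + 7) < 0" "qt 3 1 $ (10 * k + 9) > 0"
  using qt_odd[of 3 1 0 k] qt_odd[of 3 1 1 k] qt_odd[of 3 1 2 k] qt_odd[of 3 1 3 k] qt_odd[of 3 1 4 k]
    PU_pos[of 23 k] PU_pos[of 7 "k - 3"] PU_pos[of 13 "k - 1"] PU_pos[of 17 k] PU_pos[of 3 "k - 4"] assms
  unfolding sec5_theta_3 distribute theta_PK by (simp_all add: fps_X_power_mult_nth)

lemma mod_10_cases:
  obtains "n = 10 * (n div 10)" "n mod 10 = 0" | "n = 10 * (n div 10) + 1" "n mod 10 = 1"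
  | "n = 10 * (n div 10) + 2" "n mod 10 = 2" | "n = 10 * (n div 10) + 3" "n mod 10 = 3"
  | "n = 10 * (n div 10) + 4" "n mod 10 = 4" | "n = 10 * (n div 10) + 5" "n mod 10 = 5"
  | "n = 10 * (n div 10) + 6" "n mod 10 = 6" | "n = 10 * (n div 10) + 7" "n mod 10 = 7"
  | "n = 10 * (n div 10) + 8" "n mod 10 = 8" | "n = 10 * (n div 10) + 9" "n mod 10 = (9 :: nat)"
proof -
  have "n = 10 * (n div 10) + n mod 10" "n mod 10 < 10" by simp_all
  moreover from this(2) have "n mod 10 \<in> {0,1,2,3,4,5,6,7,8,9}" by (simp only: insert_iff empty_iff) arith
  ultimately show ?thesis using that by (elim insertE) auto
qed

lemma large_1:
  assumes "110 \<le> n"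
  shows "sgn (qt 1 3 $ n) = (if n mod 10 \<in> {0, 2, 3, 6, 9} then 1 else -1)"
proof -
  have k: "11 \<le> n div 10" using assms by simp
  show ?thesis
    by (cases n rule: mod_10_cases)
       (use signs_1_even[OF k] signs_1_odd[OF k] in \<open>simp_all add: sgn_if\<close>)
qed

lemma large_3:
  assumes "110 \<le> n"
  shows "sgn (qt 3 1 $ n) = (if n mod 10 \<in> {0, 1, 2, 3, 9} then 1 else -1)"
proof -
  have k: "11 \<le> n div 10" using assms by simp
  show ?thesis
    by (cases n rule: mod_10_cases)
       (use signs_3_even[OF k] signs_3_odd[OF k] in \<open>simp_all add: sgn_if\<close>)
qed

theorem theorem1p2:
  shows "(\<forall>n::nat.
            (n \<in> {2, 5, 7, 9, 15, 17, 22, 27, 37, 47} \<longrightarrow> c 1 n = 0) \<and>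
            (n \<notin> {2, 5, 7, 9, 15, 17, 22, 27, 37, 47} \<longrightarrow>
               sgn (c 1 n) = (if n mod 10 \<in> {0, 2, 3, 6, 9} then 1 else -1))) \<and>
         (\<forall>n::nat.
            (n \<in> {3, 4, 5, 6, 9, 13, 19, 23, 29, 39} \<longrightarrow> c (-1) n = 0) \<and>
            (n \<notin> {3, 4, 5, 6, 9, 13, 19, 23, 29, 39} \<longrightarrow>
               sgn (c (-1) n) = (if n mod 10 \<in> {0, 1, 2, 3, 9} then 1 else -1)))"
proof -
  have c: "c 1 n = qt 1 3 $ n" "c (-1) n = qt 3 1 $ n" for n
    by (simp_all only: c_one c_minus_one qt_def)
  have 1: "(n \<in> {2, 5, 7, 9, 15, 17, 22, 27, 37, 47} \<longrightarrow> qt 1 3 $ n = 0) \<and>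
      (n \<notin> {2, 5, 7, 9, 15, 17, 22, 27, 37, 47} \<longrightarrow>
        sgn (qt 1 3 $ n) = (if n mod 10 \<in> {0, 2, 3, 6, 9} then 1 else -1))" for n
  proof (cases "n < 110")
    case True
    show ?thesis using small_coeffs[OF _ _ check_signs_1 True] by simp
  next
    case False
    hence "n \<notin> {2, 5, 7, 9, 15, 17, 22, 27, 37, 47}" by auto
    thus ?thesis using large_1[of n] False by simp
  qed
  have 2: "(n \<in> {3, 4, 5, 6, 9, 13, 19, 23, 29, 39} \<longrightarrow> qt 3 1 $ n = 0) \<and>
      (n \<notin> {3, 4, 5, 6, 9, 13, 19, 23, 29, 39} \<longrightarrow>
        sgn (qt 3 1 $ n) = (if n mod 10 \<in> {0, 1, 2, 3, 9} then 1 else -1))" for n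
  proof (cases "n < 110")
    case True
    show ?thesis using small_coeffs[OF _ _ check_signs_3 True] by simp
  next
    case False
    hence "n \<notin> {3, 4, 5, 6, 9, 13, 19, 23, 29, 39}" by auto
    thus ?thesis using large_3[of n] False by simp
  qed
  show ?thesis unfolding c using 1 2 by (intro conjI allI) blast+
qed

end
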